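(* Let $n>m\geq 2$ and $t\geq 1$ be integers, let $K$ be a field, $S=K[x_1,\ldots,x_n]$, and let $J_{n,m}\subset S$ be the $m$-path ideal of the cycle graph of length $n$. Then: (1) $\operatorname{depth}(S/J_{n,m}^t)\leq \varphi(n-1,m,t)+1$. (2) If $\operatorname{depth}(S/(J_{n,m}^t:x_n))>\operatorname{depth}(S/J_{n,m}^t)$, then $\operatorname{depth}(S/J_{n,m}^t)=\varphi(n-1,m,t)$.
   Context: The $m$-path ideal of the cycle graph of length $n$ is the monomial ideal $J_{n,m}\subset S$ generated by the $n$ monomials $x_ix_{i+1}\cdots x_{i+m-1}$, $1\leq i\leq n$, where indices are read modulo $n$ in $\{1,\ldots,n\}$. For integers $1\leq m\leq N$ and $t\geq 1$, $$\varphi(N,m,t)=\begin{cases} N-t+2-\left\lfloor \frac{N-t+2}{m+1}\right\rfloor-\left\lceil \frac{N-t+2}{m+1}\right\rceil, & t\leq N+1-m,\\ m-1, & t>N+1-m.\end{cases}$$ Depth is taken with respect to the graded maximal ideal $(x_1,\ldots,x_n)$. *)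

theory Defs
  imports
    "HOL-Algebra.Ideal_Product"
    "HOL-Algebra.QuotRing"
    "HOL-Algebra.Module"
    "HOL-Library.Poly_Mapping"
    "HOL-Library.Extended_Real"
begin

section \<open>Depth of a module\<close>

text \<open>\<open>A M\<close>, the submodule of \<open>M\<close> generated by all \<open>a v\<close> with \<open>a\<close> in the set \<open>A\<close> of scalars.\<close>

definition set_smult :: "('a, 'c) ring_scheme \<Rightarrow> ('a, 'b, 'd) module_scheme \<Rightarrow> 'a set \<Rightarrow> 'b set" where
  "set_smult R M A =
     \<Inter>{H. submodule H R M \<and> {a \<odot>\<^bsub>M\<^esub> v |a v. a \<in> A \<and> v \<in> carrier M} \<subseteq> H}"

text \<open>
  \<open>f\<^sub>1, \<dots>, f\<^sub>r\<close> is \<open>M\<close>-regular if \<open>M \<noteq> (f\<^sub>1, \<dots>, f\<^sub>r) M\<close> and each \<open>f\<^sub>i\<close> is a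
  non-zero-divisor on \<open>M / (f\<^sub>1, \<dots>, f\<^sub>i\<^sub>-\<^sub>1) M\<close>; the latter is expressed in \<open>M\<close> itself. List
  indices start at \<open>0\<close>.
\<close>

definition regular_sequence :: "('a, 'c) ring_scheme \<Rightarrow> ('a, 'b, 'd) module_scheme \<Rightarrow> 'a list \<Rightarrow> bool" where
  "regular_sequence R M fs \<longleftrightarrow>
     set fs \<subseteq> carrier R \<and>
     (\<forall>i < length fs. \<forall>v \<in> carrier M.
        fs ! i \<odot>\<^bsub>M\<^esub> v \<in> set_smult R M (set (take i fs)) \<longrightarrow> v \<in> set_smult R M (set (take i fs))) \<and>
     set_smult R M (set fs) \<noteq> carrier M"

text \<open>
  Depth (grade) of \<open>M\<close> with respect to an ideal \<open>\<aa>\<close>, with the usual convention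
  that it is infinite if \<open>\<aa> M = M\<close>. For a finitely generated module over a
  Noetherian ring and \<open>\<aa>\<close> maximal, it is the depth of the localisation of \<open>M\<close> at \<open>\<aa>\<close>.
\<close>

definition depth :: "('a, 'c) ring_scheme \<Rightarrow> 'a set \<Rightarrow> ('a, 'b, 'd) module_scheme \<Rightarrow> enat" where
  "depth R \<aa> M =
     (if set_smult R M \<aa> = carrier M then \<infinity>
      else Sup {enat (length fs) |fs. set fs \<subseteq> \<aa> \<and> regular_sequence R M fs})"

definition quot_module :: "('a, 'c) ring_scheme \<Rightarrow> 'a set \<Rightarrow> ('a, 'a set) module" where
  "quot_module R I =
     \<lparr>carrier = carrier (R Quot I), mult = mult (R Quot I), one = one (R Quot I),
      zero = zero (R Quot I), add = add (R Quot I),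
      smult = (\<lambda>a X. (I +>\<^bsub>R\<^esub> a) \<otimes>\<^bsub>R Quot I\<^esub> X)\<rparr>"

definition ideal_power :: "('a, 'c) ring_scheme \<Rightarrow> 'a set \<Rightarrow> nat \<Rightarrow> 'a set" where
  "ideal_power R I t = I [^]\<^bsub>ideals_set R\<^esub> t"

definition colon_ideal :: "('a, 'c) ring_scheme \<Rightarrow> 'a set \<Rightarrow> 'a \<Rightarrow> 'a set" where
  "colon_ideal R I f = {g \<in> carrier R. g \<otimes>\<^bsub>R\<^esub> f \<in> I}"

section \<open>The polynomial ring in \<open>x\<^sub>1, \<dots>, x\<^sub>n\<close>\<close>

text \<open>
  A polynomial is a finitely supported map from exponent vectors to coefficients. The type has
  variables \<open>x\<^sub>i\<close> for all natural numbers \<open>i\<close>; the carrier of \<open>poly_ring n\<close> keeps those with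
  \<open>1 \<le> i \<le> n\<close>.
\<close>

type_synonym 'k mpoly = "(nat \<Rightarrow>\<^sub>0 nat) \<Rightarrow>\<^sub>0 'k"

definition var :: "nat \<Rightarrow> 'k::field mpoly" where
  "var i = Poly_Mapping.single (Poly_Mapping.single i 1) 1"

definition poly_ring :: "nat \<Rightarrow> 'k::field mpoly ring" where
  "poly_ring n =
     \<lparr>carrier = {p. \<forall>e \<in> Poly_Mapping.keys p. Poly_Mapping.keys e \<subseteq> {1..n}},
      mult = (*), one = 1, zero = 0, add = (+)\<rparr>"

definition graded_max_ideal :: "nat \<Rightarrow> 'k::field mpoly set" where
  "graded_max_ideal n = Idl\<^bsub>poly_ring n\<^esub> (var ` {1..n})"

definition depth_quot :: "nat \<Rightarrow> 'k::field mpoly set \<Rightarrow> enat" where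
  "depth_quot n I = depth (poly_ring n) (graded_max_ideal n) (quot_module (poly_ring n) I)"

section \<open>Path ideals of cycles\<close>

text \<open>\<open>cyc n j\<close> is the representative of \<open>j\<close> modulo \<open>n\<close> in \<open>{1..n}\<close>, for \<open>j \<ge> 1\<close>.\<close>

definition cyc :: "nat \<Rightarrow> nat \<Rightarrow> nat" where
  "cyc n j = (j - 1) mod n + 1"

definition cycle_path_ideal :: "nat \<Rightarrow> nat \<Rightarrow> 'k::field mpoly set" where
  "cycle_path_ideal n m =
     Idl\<^bsub>poly_ring n\<^esub> ((\<lambda>i. \<Prod>j = i..<i + m. var (cyc n j)) ` {1..n})"

definition phi :: "int \<Rightarrow> int \<Rightarrow> int \<Rightarrow> int" where
  "phi N m t =
     (if t \<le> N + 1 - m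
      then N - t + 2 - \<lfloor>real_of_int (N - t + 2) / real_of_int (m + 1)\<rfloor>
                     - \<lceil>real_of_int (N - t + 2) / real_of_int (m + 1)\<rceil>
      else m - 1)"

section \<open>The structures above are a ring and a module\<close>

lemma cring_poly_ring: "cring (poly_ring n :: 'k::field mpoly ring)"
proof -
  define S where "S = {p :: 'k mpoly. \<forall>e \<in> Poly_Mapping.keys p. Poly_Mapping.keys e \<subseteq> {1..n}}"
  have R: "poly_ring n = \<lparr>carrier = S, mult = (*), one = 1, zero = 0, add = (+)\<rparr>"
    by (simp add: poly_ring_def S_def)
  have [simp]: "0 \<in> S" "1 \<in> S"
    by (simp_all add: S_def)
  have [simp]: "p + q \<in> S" if "p \<in> S" "q \<in> S" for p q
    using that Poly_Mapping.keys_add[of p q] unfolding S_def by blast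
  have [simp]: "- p \<in> S" if "p \<in> S" for p
    using that by (simp add: S_def)
  have [simp]: "p * q \<in> S" if pq: "p \<in> S" "q \<in> S" for p q
    unfolding S_def
  proof (intro CollectI ballI)
    fix e assume "e \<in> Poly_Mapping.keys (p * q)"
    then obtain a b where ab: "a \<in> Poly_Mapping.keys p" "b \<in> Poly_Mapping.keys q" "e = a + b"
      using Poly_Mapping.keys_mult[of p q] by blast
    have "Poly_Mapping.keys a \<subseteq> {1..n}" "Poly_Mapping.keys b \<subseteq> {1..n}"
      using pq ab(1,2) unfolding S_def by blast+
    then show "Poly_Mapping.keys e \<subseteq> {1..n}"
      using Poly_Mapping.keys_add[of a b] unfolding ab(3) by blast
  qed
  have grp: "abelian_group (poly_ring n :: 'k mpoly ring)"
  proof (rule abelian_groupI)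
    fix p assume "p \<in> carrier (poly_ring n :: 'k mpoly ring)"
    then show "\<exists>q \<in> carrier (poly_ring n). q \<oplus>\<^bsub>poly_ring n\<^esub> p = \<zero>\<^bsub>poly_ring n\<^esub>"
      by (intro bexI[of _ "- p"]) (simp_all add: R)
  qed (simp_all add: R add_ac)
  have mon: "Group.comm_monoid (poly_ring n :: 'k mpoly ring)"
    by (rule comm_monoidI) (simp_all add: R mult_ac)
  show ?thesis
    by (rule cringI[OF grp mon]) (simp add: R distrib_right)
qed

lemma module_quot_module:
  assumes "cring R" "ideal I R"
  shows "Module.module R (quot_module R I)"
proof -
  interpret R: cring R by fact
  interpret I: ideal I R by fact
  interpret Q: cring "R Quot I" by (rule I.quotient_is_cring[OF assms(1)])
  interpret h: ring_hom_ring R "R Quot I" "(+>\<^bsub>R\<^esub>) I" by (rule I.rcos_ring_hom_ring)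
  have grp: "abelian_group (quot_module R I)"
  proof (rule abelian_groupI)
    fix x assume "x \<in> carrier (quot_module R I)"
    then show "\<exists>y \<in> carrier (quot_module R I). y \<oplus>\<^bsub>quot_module R I\<^esub> x = \<zero>\<^bsub>quot_module R I\<^esub>"
      unfolding quot_module_def by (intro bexI[of _ "\<ominus>\<^bsub>R Quot I\<^esub> x"]) (simp_all add: Q.l_neg)
  qed (simp_all add: quot_module_def Q.a_ac)
  show ?thesis
    by (rule moduleI[OF assms(1) grp])
      (simp_all add: quot_module_def Q.l_distr Q.r_distr Q.m_assoc)
qed

end

theory Submission
  imports Defs "HOL-Library.Multiset"
begin

text \<open>
  Depth is detected by Koszul cohomology: by Noetherianity, \<open>S/I\<close> with \<open>I \<subseteq> \<mm>\<close> has a regular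
  sequence of length \<open>r\<close> in \<open>\<mm>\<close> iff \<open>H\<^sup>k(x\<^sub>1, \<dots>, x\<^sub>n; S/I) = 0\<close> for all \<open>k < r\<close>. In this form the
  depth lemma for \<open>0 \<rightarrow> S/(I : f) \<rightarrow> S/I \<rightarrow> S/(I, f) \<rightarrow> 0\<close> and, for monomial ideals, the inequality
  \<open>depth S/(I : x\<^sub>v) \<ge> depth S/I\<close> are elementary. They are applied to \<open>I = J\<^sup>t\<close> and \<open>f = x\<^sub>n\<close>, where
  \<open>(J\<^sup>t, x\<^sub>n) = (L\<^sup>t, x\<^sub>n)\<close> for the path ideal \<open>L\<close> of the path with \<open>n - 1\<close> vertices, so that both claims
  follow once \<open>depth S/L\<^sup>t\<close> is known.

  For the lower bound let \<open>L\<^sub>N\<close> be the path ideal on the vertices \<open>1, \<dots>, N\<close> and \<open>e\<close> the monomial of the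
  last window. Dropping the last window of a packing gives \<open>(L\<^sub>N\<^sup>t : e) = L\<^sub>N\<^sup>t\<^sup>-\<^sup>1\<close>; moreover
  \<open>(L\<^sub>N\<^sup>t, e) = (L\<^sub>N\<^sub>-\<^sub>1\<^sup>t, e)\<close>, and with \<open>b = N - m\<close> the ideal \<open>Q = (L\<^sub>N\<^sub>-\<^sub>1\<^sup>t : e)\<close> satisfies
  \<open>(Q : x\<^sub>b) = L\<^sub>N\<^sub>-\<^sub>1\<^sup>t\<^sup>-\<^sup>1\<close> and \<open>(Q, x\<^sub>b) = (L\<^sub>b\<^sub>-\<^sub>1\<^sup>t, x\<^sub>b)\<close>, which yields a recursion. For the upper bound, a
  suitable \<open>(L\<^sub>N\<^sup>t : x\<^sup>u)\<close> is an intersection of \<open>m\<close> monomial primes whose depth is computed directly.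
\<close>

section \<open>Ideals of the polynomial ring\<close>

text \<open>Write g for the value of phi at (n - 1, m, t). The ring has one variable more than the
  path on n - 1 vertices, so depth S/L^t = g + 1; as x_n is regular modulo L^t, depth S/(J^t, x_n) =
  g. If depth S/J^t were at least g + 2, then so would be that of the colon ideal, and (J^t, x_n)
  would have depth at least g + 1. Under the assumption of (2) the depth lemma gives both
  inequalities between g and depth S/J^t. All path ideals live in the same ring: shortening a path
  frees variables, and each free variable adds one to the depth. This pays for the degree shifts of
  the depth lemma in the recursion. The numerical content of the lower bound is that phi, as a
  function of p = N + 1 - m - t, grows by at most 1 in one step and by at most m - 1 in m + 1 steps.
  For the upper bound p is divided by m + 1. The path then consists of m + t - 1 vertices, of k
  further ones for the remainder k, and of one block of m + 1 vertices for each unit of the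
  quotient.\<close>

abbreviation "lookup \<equiv> Poly_Mapping.lookup"
abbreviation "keys \<equiv> Poly_Mapping.keys"
abbreviation "single \<equiv> Poly_Mapping.single"
abbreviation (input) "colon n \<equiv> colon_ideal (poly_ring n)"

abbreviation pol :: "nat \<Rightarrow> 'k::field mpoly set" where
  "pol n \<equiv> carrier (poly_ring n)"

lemma poly_ring_simps [simp]:
  "p \<otimes>\<^bsub>poly_ring n\<^esub> q = p * q" "p \<oplus>\<^bsub>poly_ring n\<^esub> q = p + q"
  "\<one>\<^bsub>poly_ring n\<^esub> = 1" "\<zero>\<^bsub>poly_ring n\<^esub> = 0"
  by (simp_all add: poly_ring_def)

lemma pol_iff: "p \<in> pol n \<longleftrightarrow> (\<forall>e \<in> keys p. keys e \<subseteq> {1..n})"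
  by (simp add: poly_ring_def)

lemma
  shows pol_zero [simp, intro]: "(0 :: 'k::field mpoly) \<in> pol n"
    and pol_one [simp, intro]: "(1 :: 'k mpoly) \<in> pol n"
    and pol_add [simp, intro]: "p \<in> pol n \<Longrightarrow> q \<in> pol n \<Longrightarrow> p + q \<in> (pol n :: 'k mpoly set)"
    and pol_mult [simp, intro]: "p \<in> pol n \<Longrightarrow> q \<in> pol n \<Longrightarrow> p * q \<in> (pol n :: 'k mpoly set)"
proof -
  interpret cring "poly_ring n :: 'k mpoly ring" by (rule cring_poly_ring)
  show "(0 :: 'k::field mpoly) \<in> pol n" "(1 :: 'k mpoly) \<in> pol n"
    using zero_closed one_closed by simp_all
  show "p \<in> pol n \<Longrightarrow> q \<in> pol n \<Longrightarrow> p + q \<in> (pol n :: 'k mpoly set)"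
    "p \<in> pol n \<Longrightarrow> q \<in> pol n \<Longrightarrow> p * q \<in> (pol n :: 'k mpoly set)"
    using a_closed[of p q] m_closed[of p q] by simp_all
qed

lemma pol_uminus [simp, intro]: "p \<in> pol n \<Longrightarrow> - p \<in> (pol n :: 'k::field mpoly set)"
  by (simp add: pol_iff)

lemma pol_diff [simp, intro]: "p \<in> pol n \<Longrightarrow> q \<in> pol n \<Longrightarrow> p - q \<in> (pol n :: 'k::field mpoly set)"
  using pol_add[of p n "- q"] by simp

lemma pol_sum [intro]: "(\<And>i. i \<in> A \<Longrightarrow> f i \<in> pol n) \<Longrightarrow> sum f A \<in> (pol n :: 'k::field mpoly set)"
  by (induction A rule: infinite_finite_induct) auto

lemma pol_prod [intro]: "(\<And>i. i \<in> A \<Longrightarrow> f i \<in> pol n) \<Longrightarrow> prod f A \<in> (pol n :: 'k::field mpoly set)"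
  by (induction A rule: infinite_finite_induct) auto

lemma pol_var [simp, intro]: "i \<in> {1..n} \<Longrightarrow> var i \<in> (pol n :: 'k::field mpoly set)"
  by (simp add: var_def pol_iff)

lemma poly_ring_a_inv:
  assumes "p \<in> (pol n :: 'k::field mpoly set)"
  shows "\<ominus>\<^bsub>poly_ring n\<^esub> p = - p"
proof -
  interpret cring "poly_ring n :: 'k mpoly ring" by (rule cring_poly_ring)
  show ?thesis
    by (rule sum_zero_eq_neg[symmetric]) (use assms in auto)
qed

lemma ideal_polyI:
  fixes I :: "'k::field mpoly set"
  assumes "I \<subseteq> pol n" "0 \<in> I" "\<And>p q. p \<in> I \<Longrightarrow> q \<in> I \<Longrightarrow> p + q \<in> I"
    "\<And>s p. s \<in> pol n \<Longrightarrow> p \<in> I \<Longrightarrow> s * p \<in> I"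
  shows "ideal I (poly_ring n)"
proof -
  interpret cring "poly_ring n :: 'k mpoly ring" by (rule cring_poly_ring)
  have uminus: "- p \<in> I" if "p \<in> I" for p
    using assms(4)[of "- 1" p] that by simp
  have mult': "p * s \<in> I" if "s \<in> pol n" "p \<in> I" for p s
    using assms(4)[OF that] by (simp add: mult.commute)
  have "subgroup I (add_monoid (poly_ring n))"
  proof (rule group.subgroupI)
    show "Group.group (add_monoid (poly_ring n :: 'k mpoly ring))"
      by (rule add.group_axioms)
    fix p assume p: "p \<in> I"
    then show "inv\<^bsub>add_monoid (poly_ring n)\<^esub> p \<in> I"
      using poly_ring_a_inv[of p n] uminus assms(1) unfolding a_inv_def by auto
  qed (use assms in auto)
  then show ?thesis
    by (intro idealI) (use assms mult' in \<open>auto simp: ring_axioms\<close>)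
qed

context
  fixes n :: nat and I :: "'k::field mpoly set"
  assumes I: "ideal I (poly_ring n)"
begin

lemma ideal_pol: "p \<in> I \<Longrightarrow> p \<in> pol n"
  by (rule ideal.Icarr[OF I])

lemma ideal_zero: "0 \<in> I"
  using additive_subgroup.zero_closed[OF ideal.axioms(1)[OF I]] by simp

lemma ideal_add: "p \<in> I \<Longrightarrow> q \<in> I \<Longrightarrow> p + q \<in> I"
  using additive_subgroup.a_closed[OF ideal.axioms(1)[OF I], of p q] by simp

lemma ideal_mult: "s \<in> (pol n :: 'k mpoly set) \<Longrightarrow> p \<in> I \<Longrightarrow> s * p \<in> I"
  using ideal.I_l_closed[OF I, of p s] by simp

lemma ideal_mult': "s \<in> (pol n :: 'k mpoly set) \<Longrightarrow> p \<in> I \<Longrightarrow> p * s \<in> I"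
  using ideal_mult[of s p] by (simp add: mult.commute)

lemma ideal_uminus: "p \<in> I \<Longrightarrow> - p \<in> I"
  using ideal_mult[of "- 1" p] by simp

lemma ideal_diff: "p \<in> I \<Longrightarrow> q \<in> I \<Longrightarrow> p - q \<in> I"
  using ideal_add[of p "- q"] ideal_uminus[of q] by simp

lemma ideal_sum: "(\<And>i. i \<in> A \<Longrightarrow> f i \<in> I) \<Longrightarrow> sum f A \<in> I"
  by (induction A rule: infinite_finite_induct) (auto intro: ideal_add ideal_zero)

lemma ideal_cancel: "p - q \<in> I \<Longrightarrow> q \<in> I \<Longrightarrow> p \<in> I"
  using ideal_add[of "p - q" q] by simp

lemma ideal_cancel': "p - q \<in> I \<Longrightarrow> p \<in> I \<Longrightarrow> q \<in> I"
  using ideal_diff[of p "p - q"] by simp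

end

definition ideal_plus :: "'k::field mpoly set \<Rightarrow> 'k mpoly set \<Rightarrow> 'k mpoly set" where
  "ideal_plus P Q = {p + q |p q. p \<in> P \<and> q \<in> Q}"

definition princ :: "nat \<Rightarrow> 'k::field mpoly \<Rightarrow> 'k mpoly set" where
  "princ n f = {f * s |s. s \<in> pol n}"

lemma ideal_princ:
  assumes "f \<in> (pol n :: 'k::field mpoly set)"
  shows "ideal (princ n f) (poly_ring n)"
proof (rule ideal_polyI)
  fix p q assume "p \<in> princ n f" "q \<in> princ n f"
  then show "p + q \<in> princ n f"
    unfolding princ_def by (auto simp flip: distrib_left)
next
  fix s p assume "s \<in> (pol n :: 'k mpoly set)" "p \<in> princ n f"
  then show "s * p \<in> princ n f"
    unfolding princ_def by (auto simp: mult.left_commute[of s f])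
qed (use assms in \<open>auto simp: princ_def intro: exI[of _ 0]\<close>)

lemma ideal_ideal_plus:
  fixes P Q :: "'k::field mpoly set"
  assumes P: "ideal P (poly_ring n)" and Q: "ideal Q (poly_ring n)"
  shows "ideal (ideal_plus P Q) (poly_ring n)"
proof (rule ideal_polyI)
  show "ideal_plus P Q \<subseteq> pol n"
    using ideal_pol[OF P] ideal_pol[OF Q] by (auto simp: ideal_plus_def)
  show "0 \<in> ideal_plus P Q"
    unfolding ideal_plus_def using ideal_zero[OF P] ideal_zero[OF Q] by force
next
  fix p q assume "p \<in> ideal_plus P Q" "q \<in> ideal_plus P Q"
  then obtain a b a' b' where *: "p = a + b" "q = a' + b'" "a \<in> P" "b \<in> Q" "a' \<in> P" "b' \<in> Q"
    by (auto simp: ideal_plus_def)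
  have "p + q = (a + a') + (b + b')" using * by simp
  then show "p + q \<in> ideal_plus P Q"
    unfolding ideal_plus_def using ideal_add[OF P, of a a'] ideal_add[OF Q, of b b'] * by blast
next
  fix s p assume s: "s \<in> (pol n :: 'k mpoly set)" and "p \<in> ideal_plus P Q"
  then obtain a b where *: "p = a + b" "a \<in> P" "b \<in> Q"
    by (auto simp: ideal_plus_def)
  then show "s * p \<in> ideal_plus P Q"
    unfolding ideal_plus_def using ideal_mult[OF P s] ideal_mult[OF Q s]
    by (auto simp: distrib_left)
qed

lemma ideal_plus_left: "ideal Q (poly_ring n) \<Longrightarrow> p \<in> P \<Longrightarrow> p \<in> ideal_plus P Q"
  unfolding ideal_plus_def using ideal_zero[of Q n] by force

lemma ideal_plus_right: "ideal P (poly_ring n) \<Longrightarrow> q \<in> Q \<Longrightarrow> q \<in> ideal_plus P Q"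
  unfolding ideal_plus_def using ideal_zero[of P n] by force

lemma princ_self: "f \<in> princ n f"
  unfolding princ_def by (auto intro!: exI[of _ 1])

lemma colon_ideal_iff:
  "g \<in> colon n I f \<longleftrightarrow> g \<in> pol n \<and> g * f \<in> I"
  by (simp add: colon_ideal_def)

lemma ideal_colon:
  assumes I: "ideal I (poly_ring n)" and f: "f \<in> (pol n :: 'k::field mpoly set)"
  shows "ideal (colon n I f) (poly_ring n)"
  by (rule ideal_polyI)
    (auto simp: colon_ideal_iff distrib_right mult.assoc intro: ideal_zero[OF I] ideal_add[OF I] ideal_mult[OF I])

section \<open>Koszul cohomology\<close>

text \<open>The sign in dx_j \<and> dx_(T - {j}) = \<open>ksgn j T\<close> dx_T, where dx_T is the
  product in increasing order. A form is encoded by its coefficients, as a function of T.\<close>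

definition ksgn :: "nat \<Rightarrow> nat set \<Rightarrow> 'k::field mpoly" where
  "ksgn j T = (- 1) ^ card {k \<in> T. k < j}"

lemma ksgn_pol [simp]: "ksgn j T \<in> pol n"
proof -
  have "(- 1) ^ c \<in> pol n" for c
    by (induction c) auto
  then show ?thesis by (simp add: ksgn_def)
qed

lemma ksgn_sq [simp]: "ksgn j T * (ksgn j T * p) = p"
  by (simp add: ksgn_def flip: mult.assoc power_mult_distrib)

lemma ksgn_remove_less:
  assumes "j \<in> T" "j < k"
  shows "ksgn k T = - ksgn k (T - {j})"
proof -
  have "{i \<in> T. i < k} = insert j {i \<in> T - {j}. i < k}" using assms by auto
  moreover have "finite {i \<in> T - {j}. i < k}" by simp
  ultimately show ?thesis by (simp add: ksgn_def card_insert_if)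
qed

lemma ksgn_remove_greater:
  assumes "j < k"
  shows "ksgn j (T - {k}) = ksgn j T"
proof -
  have "{i \<in> T - {k}. i < j} = {i \<in> T. i < j}" using assms by auto
  then show ?thesis by (simp add: ksgn_def)
qed

text \<open>Removing the smaller of j and k from T shifts the position of the larger one by one;
  removing the larger leaves the smaller in place. The first version says that dx_j and dx_k
  anticommute, the second compares contraction with multiplication.\<close>

lemma
  assumes "j \<in> T" "k \<in> T" "j \<noteq> k"
  shows ksgn_swap: "ksgn j T * ksgn k (T - {j}) = - (ksgn k T * ksgn j (T - {k}) :: 'k::field mpoly)"
    and ksgn_swap': "ksgn j T * ksgn k T = - (ksgn k (T - {j}) * ksgn j (T - {k}) :: 'k mpoly)"
proof -
  consider "j < k" | "k < j" using assms(3) by linarith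
  then have "ksgn j T * ksgn k (T - {j}) = - (ksgn k T * ksgn j (T - {k}) :: 'k mpoly) \<and>
    ksgn j T * ksgn k T = - (ksgn k (T - {j}) * ksgn j (T - {k}) :: 'k mpoly)"
  proof cases
    case 1
    then show ?thesis
      unfolding ksgn_remove_less[OF assms(1) 1] ksgn_remove_greater[OF 1] by (simp add: mult.commute)
  next
    case 2
    then show ?thesis
      unfolding ksgn_remove_less[OF assms(2) 2] ksgn_remove_greater[OF 2] by (simp add: mult.commute)
  qed
  then show "ksgn j T * ksgn k (T - {j}) = - (ksgn k T * ksgn j (T - {k}) :: 'k mpoly)"
    "ksgn j T * ksgn k T = - (ksgn k (T - {j}) * ksgn j (T - {k}) :: 'k mpoly)" by blast+
qed

text \<open>Exterior multiplication by x_1 dx_1 + ... + x_n dx_n. It acts on polynomial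
  coefficients; the passage to S/I is left to the congruences in
  \<open>koszul_vanish\<close>.\<close>

definition kdiff :: "nat \<Rightarrow> (nat set \<Rightarrow> 'k::field mpoly) \<Rightarrow> nat set \<Rightarrow> 'k mpoly" where
  "kdiff n w T = (\<Sum>j \<in> T \<inter> {1..n}. ksgn j T * (var j * w (T - {j})))"

text \<open>
  Degrees are shifted by one: the elements of \<open>form n k\<close> are the \<open>(k - 1)\<close>-forms. In this way
  the vanishing of the \<open>k\<close>-th cohomology needs no separate case for \<open>k = 0\<close>.
\<close>

definition form :: "nat \<Rightarrow> nat \<Rightarrow> (nat set \<Rightarrow> 'k::field mpoly) set" where
  "form n k = {w. \<forall>T. w T \<in> pol n \<and> (w T \<noteq> 0 \<longrightarrow> T \<subseteq> {1..n} \<and> Suc (card T) = k)}"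

text \<open>Cochains over S/I are represented by polynomial lifts, so being a cocycle or a
  coboundary is a condition modulo I. Taking all degrees below r makes the predicate antitone in r,
  as is depth \<ge> r.\<close>

definition koszul_vanish :: "nat \<Rightarrow> nat \<Rightarrow> 'k::field mpoly set \<Rightarrow> bool" where
  "koszul_vanish n r I \<longleftrightarrow>
     (\<forall>k < r. \<forall>w \<in> form n (Suc k). (\<forall>T. kdiff n w T \<in> I) \<longrightarrow>
        (\<exists>\<eta> \<in> form n k. \<forall>T. w T - kdiff n \<eta> T \<in> I))"

lemma koszul_vanishD:
  "koszul_vanish n r I \<Longrightarrow> k < r \<Longrightarrow> w \<in> form n (Suc k) \<Longrightarrow> (\<And>T. kdiff n w T \<in> I) \<Longrightarrow>
     \<exists>\<eta> \<in> form n k. \<forall>T. w T - kdiff n \<eta> T \<in> I"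
  by (auto simp: koszul_vanish_def)

lemma koszul_vanishI:
  "(\<And>k w. k < r \<Longrightarrow> w \<in> form n (Suc k) \<Longrightarrow> (\<And>T. kdiff n w T \<in> I) \<Longrightarrow>
     \<exists>\<eta> \<in> form n k. \<forall>T. w T - kdiff n \<eta> T \<in> I) \<Longrightarrow> koszul_vanish n r I"
  by (auto simp: koszul_vanish_def)

lemma koszul_vanish_mono: "koszul_vanish n r I \<Longrightarrow> r' \<le> r \<Longrightarrow> koszul_vanish n r' I"
  by (auto simp: koszul_vanish_def)

lemma koszul_vanish_0 [simp]: "koszul_vanish n 0 I"
  by (simp add: koszul_vanish_def)

lemma kdiff_add: "kdiff n (\<lambda>T. w T + \<eta> T) T = kdiff n w T + kdiff n \<eta> T"
  by (simp add: kdiff_def distrib_left sum.distrib)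

lemma kdiff_mult: "kdiff n (\<lambda>T. f * w T) T = f * kdiff n w T"
  by (simp add: kdiff_def sum_distrib_left mult_ac)

lemma kdiff_uminus: "kdiff n (\<lambda>T. - w T) T = - kdiff n w T"
  using kdiff_mult[of n "- 1" w T] by simp

lemma kdiff_diff: "kdiff n (\<lambda>T. w T - \<eta> T) T = kdiff n w T - kdiff n \<eta> T"
  using kdiff_add[of n w "\<lambda>T. - \<eta> T" T] by (simp add: kdiff_uminus)

lemma kdiff_zero [simp]: "kdiff n (\<lambda>T. 0) T = 0"
  by (simp add: kdiff_def)

lemma kdiff_ideal:
  assumes "ideal I (poly_ring n)" "\<And>T. w T \<in> I"
  shows "kdiff n w T \<in> I"
  unfolding kdiff_def
  by (intro ideal_sum[OF assms(1)] ideal_mult[OF assms(1)]) (use assms in auto)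

text \<open>Matching the pairs j < k with the pairs k < j cancels the terms without division by two,
  so characteristic two is covered.\<close>

lemma sum_antisym_pairs:
  fixes a :: "nat \<Rightarrow> nat \<Rightarrow> 'a::ab_group_add"
  assumes "finite A" "\<And>j k. j \<in> A \<Longrightarrow> k \<in> A \<Longrightarrow> j \<noteq> k \<Longrightarrow> a j k = - a k j"
  shows "(\<Sum>j \<in> A. \<Sum>k \<in> A - {j}. a j k) = 0"
proof -
  let ?L = "{(j, k). j \<in> A \<and> k \<in> A \<and> j < k}" and ?G = "{(j, k). j \<in> A \<and> k \<in> A \<and> k < j}"
  have fin: "finite ?L" "finite ?G"
    by (rule finite_subset[of _ "A \<times> A"]; use assms(1) in auto)+
  have "(\<Sum>j \<in> A. \<Sum>k \<in> A - {j}. a j k) = (\<Sum>(j, k) \<in> Sigma A (\<lambda>j. A - {j}). a j k)"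
    using assms(1) by (subst sum.Sigma) auto
  also have "Sigma A (\<lambda>j. A - {j}) = ?L \<union> ?G" by auto
  also have "(\<Sum>(j, k) \<in> ?L \<union> ?G. a j k) = (\<Sum>(j, k) \<in> ?L. a j k) + (\<Sum>(j, k) \<in> ?G. a j k)"
    using fin by (intro sum.union_disjoint) auto
  also have "(\<Sum>(j, k) \<in> ?G. a j k) = (\<Sum>(j, k) \<in> ?L. a k j)"
    by (rule sum.reindex_bij_witness[of _ prod.swap prod.swap]) auto
  also have "\<dots> = (\<Sum>(j, k) \<in> ?L. - a j k)"
    by (rule sum.cong) (auto intro: assms(2))
  finally show ?thesis by (simp add: sum_negf case_prod_unfold)
qed

lemma kdiff_kd [simp]: "kdiff n (kdiff n w) T = 0"
proof -
  let ?a = "\<lambda>j k. ksgn j T * ksgn k (T - {j}) * (var j * var k * w (T - {j} - {k}))"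
  have "kdiff n (kdiff n w) T = (\<Sum>j \<in> T \<inter> {1..n}. \<Sum>k \<in> T \<inter> {1..n} - {j}. ?a j k)"
    unfolding kdiff_def sum_distrib_left
    by (intro sum.cong refl) (auto simp: mult_ac)
  also have "\<dots> = 0"
  proof (rule sum_antisym_pairs)
    fix j k assume "j \<in> T \<inter> {1..n}" "k \<in> T \<inter> {1..n}" "j \<noteq> k"
    moreover have "T - {j} - {k} = T - {k} - {j}" by auto
    ultimately show "?a j k = - ?a k j"
      using ksgn_swap[of j T k, where 'k = 'a] by (simp add: mult.commute[of "var j"])
  qed auto
  finally show ?thesis .
qed

section \<open>Cochains and exact sequences in Koszul cohomology\<close>

lemma form_pol: "w \<in> form n k \<Longrightarrow> w T \<in> pol n"
  by (auto simp: form_def)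

lemma form_nonzeroD: "w \<in> form n k \<Longrightarrow> w T \<noteq> 0 \<Longrightarrow> T \<subseteq> {1..n} \<and> Suc (card T) = k"
  by (auto simp: form_def)

lemma formI:
  "(\<And>T. w T \<in> pol n) \<Longrightarrow> (\<And>T. w T \<noteq> 0 \<Longrightarrow> T \<subseteq> {1..n} \<and> Suc (card T) = k) \<Longrightarrow> w \<in> form n k"
  by (simp add: form_def)

lemma form_add:
  assumes "w \<in> form n k" "\<eta> \<in> form n k"
  shows "(\<lambda>T. w T + \<eta> T) \<in> form n k"
proof (rule formI)
  fix T assume "w T + \<eta> T \<noteq> 0"
  then have "w T \<noteq> 0 \<or> \<eta> T \<noteq> 0" by auto
  then show "T \<subseteq> {1..n} \<and> Suc (card T) = k" using assms form_nonzeroD by blast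
qed (use assms form_pol in blast)

lemma form_mult: "w \<in> form n k \<Longrightarrow> f \<in> pol n \<Longrightarrow> (\<lambda>T. f * w T) \<in> form n k"
  unfolding form_def by auto

lemma form_diff: "w \<in> form n k \<Longrightarrow> \<eta> \<in> form n k \<Longrightarrow> (\<lambda>T. w T - \<eta> T) \<in> form n k"
  using form_add[of w n k "\<lambda>T. - 1 * \<eta> T"] form_mult[of \<eta> n k "- 1"] by simp

lemma form_zero: "(\<lambda>T. 0) \<in> form n k"
  unfolding form_def by auto

lemma kdiff_form:
  assumes "w \<in> form n k"
  shows "kdiff n w \<in> form n (Suc k)"
  unfolding form_def
proof (intro CollectI allI conjI impI)
  fix T
  show "kdiff n w T \<in> pol n"
    unfolding kdiff_def using assms by (intro pol_sum) (auto simp: form_pol)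
  assume "kdiff n w T \<noteq> 0"
  then obtain j where j: "j \<in> T" "j \<in> {1..n}" "w (T - {j}) \<noteq> 0"
    unfolding kdiff_def by (metis (no_types, lifting) Int_iff mult_zero_right sum.neutral)
  then have *: "T - {j} \<subseteq> {1..n}" "Suc (card (T - {j})) = k"
    using assms by (auto simp: form_def)
  then show T: "T \<subseteq> {1..n}" using j by auto
  have "finite T" by (rule finite_subset[OF T]) simp
  then show "Suc (card T) = Suc k" using card_Suc_Diff1[of T j] *(2) j(1) by linarith
qed

text \<open>Both summands are chosen to be 0 wherever w T = 0; otherwise they might have nonzero
  coefficients in other degrees and leave \<open>form n k\<close>.\<close>

lemma form_split:
  assumes w: "w \<in> form n k" and PQ: "\<And>T. w T \<in> ideal_plus P Q"
    and P: "ideal P (poly_ring n)" and Q: "ideal Q (poly_ring n)"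
  obtains \<pi> \<kappa> where "\<pi> \<in> form n k" "\<kappa> \<in> form n k" "\<And>T. \<pi> T \<in> P" "\<And>T. \<kappa> T \<in> Q"
    "\<And>T. w T = \<pi> T + \<kappa> T"
proof -
  have "\<exists>p q. p \<in> P \<and> q \<in> Q \<and> w T = p + q \<and> (w T = 0 \<longrightarrow> p = 0 \<and> q = 0)" for T
    using PQ[of T] ideal_zero[OF P] ideal_zero[OF Q]
    by (cases "w T = 0") (force simp: ideal_plus_def)+
  then obtain \<pi> \<kappa> where *: "\<And>T. \<pi> T \<in> P \<and> \<kappa> T \<in> Q \<and> w T = \<pi> T + \<kappa> T \<and> (w T = 0 \<longrightarrow> \<pi> T = 0 \<and> \<kappa> T = 0)"
    by metis
  then have "\<pi> \<in> form n k" "\<kappa> \<in> form n k"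
    using w ideal_pol[OF P] ideal_pol[OF Q] unfolding form_def by blast+
  with * that show thesis by blast
qed

lemma form_split_princ:
  assumes w: "w \<in> form n k" and PQ: "\<And>T. w T \<in> ideal_plus P (princ n f)"
    and P: "ideal P (poly_ring n)" and f: "f \<in> pol n"
  obtains \<pi> \<sigma> where "\<pi> \<in> form n k" "\<sigma> \<in> form n k" "\<And>T. \<pi> T \<in> P"
    "\<And>T. w T = \<pi> T + f * \<sigma> T"
proof -
  obtain \<pi> \<kappa> where *: "\<pi> \<in> form n k" "\<kappa> \<in> form n k" "\<And>T. \<pi> T \<in> P" "\<And>T. \<kappa> T \<in> princ n f"
    "\<And>T. w T = \<pi> T + \<kappa> T"
    using form_split[OF w PQ P ideal_princ[OF f]] by blast
  have "\<exists>s. s \<in> pol n \<and> \<kappa> T = f * s \<and> (\<kappa> T = 0 \<longrightarrow> s = 0)" for T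
    using *(4)[of T] by (cases "\<kappa> T = 0") (auto simp: princ_def)
  then obtain \<sigma> where s: "\<And>T. \<sigma> T \<in> pol n \<and> \<kappa> T = f * \<sigma> T \<and> (\<kappa> T = 0 \<longrightarrow> \<sigma> T = 0)"
    by metis
  then have "\<sigma> \<in> form n k"
    using *(2) unfolding form_def by blast
  with s * that show thesis by metis
qed

text \<open>Exactness of H^k(S/(B : f)) \<rightarrow> H^k(S/B) \<rightarrow> H^k(S/(B, f)) in the
  middle. A primitive modulo (B, f) leaves an error f \<sigma> modulo B; here \<sigma> is a cocycle
  modulo (B : f), and f times its primitive is the correction.\<close>

lemma koszul_vanish_extension:
  assumes B: "ideal B (poly_ring n)" and f: "f \<in> pol n"
    and VA: "koszul_vanish n r (colon n B f)"
    and VC: "koszul_vanish n r (ideal_plus B (princ n f))"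
  shows "koszul_vanish n r B"
proof (rule koszul_vanishI)
  fix k w assume k: "k < r" and w: "w \<in> form n (Suc k)" and dw: "\<And>T. kdiff n w T \<in> B"
  have "kdiff n w T \<in> ideal_plus B (princ n f)" for T
    by (rule ideal_plus_left[OF ideal_princ[OF f] dw])
  then obtain \<eta> where eta: "\<eta> \<in> form n k" "\<And>T. w T - kdiff n \<eta> T \<in> ideal_plus B (princ n f)"
    using koszul_vanishD[OF VC k w] by blast
  obtain \<beta> \<sigma> where s: "\<beta> \<in> form n (Suc k)" "\<sigma> \<in> form n (Suc k)" "\<And>T. \<beta> T \<in> B"
    "\<And>T. w T - kdiff n \<eta> T = \<beta> T + f * \<sigma> T"
    using form_split_princ[OF form_diff[OF w kdiff_form[OF eta(1)]] eta(2) B f] by blast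
  have "kdiff n \<sigma> T \<in> colon n B f" for T
  proof -
    have "kdiff n w T = kdiff n \<beta> T + f * kdiff n \<sigma> T"
    proof -
      have "kdiff n (\<lambda>T. w T - kdiff n \<eta> T) T = kdiff n (\<lambda>T. \<beta> T + f * \<sigma> T) T"
        using s(4) by simp
      then show ?thesis by (simp add: kdiff_diff kdiff_add kdiff_mult)
    qed
    then have "f * kdiff n \<sigma> T \<in> B"
      using ideal_diff[OF B dw[of T] kdiff_ideal[OF B, of \<beta> T]] s(3) by simp
    then show ?thesis
      using form_pol[OF kdiff_form[OF s(2)]] by (simp add: colon_ideal_iff mult.commute)
  qed
  then obtain \<tau> where t: "\<tau> \<in> form n k" "\<And>T. \<sigma> T - kdiff n \<tau> T \<in> colon n B f"
    using koszul_vanishD[OF VA k s(2)] by blast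
  show "\<exists>\<eta>\<in>form n k. \<forall>T. w T - kdiff n \<eta> T \<in> B"
  proof (intro bexI allI)
    show "(\<lambda>T. \<eta> T + f * \<tau> T) \<in> form n k"
      by (intro form_add form_mult eta t f)
    fix T
    have "w T - kdiff n (\<lambda>T. \<eta> T + f * \<tau> T) T = \<beta> T + (\<sigma> T - kdiff n \<tau> T) * f"
      using s(4)[of T] by (simp add: kdiff_add kdiff_mult algebra_simps)
    then show "w T - kdiff n (\<lambda>T. \<eta> T + f * \<tau> T) T \<in> B"
      using t(2)[of T] s(3) ideal_add[OF B] by (simp add: colon_ideal_iff)
  qed
qed

text \<open>Exactness at H^k(S/(B, f)), between H^k(S/B) and H^(k+1)(S/(B : f)); hence the extra
  degree in the premise on the colon ideal. The cochain \<sigma> with d w = f \<sigma> modulo B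
  represents the connecting homomorphism.\<close>

lemma koszul_vanish_quotient:
  assumes B: "ideal B (poly_ring n)" and f: "f \<in> pol n"
    and VA: "koszul_vanish n (Suc r) (colon n B f)"
    and VB: "koszul_vanish n r B"
  shows "koszul_vanish n r (ideal_plus B (princ n f))"
proof (rule koszul_vanishI)
  fix k w assume k: "k < r" and w: "w \<in> form n (Suc k)"
    and dw: "\<And>T. kdiff n w T \<in> ideal_plus B (princ n f)"
  obtain \<beta> \<sigma> where s: "\<beta> \<in> form n (Suc (Suc k))" "\<sigma> \<in> form n (Suc (Suc k))" "\<And>T. \<beta> T \<in> B"
    "\<And>T. kdiff n w T = \<beta> T + f * \<sigma> T"
    using form_split_princ[OF kdiff_form[OF w] dw B f] by blast
  have "kdiff n \<sigma> T \<in> colon n B f" for T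
  proof -
    have "kdiff n (kdiff n w) T = kdiff n (\<lambda>T. \<beta> T + f * \<sigma> T) T"
      using s(4) by presburger
    then have "f * kdiff n \<sigma> T = - kdiff n \<beta> T"
      by (simp add: kdiff_add kdiff_mult eq_neg_iff_add_eq_0 add.commute)
    then have "f * kdiff n \<sigma> T \<in> B"
      using ideal_uminus[OF B kdiff_ideal[OF B, of \<beta> T]] s(3) by simp
    then show ?thesis
      using form_pol[OF kdiff_form[OF s(2)]] by (simp add: colon_ideal_iff mult.commute)
  qed
  then obtain \<tau> where t: "\<tau> \<in> form n (Suc k)" "\<And>T. \<sigma> T - kdiff n \<tau> T \<in> colon n B f"
    using koszul_vanishD[OF VA _ s(2)] k by auto
  have "kdiff n (\<lambda>T. w T - f * \<tau> T) T \<in> B" for T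
  proof -
    have "kdiff n (\<lambda>T. w T - f * \<tau> T) T = \<beta> T + (\<sigma> T - kdiff n \<tau> T) * f"
      using s(4)[of T] by (simp add: kdiff_diff kdiff_mult algebra_simps)
    then show ?thesis
      using t(2)[of T] s(3) ideal_add[OF B] by (simp add: colon_ideal_iff)
  qed
  then obtain \<eta> where eta: "\<eta> \<in> form n k" "\<And>T. w T - f * \<tau> T - kdiff n \<eta> T \<in> B"
    using koszul_vanishD[OF VB k form_diff[OF w form_mult[OF t(1) f]]] by blast
  show "\<exists>\<eta>\<in>form n k. \<forall>T. w T - kdiff n \<eta> T \<in> ideal_plus B (princ n f)"
  proof (intro bexI allI)
    fix T
    have "w T - kdiff n \<eta> T = (w T - f * \<tau> T - kdiff n \<eta> T) + f * \<tau> T" by simp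
    then show "w T - kdiff n \<eta> T \<in> ideal_plus B (princ n f)"
      unfolding ideal_plus_def princ_def using eta(2)[of T] form_pol[OF t(1), of T] by blast
  qed (fact eta)
qed

text \<open>Mayer-Vietoris for 0 \<rightarrow> S/(P \<inter> Q) \<rightarrow> S/P \<oplus> S/Q
  \<rightarrow> S/(P + Q) \<rightarrow> 0: the P-part of d w is a cocycle modulo P \<inter> Q and
  represents the connecting homomorphism.\<close>

lemma koszul_vanish_plus:
  assumes P: "ideal P (poly_ring n)" and Q: "ideal Q (poly_ring n)"
    and VPQ: "koszul_vanish n (Suc r) (P \<inter> Q)"
    and VP: "koszul_vanish n r P" and VQ: "koszul_vanish n r Q"
  shows "koszul_vanish n r (ideal_plus P Q)"
proof (rule koszul_vanishI)
  fix k w assume k: "k < r" and w: "w \<in> form n (Suc k)" and dw: "\<And>T. kdiff n w T \<in> ideal_plus P Q"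
  obtain \<pi> \<kappa> where s: "\<pi> \<in> form n (Suc (Suc k))" "\<kappa> \<in> form n (Suc (Suc k))" "\<And>T. \<pi> T \<in> P"
    "\<And>T. \<kappa> T \<in> Q" "\<And>T. kdiff n w T = \<pi> T + \<kappa> T"
    using form_split[OF kdiff_form[OF w] dw P Q] by blast
  have "kdiff n \<pi> T \<in> P \<inter> Q" for T
  proof -
    have "kdiff n (kdiff n w) T = kdiff n (\<lambda>T. \<pi> T + \<kappa> T) T"
      using s(5) by presburger
    then have "kdiff n \<pi> T = - kdiff n \<kappa> T"
      by (simp add: kdiff_add eq_neg_iff_add_eq_0)
    then show ?thesis
      using ideal_uminus[OF Q kdiff_ideal[OF Q, of \<kappa> T]] kdiff_ideal[OF P, of \<pi> T] s(3,4) by simp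
  qed
  then obtain \<eta> where eta: "\<eta> \<in> form n (Suc k)" "\<And>T. \<pi> T - kdiff n \<eta> T \<in> P \<inter> Q"
    using koszul_vanishD[OF VPQ _ s(1)] k by auto
  have "kdiff n \<eta> T \<in> P" for T
    using ideal_cancel'[OF P, of "\<pi> T" "kdiff n \<eta> T"] eta(2)[of T] s(3) by simp
  then obtain \<xi> where xi: "\<xi> \<in> form n k" "\<And>T. \<eta> T - kdiff n \<xi> T \<in> P"
    using koszul_vanishD[OF VP k eta(1)] by blast
  have "kdiff n (\<lambda>T. w T - \<eta> T) T \<in> Q" for T
  proof -
    have "kdiff n (\<lambda>T. w T - \<eta> T) T = (\<pi> T - kdiff n \<eta> T) + \<kappa> T"
      using s(5)[of T] by (simp add: kdiff_diff)
    then show ?thesis using eta(2)[of T] s(4)[of T] ideal_add[OF Q] by simp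
  qed
  then obtain \<zeta> where zeta: "\<zeta> \<in> form n k" "\<And>T. w T - \<eta> T - kdiff n \<zeta> T \<in> Q"
    using koszul_vanishD[OF VQ k form_diff[OF w eta(1)]] by blast
  show "\<exists>\<eta>\<in>form n k. \<forall>T. w T - kdiff n \<eta> T \<in> ideal_plus P Q"
  proof (intro bexI allI)
    show "(\<lambda>T. \<xi> T + \<zeta> T) \<in> form n k" by (intro form_add xi zeta)
    fix T
    have "w T - kdiff n (\<lambda>T. \<xi> T + \<zeta> T) T = (\<eta> T - kdiff n \<xi> T) + (w T - \<eta> T - kdiff n \<zeta> T)"
      by (simp add: kdiff_add)
    then show "w T - kdiff n (\<lambda>T. \<xi> T + \<zeta> T) T \<in> ideal_plus P Q"
      unfolding ideal_plus_def using xi(2)[of T] zeta(2)[of T] by blast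
  qed
qed

text \<open>The same sequence at H^k(S/(P \<inter> Q)), which is preceded by H^(k-1)(S/(P + Q));
  hence \<open>r - 1\<close>.\<close>

lemma koszul_vanish_inter:
  assumes P: "ideal P (poly_ring n)" and Q: "ideal Q (poly_ring n)"
    and VPQ: "koszul_vanish n (r - 1) (ideal_plus P Q)"
    and VP: "koszul_vanish n r P" and VQ: "koszul_vanish n r Q"
  shows "koszul_vanish n r (P \<inter> Q)"
proof (rule koszul_vanishI)
  fix k w assume k: "k < r" and w: "w \<in> form n (Suc k)" and dw: "\<And>T. kdiff n w T \<in> P \<inter> Q"
  have dw': "kdiff n w T \<in> P" "kdiff n w T \<in> Q" for T using dw by auto
  obtain \<eta> where eta: "\<eta> \<in> form n k" "\<And>T. w T - kdiff n \<eta> T \<in> P"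
    using koszul_vanishD[OF VP k w dw'(1)] by blast
  obtain \<zeta> where zeta: "\<zeta> \<in> form n k" "\<And>T. w T - kdiff n \<zeta> T \<in> Q"
    using koszul_vanishD[OF VQ k w dw'(2)] by blast
  \<comment> \<open>The primitives \<eta> modulo P and \<zeta> modulo Q differ by a cocycle modulo P
    + Q. Up to an exact form \<theta> the difference splits into a part \<pi> in P and a part in Q,
    and \<eta> - \<pi> is then a primitive modulo both. For k = 0 both primitives are 0.\<close>
  have "\<exists>\<theta> \<in> form n k. \<exists>\<pi> \<in> form n k. (\<forall>T. \<pi> T \<in> P \<and> \<eta> T - \<pi> T - \<zeta> T - \<theta> T \<in> Q \<and> kdiff n \<theta> T = 0)"
  proof (cases k)
    case 0
    then have "\<eta> T = 0" "\<zeta> T = 0" for T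
      using form_nonzeroD[OF eta(1)] form_nonzeroD[OF zeta(1)] by blast+
    then show ?thesis
      using form_zero ideal_zero[OF P] ideal_zero[OF Q]
      by (intro bexI[of _ "\<lambda>T. 0"]) auto
  next
    case (Suc k')
    have "kdiff n (\<lambda>T. \<eta> T - \<zeta> T) T \<in> ideal_plus P Q" for T
    proof -
      have "kdiff n (\<lambda>T. \<eta> T - \<zeta> T) T = - (w T - kdiff n \<eta> T) + (w T - kdiff n \<zeta> T)"
        by (simp add: kdiff_diff)
      then show ?thesis
        unfolding ideal_plus_def using ideal_uminus[OF P eta(2)[of T]] zeta(2)[of T] by blast
    qed
    moreover have "(\<lambda>T. \<eta> T - \<zeta> T) \<in> form n (Suc k')"
      using form_diff[OF eta(1) zeta(1)] Suc by simp
    ultimately obtain \<theta> where th: "\<theta> \<in> form n k'" "\<And>T. \<eta> T - \<zeta> T - kdiff n \<theta> T \<in> ideal_plus P Q"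
      using koszul_vanishD[OF VPQ, of k' "\<lambda>T. \<eta> T - \<zeta> T"] Suc k by force
    have D: "(\<lambda>T. \<eta> T - \<zeta> T - kdiff n \<theta> T) \<in> form n k"
      unfolding Suc by (intro form_diff kdiff_form th) (use eta zeta Suc in auto)
    obtain \<pi> \<kappa> where s: "\<pi> \<in> form n k" "\<kappa> \<in> form n k" "\<And>T. \<pi> T \<in> P" "\<And>T. \<kappa> T \<in> Q"
      "\<And>T. \<eta> T - \<zeta> T - kdiff n \<theta> T = \<pi> T + \<kappa> T"
      using form_split[OF D th(2) P Q] by blast
    have "\<eta> T - \<pi> T - \<zeta> T - kdiff n \<theta> T = \<kappa> T" for T
      using s(5)[of T] by (simp add: algebra_simps)
    then show ?thesis
      using s Suc kdiff_form[OF th(1)] by (intro bexI[of _ "kdiff n \<theta>"] bexI[of _ \<pi>]) auto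
  qed
  then obtain \<theta> \<pi> where s: "\<theta> \<in> form n k" "\<pi> \<in> form n k" "\<And>T. \<pi> T \<in> P"
    "\<And>T. \<eta> T - \<pi> T - \<zeta> T - \<theta> T \<in> Q" "\<And>T. kdiff n \<theta> T = 0"
    by blast
  show "\<exists>\<eta>\<in>form n k. \<forall>T. w T - kdiff n \<eta> T \<in> P \<inter> Q"
  proof (intro bexI allI)
    show "(\<lambda>T. \<eta> T - \<pi> T) \<in> form n k" by (intro form_diff eta s)
    fix T
    have E: "w T - kdiff n (\<lambda>T. \<eta> T - \<pi> T) T = (w T - kdiff n \<eta> T) + kdiff n \<pi> T"
      by (simp add: kdiff_diff)
    have 1: "w T - kdiff n (\<lambda>T. \<eta> T - \<pi> T) T \<in> P"
      unfolding E by (intro ideal_add[OF P eta(2)] kdiff_ideal[OF P] s(3))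
    have "kdiff n (\<lambda>T. \<eta> T - \<pi> T - \<zeta> T - \<theta> T) T = kdiff n (\<lambda>T. \<eta> T - \<pi> T) T - kdiff n \<zeta> T"
      by (simp add: kdiff_diff s(5))
    then have E: "w T - kdiff n (\<lambda>T. \<eta> T - \<pi> T) T
        = (w T - kdiff n \<zeta> T) - kdiff n (\<lambda>T. \<eta> T - \<pi> T - \<zeta> T - \<theta> T) T"
      by simp
    have "w T - kdiff n (\<lambda>T. \<eta> T - \<pi> T) T \<in> Q"
      unfolding E by (intro ideal_diff[OF Q zeta(2)] kdiff_ideal[OF Q] s(4))
    with 1 show "w T - kdiff n (\<lambda>T. \<eta> T - \<pi> T) T \<in> P \<inter> Q" by simp
  qed
qed

text \<open>Contraction by \<open>x\<^sub>j\<close>, a homotopy for multiplication by \<open>x\<^sub>j\<close> on the Koszul complex.\<close>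

definition contract :: "nat \<Rightarrow> (nat set \<Rightarrow> 'k::field mpoly) \<Rightarrow> nat set \<Rightarrow> 'k mpoly" where
  "contract j w T = (if j \<in> T then 0 else ksgn j (insert j T) * w (insert j T))"

lemma contract_form:
  assumes "w \<in> form n (Suc k)"
  shows "contract j w \<in> form n k"
proof (rule formI)
  fix T
  show "contract j w T \<in> pol n"
    using assms by (auto simp: contract_def form_pol)
  assume "contract j w T \<noteq> 0"
  then have "j \<notin> T" "w (insert j T) \<noteq> 0"
    by (auto simp: contract_def split: if_splits)
  then have *: "insert j T \<subseteq> {1..n}" "card (insert j T) = k"
    using form_nonzeroD[OF assms, of "insert j T"] by simp_all
  have "finite T" by (rule finite_subset[of T "{1..n}"]) (use * in auto)
  then show "T \<subseteq> {1..n} \<and> Suc (card T) = k"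
    using * \<open>j \<notin> T\<close> by auto
qed

lemma kdiff_contract:
  assumes j: "j \<in> {1..n}"
  shows "kdiff n (contract j w) T + contract j (kdiff n w) T = var j * w T"
proof (cases "j \<in> T")
  case True
  have "kdiff n (contract j w) T = (\<Sum>i \<in> T \<inter> {1..n}. if i = j then var j * w T else 0)"
    unfolding kdiff_def
  proof (rule sum.cong)
    fix i assume i: "i \<in> T \<inter> {1..n}"
    show "ksgn i T * (var i * contract j w (T - {i})) = (if i = j then var j * w T else 0)"
    proof (cases "i = j")
      case eq: True
      have "insert j (T - {j}) = T" using True by auto
      then have "ksgn i T * (var i * contract j w (T - {i})) = ksgn j T * (ksgn j T * (var j * w T))"
        using eq by (simp add: contract_def mult_ac)
      then show ?thesis using eq by simp
    qed (use True in \<open>auto simp: contract_def\<close>)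
  qed simp
  also have "\<dots> = var j * w T" using True j by simp
  finally show ?thesis using True by (simp add: contract_def)
next
  case False
  let ?U = "insert j T"
  have "?U \<inter> {1..n} = insert j (T \<inter> {1..n})" using j by auto
  moreover have "?U - {j} = T" using False by auto
  ultimately have "kdiff n w ?U = ksgn j ?U * (var j * w T)
      + (\<Sum>i \<in> T \<inter> {1..n}. ksgn i ?U * (var i * w (?U - {i})))"
    unfolding kdiff_def using False by simp
  then have "contract j (kdiff n w) T = var j * w T
      + (\<Sum>i \<in> T \<inter> {1..n}. (ksgn j ?U * ksgn i ?U) * (var i * w (?U - {i})))"
    using False by (simp add: contract_def distrib_left sum_distrib_left mult.assoc)
  also have "(\<Sum>i \<in> T \<inter> {1..n}. (ksgn j ?U * ksgn i ?U) * (var i * w (?U - {i})))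
      = (\<Sum>i \<in> T \<inter> {1..n}. - (ksgn i T * (var i * contract j w (T - {i}))))"
  proof (rule sum.cong)
    fix i assume i: "i \<in> T \<inter> {1..n}"
    then have "i \<noteq> j" using False by auto
    then have "insert j (T - {i}) = ?U - {i}" by auto
    with ksgn_swap'[of j ?U i, where 'k = 'a] i \<open>i \<noteq> j\<close> \<open>?U - {j} = T\<close> False
    show "(ksgn j ?U * ksgn i ?U) * (var i * w (?U - {i})) = - (ksgn i T * (var i * contract j w (T - {i})))"
      by (simp add: contract_def mult_ac)
  qed simp
  finally show ?thesis unfolding kdiff_def by (simp add: sum_negf)
qed

section \<open>Annihilation of Koszul cohomology by the graded maximal ideal\<close>

lemma ideal_graded_max_ideal: "ideal (graded_max_ideal n :: 'k::field mpoly set) (poly_ring n)"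
proof -
  interpret cring "poly_ring n :: 'k mpoly ring" by (rule cring_poly_ring)
  show ?thesis
    unfolding graded_max_ideal_def by (rule genideal_ideal) auto
qed

lemma graded_max_ideal_least:
  fixes I :: "'k::field mpoly set"
  assumes "ideal I (poly_ring n)" "\<And>i. i \<in> {1..n} \<Longrightarrow> var i \<in> I"
  shows "graded_max_ideal n \<subseteq> I"
proof -
  interpret cring "poly_ring n :: 'k mpoly ring" by (rule cring_poly_ring)
  show ?thesis
    unfolding graded_max_ideal_def by (rule genideal_minimal) (use assms in auto)
qed

lemma var_graded_max_ideal:
  assumes "i \<in> {1..n}"
  shows "var i \<in> (graded_max_ideal n :: 'k::field mpoly set)"
proof -
  interpret cring "poly_ring n :: 'k mpoly ring" by (rule cring_poly_ring)
  have "var ` {1..n} \<subseteq> (graded_max_ideal n :: 'k mpoly set)"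
    unfolding graded_max_ideal_def by (rule genideal_self) (use pol_var in blast)
  then show ?thesis using assms by blast
qed

text \<open>The polynomials f for which f w is a coboundary modulo I form an ideal, and
  \<open>kdiff_contract\<close> puts every variable into it.\<close>

lemma max_ideal_annihilates:
  fixes I :: "'k::field mpoly set"
  assumes I: "ideal I (poly_ring n)" and f: "f \<in> graded_max_ideal n"
    and w: "w \<in> form n (Suc k)" and dw: "\<And>T. kdiff n w T \<in> I"
  shows "\<exists>\<zeta> \<in> form n k. \<forall>T. f * w T - kdiff n \<zeta> T \<in> I"
proof -
  let ?K = "{f \<in> pol n. \<exists>\<zeta> \<in> form n k. \<forall>T. f * w T - kdiff n \<zeta> T \<in> I}"
  have "ideal ?K (poly_ring n)"
  proof (rule ideal_polyI)
    show "0 \<in> ?K" using form_zero[of n k] ideal_zero[OF I] by force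
  next
    fix p q assume "p \<in> ?K" "q \<in> ?K"
    then obtain \<zeta> \<zeta>' where *: "p \<in> pol n" "q \<in> pol n" "\<zeta> \<in> form n k" "\<zeta>' \<in> form n k"
      "\<And>T. p * w T - kdiff n \<zeta> T \<in> I" "\<And>T. q * w T - kdiff n \<zeta>' T \<in> I" by blast
    have "(p + q) * w T - kdiff n (\<lambda>T. \<zeta> T + \<zeta>' T) T \<in> I" for T
      using ideal_add[OF I *(5)[of T] *(6)[of T]] by (simp add: kdiff_add algebra_simps)
    then show "p + q \<in> ?K" using form_add[OF *(3,4)] *(1,2) by blast
  next
    fix s p assume s: "s \<in> (pol n :: 'k mpoly set)" and "p \<in> ?K"
    then obtain \<zeta> where *: "p \<in> pol n" "\<zeta> \<in> form n k" "\<And>T. p * w T - kdiff n \<zeta> T \<in> I" by blast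
    have "s * p * w T - kdiff n (\<lambda>T. s * \<zeta> T) T \<in> I" for T
      using ideal_mult[OF I s *(3)[of T]] by (simp add: kdiff_mult algebra_simps)
    then show "s * p \<in> ?K" using form_mult[OF *(2) s] *(1) s by blast
  qed auto
  moreover have "var j \<in> ?K" if j: "j \<in> {1..n}" for j
  proof -
    have "var j * w T - kdiff n (contract j w) T \<in> I" for T
    proof -
      have "var j * w T - kdiff n (contract j w) T = contract j (kdiff n w) T"
        using kdiff_contract[OF j, of w T] by (simp add: algebra_simps)
      then show ?thesis
        unfolding contract_def using dw ideal_zero[OF I] ideal_mult[OF I] by auto
    qed
    then show ?thesis using contract_form[OF w, of j] j by blast
  qed
  ultimately have "graded_max_ideal n \<subseteq> ?K" by (rule graded_max_ideal_least)
  then show ?thesis using f by blast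
qed

definition nonzerodivisor_mod :: "nat \<Rightarrow> 'k::field mpoly set \<Rightarrow> 'k mpoly \<Rightarrow> bool" where
  "nonzerodivisor_mod n I f \<longleftrightarrow> f \<in> pol n \<and> (\<forall>v \<in> pol n. f * v \<in> I \<longrightarrow> v \<in> I)"

text \<open>Forward, (I : f) = I reduces this to \<open>koszul_vanish_quotient\<close>. Backward, f
  annihilates cohomology: f w = d \<chi> modulo I, so \<chi> is a cocycle modulo (I, f) and \<chi> =
  d \<zeta> + f \<eta> modulo I. Then f (w - d \<eta>) lies in I, and f can be cancelled.\<close>

lemma koszul_vanish_nonzerodivisor:
  assumes I: "ideal I (poly_ring n)" and nzd: "nonzerodivisor_mod n I f"
    and f: "f \<in> graded_max_ideal n"
  shows "koszul_vanish n (Suc r) I \<longleftrightarrow> koszul_vanish n r (ideal_plus I (princ n f))"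
proof
  have fp: "f \<in> pol n" using nzd by (simp add: nonzerodivisor_mod_def)
  have "g * f \<in> I \<longleftrightarrow> g \<in> I" if "g \<in> pol n" for g
    using nzd that ideal_mult[OF I fp, of g] unfolding nonzerodivisor_mod_def mult.commute[of g f] by blast
  then have eq: "colon n I f = I"
    using ideal_pol[OF I] unfolding colon_ideal_def poly_ring_simps by blast
  show "koszul_vanish n r (ideal_plus I (princ n f))" if "koszul_vanish n (Suc r) I"
    by (rule koszul_vanish_quotient[OF I fp]) (use that koszul_vanish_mono[OF that, of r] eq in simp_all)
  assume V: "koszul_vanish n r (ideal_plus I (princ n f))"
  show "koszul_vanish n (Suc r) I"
  proof (rule koszul_vanishI)
    fix k w assume k: "k < Suc r" and w: "w \<in> form n (Suc k)" and dw: "\<And>T. kdiff n w T \<in> I"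
    obtain \<chi> where h: "\<chi> \<in> form n k" "\<And>T. f * w T - kdiff n \<chi> T \<in> I"
      using max_ideal_annihilates[OF I f w dw] by blast
    show "\<exists>\<eta>\<in>form n k. \<forall>T. w T - kdiff n \<eta> T \<in> I"
    proof (cases k)
      case 0
      then have "\<chi> = (\<lambda>T. 0)" using form_nonzeroD[OF h(1)] by blast
      then have "f * w T \<in> I" for T using h(2)[of T] by simp
      then have "w T \<in> I" for T
        using nzd form_pol[OF w] unfolding nonzerodivisor_mod_def by blast
      then show ?thesis using form_zero[of n k] by force
    next
      case (Suc k')
      have "kdiff n \<chi> T \<in> ideal_plus I (princ n f)" for T
      proof -
        have "kdiff n \<chi> T = - (f * w T - kdiff n \<chi> T) + f * w T" by simp
        then show ?thesis
          unfolding ideal_plus_def princ_def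
          using ideal_uminus[OF I h(2)[of T]] form_pol[OF w, of T] by blast
      qed
      then obtain \<zeta> where z: "\<zeta> \<in> form n k'" "\<And>T. \<chi> T - kdiff n \<zeta> T \<in> ideal_plus I (princ n f)"
        using koszul_vanishD[OF V, of k' \<chi>] k h(1) Suc by auto
      have D: "(\<lambda>T. \<chi> T - kdiff n \<zeta> T) \<in> form n k"
        using form_diff[OF h(1)] kdiff_form[OF z(1)] Suc by simp
      obtain \<beta> \<eta> where s: "\<beta> \<in> form n k" "\<eta> \<in> form n k" "\<And>T. \<beta> T \<in> I"
        "\<And>T. \<chi> T - kdiff n \<zeta> T = \<beta> T + f * \<eta> T"
        using form_split_princ[OF D z(2) I fp] by blast
      have "w T - kdiff n \<eta> T \<in> I" for T
      proof -
        have "kdiff n (\<lambda>T. \<chi> T - kdiff n \<zeta> T) T = kdiff n (\<lambda>T. \<beta> T + f * \<eta> T) T"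
          using s(4) by simp
        then have "kdiff n \<chi> T = kdiff n \<beta> T + f * kdiff n \<eta> T"
          by (simp add: kdiff_diff kdiff_add kdiff_mult)
        then have "f * (w T - kdiff n \<eta> T) = (f * w T - kdiff n \<chi> T) + kdiff n \<beta> T"
          by (simp add: algebra_simps)
        then have "f * (w T - kdiff n \<eta> T) \<in> I"
          using ideal_add[OF I h(2)[of T] kdiff_ideal[OF I, of \<beta> T]] s(3) by simp
        then show ?thesis
          using nzd form_pol[OF form_diff[OF w]] kdiff_form[OF s(2)] Suc unfolding nonzerodivisor_mod_def by blast
      qed
      then show ?thesis using s(2) by blast
    qed
  qed
qed

section \<open>Monomial ideals\<close>

definition exps :: "nat \<Rightarrow> (nat \<Rightarrow>\<^sub>0 nat) set" where
  "exps n = {a. keys a \<subseteq> {1..n}}"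

text \<open>Storing all exponents instead of generators turns sums, intersections and colons by
  monomials into unions, intersections and shifts of exponent sets.\<close>

definition mono_ideal :: "(nat \<Rightarrow>\<^sub>0 nat) set \<Rightarrow> 'k::field mpoly set" where
  "mono_ideal U = {p. keys p \<subseteq> U}"

abbreviation (input) mono_vanish :: "'k::field itself \<Rightarrow> nat \<Rightarrow> nat \<Rightarrow> (nat \<Rightarrow>\<^sub>0 nat) set \<Rightarrow> bool" where
  "mono_vanish K n r U \<equiv> koszul_vanish n r (mono_ideal U :: 'k mpoly set)"

definition upset :: "nat \<Rightarrow> (nat \<Rightarrow>\<^sub>0 nat) set \<Rightarrow> bool" where
  "upset n U \<longleftrightarrow> U \<subseteq> exps n \<and> (\<forall>a \<in> U. \<forall>c \<in> exps n. a + c \<in> U)"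

definition up :: "nat \<Rightarrow> (nat \<Rightarrow>\<^sub>0 nat) \<Rightarrow> (nat \<Rightarrow>\<^sub>0 nat) set" where
  "up n u = {u + c |c. c \<in> exps n}"

abbreviation monom :: "(nat \<Rightarrow>\<^sub>0 nat) \<Rightarrow> 'k::field mpoly" where
  "monom u \<equiv> single u 1"

lemma mem_pol_iff: "p \<in> pol n \<longleftrightarrow> keys p \<subseteq> exps n"
  by (auto simp: pol_iff exps_def)

lemma pol_eq_mono_ideal: "pol n = mono_ideal (exps n)"
  by (auto simp: mem_pol_iff mono_ideal_def)

lemma exps_zero [simp, intro]: "0 \<in> exps n"
  by (simp add: exps_def)

lemma exps_add_iff [simp]: "a + b \<in> exps n \<longleftrightarrow> a \<in> exps n \<and> b \<in> exps n"
  by (auto simp: exps_def subset_iff in_keys_iff lookup_add)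

lemma exps_sum [intro]: "(\<And>i. i \<in> A \<Longrightarrow> f i \<in> exps n) \<Longrightarrow> sum f A \<in> exps n"
  by (induction A rule: infinite_finite_induct) auto

lemma exps_single [simp]: "i \<in> {1..n} \<Longrightarrow> single i c \<in> exps n"
  by (simp add: exps_def)

lemma exps_minus: "a \<in> exps n \<Longrightarrow> a - b \<in> exps n"
  by (auto simp: exps_def subset_iff in_keys_iff lookup_minus)

lemma exps_lookup: "a \<in> exps n \<Longrightarrow> v \<notin> {1..n} \<Longrightarrow> lookup a v = 0"
  by (auto simp: exps_def subset_iff in_keys_iff)

lemma monom_pol [simp]: "monom u \<in> pol n \<longleftrightarrow> u \<in> exps n"
  by (simp add: mem_pol_iff)

lemma lookup_monom_mult:
  "lookup (monom u * p) (u + a) = lookup (p :: 'k::field mpoly) a"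
  by (simp add: lookup_mult lookup_single when_mult Sum_any_when_equal)

lemma keys_monom_mult: "keys (monom u * p :: 'k::field mpoly) = (+) u ` keys p"
proof
  show "keys (monom u * p) \<subseteq> (+) u ` keys p"
    using keys_mult[of "monom u :: 'k mpoly" p] by auto
  show "(+) u ` keys p \<subseteq> keys (monom u * p)"
    by (auto simp: in_keys_iff lookup_monom_mult)
qed

lemma lookup_monom_mult_0:
  "k \<notin> range ((+) u) \<Longrightarrow> lookup (monom u * p :: 'k::field mpoly) k = 0"
  using keys_monom_mult[of u p] not_in_keys_iff_lookup_eq_zero[of k "monom u * p"] by blast

lemma ideal_mono_ideal:
  assumes "upset n U"
  shows "ideal (mono_ideal U :: 'k::field mpoly set) (poly_ring n)"
proof (rule ideal_polyI)
  show "mono_ideal U \<subseteq> (pol n :: 'k mpoly set)"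
    using assms by (auto simp: mono_ideal_def mem_pol_iff upset_def)
next
  fix p q :: "'k mpoly" assume "p \<in> mono_ideal U" "q \<in> mono_ideal U"
  then show "p + q \<in> mono_ideal U"
    using Poly_Mapping.keys_add[of p q] by (auto simp: mono_ideal_def)
next
  fix s p :: "'k mpoly" assume "s \<in> pol n" "p \<in> mono_ideal U"
  then show "s * p \<in> mono_ideal U"
    using keys_mult[of s p] assms unfolding mono_ideal_def mem_pol_iff upset_def
    by (auto simp: add.commute) (smt (verit) add.commute mem_Collect_eq subsetD)
qed (simp add: mono_ideal_def)

lemma mono_ideal_inter: "mono_ideal U \<inter> mono_ideal V = mono_ideal (U \<inter> V)"
  by (auto simp: mono_ideal_def)

definition keep :: "(nat \<Rightarrow>\<^sub>0 nat) set \<Rightarrow> 'k::field mpoly \<Rightarrow> 'k mpoly" where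
  "keep A p = Poly_Mapping.mapp (\<lambda>e c. c when e \<in> A) p"

lemma lookup_keep: "lookup (keep A p) e = (lookup p e when e \<in> A)"
  by (auto simp: keep_def lookup_mapp when_def in_keys_iff)

lemma keys_keep [simp]: "keys (keep A p) = keys p \<inter> A"
  by (auto simp: in_keys_iff lookup_keep when_def split: if_splits)

lemma keep_add: "keep A (p + q) = keep A p + keep A q"
  by (rule poly_mapping_eqI) (simp add: lookup_keep lookup_add when_add_distrib)

lemma keep_uminus: "keep A (- p) = - keep A p"
  by (rule poly_mapping_eqI) (simp add: lookup_keep when_uminus_distrib)

lemma keep_zero [simp]: "keep A 0 = 0"
  by (rule poly_mapping_eqI) (simp add: lookup_keep)

lemma keep_diff: "keep A (p - q) = keep A p - keep A q"
  using keep_add[of A p "- q"] by (simp add: keep_uminus)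

lemma keep_sum: "keep A (sum f B) = (\<Sum>i \<in> B. keep A (f i))"
  by (induction B rule: infinite_finite_induct) (simp_all add: keep_add)

lemma keep_pol [simp]: "p \<in> pol n \<Longrightarrow> keep A p \<in> pol n"
  by (auto simp: mem_pol_iff)

lemma ideal_plus_mono_ideal: "ideal_plus (mono_ideal U) (mono_ideal V) = mono_ideal (U \<union> V)"
proof
  show "ideal_plus (mono_ideal U) (mono_ideal V) \<subseteq> mono_ideal (U \<union> V)"
  proof
    fix p assume "p \<in> ideal_plus (mono_ideal U) (mono_ideal V)"
    then obtain a b where "p = a + b" "a \<in> mono_ideal U" "b \<in> mono_ideal V"
      by (auto simp: ideal_plus_def)
    then show "p \<in> mono_ideal (U \<union> V)"
      using Poly_Mapping.keys_add[of a b] by (auto simp: mono_ideal_def)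
  qed
  show "mono_ideal (U \<union> V) \<subseteq> ideal_plus (mono_ideal U) (mono_ideal V)"
  proof
    fix p assume "p \<in> mono_ideal (U \<union> V)"
    moreover have "p = keep U p + keep (- U) p"
      by (rule poly_mapping_eqI) (simp add: lookup_keep lookup_add when_def)
    moreover have "keys (keep U p) \<subseteq> U" by simp
    ultimately show "p \<in> ideal_plus (mono_ideal U) (mono_ideal V)"
      unfolding ideal_plus_def mono_ideal_def mem_Collect_eq
      by (intro exI[of _ "keep U p"] exI[of _ "keep (- U) p"]) auto
  qed
qed

lemma colon_mono_ideal:
  assumes "u \<in> exps n"
  shows "colon n (mono_ideal U) (monom u) = mono_ideal {a \<in> exps n. a + u \<in> U}"
  using assms by (auto simp: colon_ideal_iff mono_ideal_def mem_pol_iff keys_monom_mult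
      mult.commute[of _ "monom u"] add.commute[of _ u] image_subset_iff)

lemma princ_monom:
  assumes u: "u \<in> exps n"
  shows "princ n (monom u) = mono_ideal (up n u)"
proof
  show "princ n (monom u) \<subseteq> mono_ideal (up n u)"
    unfolding princ_def mono_ideal_def up_def by (auto simp: keys_monom_mult mem_pol_iff) blast
  show "mono_ideal (up n u) \<subseteq> (princ n (monom u) :: 'a mpoly set)"
  proof
    fix p :: "'a mpoly" assume p: "p \<in> mono_ideal (up n u)"
    \<comment> \<open>Division by the monomial: the coefficient of q at a is that of p at u +
      a.\<close>
    define q where "q = Poly_Mapping.map_key ((+) u) p"
    have q: "lookup q a = lookup p (u + a)" for a
      unfolding q_def by (subst map_key.rep_eq) (simp_all add: inj_def)
    have "p = monom u * q"
    proof (rule poly_mapping_eqI)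
      fix k
      show "lookup p k = lookup (monom u * q) k"
      proof (cases "k \<in> range ((+) u)")
        case True
        then show ?thesis by (auto simp: lookup_monom_mult q)
      next
        case False
        then have "k \<notin> keys p" using p by (auto simp: mono_ideal_def up_def)
        then show ?thesis using False by (simp add: lookup_monom_mult_0 in_keys_iff)
      qed
    qed
    moreover have "q \<in> pol n"
      using p q by (fastforce simp: mem_pol_iff mono_ideal_def up_def in_keys_iff subset_iff)
    ultimately show "p \<in> princ n (monom u)" by (auto simp: princ_def)
  qed
qed

lemma upset_colon: "upset n U \<Longrightarrow> upset n {a \<in> exps n. a + u \<in> U}"
  unfolding upset_def by (auto simp: add.assoc add.commute[of _ u])

section \<open>Colons of monomial ideals by monomials\<close>

lemma ksgn_cases: "ksgn j T = 1 \<or> ksgn j T = - 1"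
  unfolding ksgn_def by (cases "even (card {k \<in> T. k < j})") auto

text \<open>
  Multiplication by \<open>x\<^sub>v\<close> embeds \<open>S/(I : x\<^sub>v)\<close> into \<open>S/I\<close>. A primitive \<open>\<eta>\<close> of \<open>x\<^sub>v w\<close> need not
  be divisible by \<open>x\<^sub>v\<close>; its \<open>x\<^sub>v\<close>-free part \<open>\<eta>\<^sub>0\<close> gives rise to a cocycle \<open>\<eta>\<^sub>0 \<and> dx\<^sub>v\<close> modulo \<open>I\<close>,
  which is a coboundary as well.
\<close>

lemma koszul_vanish_colon_var:
  assumes U: "upset n U" and v: "v \<in> {1..n}"
    and V: "mono_vanish TYPE('k::field) n r U"
  shows "koszul_vanish n r (colon n (mono_ideal U :: 'k mpoly set) (var v))"
proof (rule koszul_vanishI)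
  let ?I = "mono_ideal U :: 'k mpoly set" and ?x = "var v :: 'k mpoly"
  let ?A = "colon n ?I ?x"
  note I = ideal_mono_ideal[OF U, where 'k = 'k]
  have xp: "?x \<in> pol n" using v by simp
  note A = ideal_colon[OF I xp]
  \<comment> \<open>Reduction modulo x_v as a linear map on polynomials: it drops the terms
    divisible by x_v and preserves monomial ideals.\<close>
  define z where "z = (keep {e. lookup e v = 0} :: 'k mpoly \<Rightarrow> _)"
  have z_I: "z p \<in> ?I" if "p \<in> ?I" for p
    using that by (auto simp: z_def mono_ideal_def)
  have z_var: "z (var j * p) = (if j = v then 0 else var j * z p)" for j p
  proof (rule poly_mapping_eqI)
    fix k
    show "lookup (z (var j * p)) k = lookup (if j = v then 0 else var j * z p) k"
    proof (cases "k \<in> range ((+) (single j 1))")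
      case True
      then obtain a where k: "k = single j 1 + a" by blast
      show ?thesis unfolding k z_def var_def
        by (auto simp: lookup_keep lookup_monom_mult lookup_add lookup_single when_def)
    next
      case False
      then show ?thesis unfolding z_def var_def
        by (auto simp: lookup_keep lookup_monom_mult_0)
    qed
  qed
  have z_sgn: "z (ksgn j T * p) = ksgn j T * z p" for j T p
  proof -
    consider "ksgn j T = (1 :: 'k mpoly)" | "ksgn j T = (- 1 :: 'k mpoly)" using ksgn_cases by blast
    then show ?thesis by cases (simp_all add: z_def keep_uminus)
  qed
  have z_rest: "\<exists>q \<in> pol n. p - z p = ?x * q" if "p \<in> pol n" for p
  proof -
    have "p - z p \<in> mono_ideal (up n (single v 1))"
      unfolding mono_ideal_def
    proof safe
      fix e assume "e \<in> keys (p - z p)"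
      then have "lookup p e - lookup (z p) e \<noteq> 0"
        by (simp add: in_keys_iff lookup_minus)
      then have e: "e \<in> keys p" "lookup e v \<noteq> 0"
        by (auto simp: z_def lookup_keep when_def in_keys_iff split: if_splits)
      then have "e = single v 1 + (e - single v 1)"
        by (intro poly_mapping_eqI) (auto simp: lookup_add lookup_minus lookup_single when_def)
      moreover have "e - single v 1 \<in> exps n"
        using e that by (intro exps_minus) (auto simp: mem_pol_iff)
      ultimately show "e \<in> up n (single v 1)" unfolding up_def by blast
    qed
    then have "p - z p \<in> princ n ?x"
      using princ_monom[of "single v 1" n, where 'a = 'k] v by (simp add: var_def)
    then show ?thesis by (auto simp: princ_def)
  qed

  fix k w assume k: "k < r" and w: "w \<in> form n (Suc k)" and dw: "\<And>T. kdiff n w T \<in> ?A"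
  have "kdiff n (\<lambda>T. ?x * w T) T \<in> ?I" for T
    using dw[of T] by (simp add: kdiff_mult colon_ideal_iff mult.commute)
  then obtain \<eta> where eta: "\<eta> \<in> form n k" "\<And>T. ?x * w T - kdiff n \<eta> T \<in> ?I"
    using koszul_vanishD[OF V k form_mult[OF w xp]] by blast
  have "\<exists>q. q \<in> pol n \<and> \<eta> T - z (\<eta> T) = ?x * q \<and> (\<eta> T = 0 \<longrightarrow> q = 0)" for T
  proof (cases "\<eta> T = 0")
    case True
    then show ?thesis by (intro exI[of _ 0]) (simp add: z_def)
  next
    case False
    then show ?thesis using z_rest[OF form_pol[OF eta(1), of T]] by blast
  qed
  then obtain \<eta>' where eta': "\<And>T. \<eta>' T \<in> pol n" "\<And>T. \<eta> T - z (\<eta> T) = ?x * \<eta>' T"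
    "\<And>T. \<eta> T = 0 \<Longrightarrow> \<eta>' T = 0" by metis
  have eta'_form: "\<eta>' \<in> form n k"
    using eta' form_nonzeroD[OF eta(1)] by (intro formI) blast+
  define \<eta>0 where "\<eta>0 = (\<lambda>T. z (\<eta> T))"
  \<comment> \<open>This is dx_v \<and> \<open>\<eta>0\<close>. Since \<open>\<eta>0\<close> is free
    of x_v, it is the coefficient of x_v in d \<open>\<eta>0\<close>; the rest of d
    \<open>\<eta>0\<close> is the reduction of d \<eta>.\<close>
  define \<rho> where "\<rho> = (\<lambda>T. if v \<in> T then ksgn v T * \<eta>0 (T - {v}) else 0)"
  have d\<eta>0: "kdiff n \<eta>0 T = z (kdiff n \<eta> T) + ?x * \<rho> T" for T
  proof -
    have "z (kdiff n \<eta> T) = (\<Sum>j \<in> T \<inter> {1..n}. if j = v then 0 else ksgn j T * (var j * \<eta>0 (T - {j})))"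
      unfolding kdiff_def z_def keep_sum
      by (intro sum.cong refl) (simp add: z_var[unfolded z_def] z_sgn[unfolded z_def] \<eta>0_def z_def)
    moreover have "?x * \<rho> T = (\<Sum>j \<in> T \<inter> {1..n}. if j = v then ksgn j T * (var j * \<eta>0 (T - {j})) else 0)"
      using v by (simp add: \<rho>_def sum.delta mult_ac)
    ultimately have "z (kdiff n \<eta> T) + ?x * \<rho> T
        = (\<Sum>j \<in> T \<inter> {1..n}. (if j = v then 0 else ksgn j T * (var j * \<eta>0 (T - {j})))
            + (if j = v then ksgn j T * (var j * \<eta>0 (T - {j})) else 0))"
      by (simp only: sum.distrib)
    also have "\<dots> = kdiff n \<eta>0 T"
      unfolding kdiff_def by (rule sum.cong) auto
    finally show ?thesis ..
  qed
  \<comment> \<open>Because d \<eta> = x_v w modulo I and the reduction kills x_v w.\<close>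
  have z_d: "z (kdiff n \<eta> T) \<in> ?I" for T
  proof -
    have "z (kdiff n \<eta> T) = - z (?x * w T - kdiff n \<eta> T)"
      using z_var[of v "w T"] by (simp add: z_def keep_diff)
    then show ?thesis using ideal_uminus[OF I z_I[OF eta(2)[of T]]] by simp
  qed
  have \<rho>_form: "\<rho> \<in> form n (Suc k)"
  proof (rule formI)
    fix T
    show "\<rho> T \<in> pol n"
      using form_pol[OF eta(1)] by (auto simp: \<rho>_def \<eta>0_def z_def)
    assume "\<rho> T \<noteq> 0"
    then have vT: "v \<in> T" and "\<eta> (T - {v}) \<noteq> 0"
      by (auto simp: \<rho>_def \<eta>0_def z_def split: if_splits)
    then have *: "T - {v} \<subseteq> {1..n}" "Suc (card (T - {v})) = k"
      using form_nonzeroD[OF eta(1), of "T - {v}"] by auto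
    then have T: "T \<subseteq> {1..n}" using v by auto
    have "finite T" by (rule finite_subset[OF T]) simp
    then show "T \<subseteq> {1..n} \<and> Suc (card T) = Suc k"
      using T card_Suc_Diff1[of T v] *(2) vT by linarith
  qed
  have "kdiff n \<rho> T \<in> ?I" for T
  proof (cases "v \<in> T")
    case False
    then have "kdiff n \<rho> T = 0" unfolding kdiff_def by (intro sum.neutral) (auto simp: \<rho>_def)
    then show ?thesis using ideal_zero[OF I] by simp
  next
    case True
    have "kdiff n \<rho> T = (\<Sum>j \<in> (T - {v}) \<inter> {1..n}. ksgn j T * (var j * \<rho> (T - {j})))"
      unfolding kdiff_def by (rule sum.mono_neutral_right) (auto simp: \<rho>_def)
    also have "\<dots> = (\<Sum>j \<in> (T - {v}) \<inter> {1..n}. - ksgn v T * (ksgn j (T - {v}) * (var j * \<eta>0 (T - {v} - {j}))))"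
    proof (rule sum.cong)
      fix j assume j: "j \<in> (T - {v}) \<inter> {1..n}"
      then have e: "T - {j} - {v} = T - {v} - {j}" and \<rho>j: "\<rho> (T - {j}) = ksgn v (T - {j}) * \<eta>0 (T - {j} - {v})"
        using True by (auto simp: \<rho>_def)
      have "ksgn j T * (var j * \<rho> (T - {j})) = (ksgn j T * ksgn v (T - {j})) * (var j * \<eta>0 (T - {v} - {j}))"
        unfolding \<rho>j e by (simp add: mult_ac)
      also have "ksgn j T * ksgn v (T - {j}) = - (ksgn v T * ksgn j (T - {v}) :: 'k mpoly)"
        using j True by (intro ksgn_swap) auto
      finally show "ksgn j T * (var j * \<rho> (T - {j})) = - ksgn v T * (ksgn j (T - {v}) * (var j * \<eta>0 (T - {v} - {j})))"
        by (simp add: mult.assoc)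
    qed simp
    also have "\<dots> = - ksgn v T * kdiff n \<eta>0 (T - {v})"
      unfolding kdiff_def sum_distrib_left ..
    also have "kdiff n \<eta>0 (T - {v}) = z (kdiff n \<eta> (T - {v}))"
      using d\<eta>0[of "T - {v}"] by (simp add: \<rho>_def)
    finally show ?thesis
      using ideal_mult[OF I _ z_d[of "T - {v}"], of "- ksgn v T"] by simp
  qed
  then obtain \<zeta> where zeta: "\<zeta> \<in> form n k" "\<And>T. \<rho> T - kdiff n \<zeta> T \<in> ?I"
    using koszul_vanishD[OF V k \<rho>_form] by blast
  show "\<exists>\<eta>\<in>form n k. \<forall>T. w T - kdiff n \<eta> T \<in> ?A"
  proof (intro bexI allI)
    show "(\<lambda>T. \<eta>' T + \<zeta> T) \<in> form n k" by (intro form_add eta'_form zeta)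
    fix T
    have "kdiff n \<eta> T = kdiff n (\<lambda>T. \<eta>0 T + ?x * \<eta>' T) T"
      using eta'(2) by (simp add: \<eta>0_def algebra_simps)
    then have "kdiff n \<eta> T = kdiff n \<eta>0 T + ?x * kdiff n \<eta>' T"
      by (simp add: kdiff_add kdiff_mult)
    then have "(w T - kdiff n (\<lambda>T. \<eta>' T + \<zeta> T) T) * ?x
      = (?x * w T - kdiff n \<eta> T) + z (kdiff n \<eta> T) + ?x * (\<rho> T - kdiff n \<zeta> T)"
      by (simp add: kdiff_add d\<eta>0 algebra_simps)
    then have "(w T - kdiff n (\<lambda>T. \<eta>' T + \<zeta> T) T) * ?x \<in> ?I"
      using ideal_add[OF I ideal_add[OF I eta(2)[of T] z_d[of T]] ideal_mult[OF I xp zeta(2)[of T]]] by simp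
    then show "w T - kdiff n (\<lambda>T. \<eta>' T + \<zeta> T) T \<in> ?A"
      using form_pol[OF form_diff[OF w kdiff_form[OF form_add[OF eta'_form zeta(1)]]], of T]
      by (simp add: colon_ideal_iff)
  qed
qed

lemma exps_induct [consumes 1, case_names zero single]:
  assumes "u \<in> exps n" "P 0"
    "\<And>v u. v \<in> {1..n} \<Longrightarrow> u \<in> exps n \<Longrightarrow> P u \<Longrightarrow> P (single v 1 + u)"
  shows "P u"
  using assms(1)
proof (induction "\<Sum>i \<in> {1..n}. lookup u i" arbitrary: u)
  case 0
  then have "lookup u i = 0" for i
    using exps_lookup[of u n i] by (cases "i \<in> {1..n}") auto
  then have "u = 0" by (intro poly_mapping_eqI) simp
  then show ?case using assms(2) by simp
next
  case (Suc s)
  then obtain i where i: "i \<in> {1..n}" "lookup u i \<noteq> 0"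
    by (metis Zero_not_Suc sum.neutral)
  define w where "w = u - single i 1"
  have u: "u = single i 1 + w"
    using i by (intro poly_mapping_eqI) (auto simp: w_def lookup_add lookup_minus lookup_single when_def)
  have "(\<Sum>j \<in> {1..n}. lookup u j)
      = (\<Sum>j \<in> {1..n}. (if i = j then 1 else 0)) + (\<Sum>j \<in> {1..n}. lookup w j)"
    unfolding u lookup_add sum.distrib by (simp add: lookup_single when_def)
  then have "s = (\<Sum>j \<in> {1..n}. lookup w j)"
    using Suc.hyps(2) i(1) by simp
  moreover have "w \<in> exps n" using Suc.prems u exps_add_iff by metis
  ultimately show ?case using Suc.hyps(1) assms(3) i(1) u by metis
qed

lemma koszul_vanish_colon_monom:
  assumes u: "u \<in> exps n" and U: "upset n U"
    and V: "mono_vanish TYPE('k::field) n r U"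
  shows "mono_vanish TYPE('k) n r {a \<in> exps n. a + u \<in> U}"
  using u
proof (induction rule: exps_induct)
  case zero
  have "{a \<in> exps n. a + 0 \<in> U} = U" using U by (auto simp: upset_def)
  then show ?case using V by simp
next
  case (single v u)
  have "{a \<in> exps n. a + single v 1 \<in> {a \<in> exps n. a + u \<in> U}}
      = {a \<in> exps n. a + (single v 1 + u) \<in> U}"
    using single by (auto simp: add.assoc)
  then show ?case
    using koszul_vanish_colon_var[OF upset_colon[OF U] single(1,3)] single(1)
      colon_mono_ideal[of "single v 1" n "{a \<in> exps n. a + u \<in> U}", where 'a = 'k]
    by (simp add: var_def)
qed

section \<open>Noetherianity and zero divisors\<close>

lemma nat_seq_incseq_subseq:
  fixes f :: "nat \<Rightarrow> nat"
  obtains s where "strict_mono s" "incseq (\<lambda>i. f (s i))"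
proof -
  obtain s where s: "strict_mono s" "monoseq (\<lambda>i. f (s i))"
    using seq_monosub[of f] by blast
  show thesis
  proof (cases "incseq (\<lambda>i. f (s i))")
    case True
    then show ?thesis using that s by blast
  next
    case False
    then have dec: "decseq (\<lambda>i. f (s i))" using s(2) by (auto simp: monoseq_iff)
    obtain N where N: "\<And>i. f (s N) \<le> f (s i)"
      using ex_has_least_nat[of "\<lambda>_. True" _ "\<lambda>i. f (s i)"] by blast
    then have "f (s (N + i)) = f (s N)" for i
      using decseqD[OF dec, of N "N + i"] by (simp add: antisym)
    moreover have "strict_mono (\<lambda>i. s (N + i))"
      using s(1) by (simp add: strict_mono_def)
    ultimately show ?thesis using that[of "\<lambda>i. s (N + i)"] by (simp add: incseq_def)
  qed
qed

lemma exps_seq_incseq_subseq: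
  fixes f :: "nat \<Rightarrow> (nat \<Rightarrow>\<^sub>0 nat)"
  assumes "finite D"
  shows "\<exists>s. strict_mono s \<and> (\<forall>d \<in> D. incseq (\<lambda>i. lookup (f (s i)) d))"
  using assms
proof induction
  case empty
  then show ?case by (intro exI[of _ id]) (simp add: strict_mono_def)
next
  case (insert d D)
  then obtain s where s: "strict_mono s" "\<And>d. d \<in> D \<Longrightarrow> incseq (\<lambda>i. lookup (f (s i)) d)"
    by blast
  obtain s' where s': "strict_mono s'" "incseq (\<lambda>i. lookup (f (s (s' i))) d)"
    using nat_seq_incseq_subseq[of "\<lambda>i. lookup (f (s i)) d"] by blast
  have "incseq (\<lambda>i. lookup (f (s (s' i))) e)" if "e \<in> D" for e
    using s(2)[OF that] s'(1) by (simp add: incseq_def strict_mono_less_eq)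
  then show ?case
    using s(1) s' by (intro exI[of _ "s \<circ> s'"]) (auto simp: strict_mono_def)
qed

text \<open>Dickson's lemma: along a subsequence every coordinate is weakly increasing, so an
  earlier monomial divides a later one.\<close>

lemma dickson:
  fixes f :: "nat \<Rightarrow> (nat \<Rightarrow>\<^sub>0 nat)"
  assumes "\<And>k. f k \<in> exps n"
  obtains i j c where "i < j" "c \<in> exps n" "f j = f i + c"
proof -
  obtain s where s: "strict_mono s" "\<And>d. d \<in> {1..n} \<Longrightarrow> incseq (\<lambda>i. lookup (f (s i)) d)"
    using exps_seq_incseq_subseq[of "{1..n}" f] by auto
  have "lookup (f (s 0)) d \<le> lookup (f (s 1)) d" for d
  proof (cases "d \<in> {1..n}")
    case True
    then show ?thesis using incseqD[OF s(2), of d 0 1] by simp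
  next
    case False
    then show ?thesis using exps_lookup[OF assms] by simp
  qed
  then have "f (s 1) = f (s 0) + (f (s 1) - f (s 0))"
    by (intro poly_mapping_eqI) (simp add: lookup_add lookup_minus)
  moreover have "s 0 < s 1" using s(1) by (simp add: strict_mono_def)
  ultimately show thesis using that exps_minus[OF assms] by blast
qed

lemma poly_mapping_nat_nonneg: "(0 :: nat \<Rightarrow>\<^sub>0 nat) \<le> c"
proof -
  have "\<not> c < 0" by (simp add: less_poly_mapping.rep_eq less_fun_def)
  then show ?thesis by simp
qed

text \<open>The linear order on \<open>nat \<Rightarrow>\<^sub>0 nat\<close> is lexicographic and
  compatible with addition, so it can serve as a monomial order. On the whole type it is not
  well-founded, since \<open>single i 1\<close> descends as i grows; on \<open>exps n\<close> a
  descending sequence contradicts \<open>dickson\<close>.\<close>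

lemma exps_ex_least:
  assumes "X \<subseteq> exps n" "X \<noteq> {}"
  obtains a where "a \<in> X" "\<And>b. b \<in> X \<Longrightarrow> a \<le> b"
proof -
  have "wf {(a, b). a < b \<and> a \<in> exps n \<and> b \<in> exps n}"
    unfolding wf_iff_no_infinite_down_chain
  proof
    assume "\<exists>f. \<forall>i. (f (Suc i), f i) \<in> {(a, b). a < b \<and> a \<in> exps n \<and> b \<in> exps n}"
    then obtain f where f: "\<And>i. f (Suc i) < f i" "\<And>i. f i \<in> exps n" by blast
    then obtain i j c where "i < j" "f j = f i + c"
      using dickson[of f n] by metis
    moreover have "f j < f i"
      using lift_Suc_antimono_le[of f "Suc i" j] f(1) \<open>i < j\<close> by (meson Suc_leI le_less_trans less_imp_le)
    ultimately show False
      using add_left_mono[OF poly_mapping_nat_nonneg[of c], of "f i"] by simp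
  qed
  moreover obtain x where "x \<in> X" using assms(2) by blast
  ultimately obtain a where a: "a \<in> X" "\<And>b. (b, a) \<in> {(a, b). a < b \<and> a \<in> exps n \<and> b \<in> exps n} \<Longrightarrow> b \<notin> X"
    by (rule wfE_min) blast
  have "a \<le> b" if "b \<in> X" for b
  proof (rule ccontr)
    assume "\<not> a \<le> b"
    then have "b < a" by (rule linorder_not_le[THEN iffD1])
    moreover have "a \<in> exps n" "b \<in> exps n" using that a(1) assms(1) by blast+
    ultimately show False using a(2)[of b] that by blast
  qed
  then show thesis using that a(1) by blast
qed

definition lm :: "'k::field mpoly \<Rightarrow> (nat \<Rightarrow>\<^sub>0 nat)" where
  "lm p = Max (keys p)"

lemma lm_in_keys: "p \<noteq> 0 \<Longrightarrow> lm p \<in> keys p"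
  by (simp add: lm_def)

lemma le_lm: "e \<in> keys p \<Longrightarrow> e \<le> lm p"
  by (simp add: lm_def)

text \<open>If every step is strict, take \<open>g k\<close> in \<open>I (Suc k) - I k\<close> with
  least leading monomial. By \<open>dickson\<close> the leading monomial of some \<open>g i\<close>
  divides that of a later \<open>g j\<close>; subtracting a multiple of \<open>g i\<close> from
  \<open>g j\<close> cancels the leading term without entering \<open>I j\<close>, contrary to
  minimality.\<close>

lemma ideal_chain_stabilizes:
  fixes I :: "nat \<Rightarrow> 'k::field mpoly set"
  assumes I: "\<And>k. ideal (I k) (poly_ring n)" and inc: "\<And>k. I k \<subseteq> I (Suc k)"
  shows "\<exists>k. I (Suc k) = I k"
proof (rule ccontr)
  assume "\<nexists>k. I (Suc k) = I k"
  then have ne: "I (Suc k) - I k \<noteq> {}" for k using inc by blast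
  have "\<exists>g \<in> I (Suc k) - I k. \<forall>h \<in> I (Suc k) - I k. lm g \<le> lm h" for k
  proof -
    have "lm ` (I (Suc k) - I k) \<subseteq> exps n"
    proof (rule image_subsetI)
      fix g assume g: "g \<in> I (Suc k) - I k"
      then have "g \<noteq> 0" using ideal_zero[OF I[of k]] by auto
      then show "lm g \<in> exps n"
        using lm_in_keys[of g] ideal_pol[OF I, of g "Suc k"] g by (auto simp: mem_pol_iff)
    qed
    moreover have "lm ` (I (Suc k) - I k) \<noteq> {}" using ne by simp
    ultimately obtain a where "a \<in> lm ` (I (Suc k) - I k)" "\<And>b. b \<in> lm ` (I (Suc k) - I k) \<Longrightarrow> a \<le> b"
      by (rule exps_ex_least) blast
    then show ?thesis by blast
  qed
  then obtain g where g: "\<And>k. g k \<in> I (Suc k) - I k" "\<And>k h. h \<in> I (Suc k) - I k \<Longrightarrow> lm (g k) \<le> lm h"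
    by metis
  have g0: "g k \<noteq> 0" for k using g(1)[of k] ideal_zero[OF I[of k]] by auto
  have lmg: "lm (g k) \<in> exps n" for k
    using lm_in_keys[OF g0[of k]] ideal_pol[OF I, of "g k" "Suc k"] g(1)[of k] by (auto simp: mem_pol_iff)
  obtain i j c where ij: "i < j" "c \<in> exps n" "lm (g j) = lm (g i) + c"
    using dickson[of "\<lambda>k. lm (g k)" n] lmg by metis
  define q where "q = lookup (g j) (lm (g j)) / lookup (g i) (lm (g i))"
  define s where "s = (single 0 q * monom c :: 'k mpoly)"
  define h where "h = g j - s * g i"
  have "s \<in> pol n" unfolding s_def using ij(2) by (intro pol_mult) (auto simp: mem_pol_iff)
  moreover have "I (Suc i) \<subseteq> I j"
    using lift_Suc_mono_le[of I, OF inc] ij(1) by simp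
  ultimately have gi: "s * g i \<in> I j"
    using ideal_mult[OF I] g(1)[of i] by blast
  have "h \<in> I (Suc j) - I j"
    using g(1)[of j] gi inc[of j] ideal_diff[OF I[of "Suc j"]] ideal_cancel[OF I[of j], of "g j" "s * g i"]
    unfolding h_def by blast
  then have le: "lm (g j) \<le> lm h" and h0: "h \<noteq> 0"
    using g(2) ideal_zero[OF I[of j]] by auto
  have sg: "s * g i = monom c * (single 0 q * g i)"
    unfolding s_def by (simp only: mult_ac)
  have lk: "lookup (s * g i) (c + e) = q * lookup (g i) e" for e
    unfolding sg lookup_monom_mult by (simp add: lookup_mult lookup_single when_mult)
  have le_sg: "e \<le> lm (g j)" if e: "e \<in> keys (s * g i)" for e
  proof -
    obtain e' where e': "e = c + e'"
      using e unfolding sg keys_monom_mult by auto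
    then have "e' \<in> keys (g i)"
      using e lk[of e'] by (auto simp: in_keys_iff)
    then show ?thesis
      unfolding e' ij(3) using le_lm add_left_mono by (metis add.commute)
  qed
  have "lm h \<in> keys (g j) \<or> lm h \<in> keys (s * g i)"
    using lm_in_keys[OF h0] by (auto simp: h_def in_keys_iff lookup_minus)
  then have "lm h \<le> lm (g j)"
    using le_lm le_sg by blast
  then have "lm h = lm (g j)" using le by simp
  moreover have "lookup h (lm (g j)) = 0"
  proof -
    have "lookup (g i) (lm (g i)) \<noteq> 0"
      using lm_in_keys[OF g0[of i]] by (simp add: in_keys_iff)
    then show ?thesis
      unfolding h_def lookup_minus using lk[of "lm (g i)"] ij(3) by (simp add: q_def add.commute)
  qed
  ultimately show False using lm_in_keys[OF h0] by (simp add: in_keys_iff)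
qed

lemma ideals_ex_maximal:
  fixes \<S> :: "'k::field mpoly set set"
  assumes id: "\<And>J. J \<in> \<S> \<Longrightarrow> ideal J (poly_ring n)" and "\<S> \<noteq> {}"
  shows "\<exists>M \<in> \<S>. \<forall>J \<in> \<S>. M \<subseteq> J \<longrightarrow> J = M"
proof (rule ccontr)
  assume "\<not> ?thesis"
  then have "\<exists>J. J \<in> \<S> \<and> M \<subset> J" if "M \<in> \<S>" for M using that by blast
  then obtain F where F: "\<And>M. M \<in> \<S> \<Longrightarrow> F M \<in> \<S> \<and> M \<subset> F M" by metis
  obtain M0 where M0: "M0 \<in> \<S>" using assms(2) by blast
  have S: "(F ^^ k) M0 \<in> \<S>" for k by (induction k) (use M0 F in auto)
  have "\<exists>k. (F ^^ Suc k) M0 = (F ^^ k) M0"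
    by (rule ideal_chain_stabilizes) (use id S F in auto)
  then obtain k where "F ((F ^^ k) M0) = (F ^^ k) M0" by auto
  then show False using F[OF S[of k]] by blast
qed

text \<open>A socle element is a 0-cocycle, and \<open>form n 0\<close> contains only 0, so there
  are no nonzero 0-coboundaries.\<close>

lemma koszul_vanish_socle:
  assumes I: "ideal I (poly_ring n)" and V: "koszul_vanish n (Suc r) I"
    and v: "v \<in> pol n" and soc: "\<And>i. i \<in> {1..n} \<Longrightarrow> var i * v \<in> I"
  shows "v \<in> I"
proof -
  let ?w = "\<lambda>T :: nat set. if T = {} then v else 0"
  have w: "?w \<in> form n (Suc 0)" by (rule formI) (use v in \<open>auto split: if_splits\<close>)
  have "var i * ?w T \<in> I" if "i \<in> {1..n}" for i T
    using soc[OF that] ideal_zero[OF I] by simp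
  then have "kdiff n ?w T \<in> I" for T
    unfolding kdiff_def by (intro ideal_sum[OF I] ideal_mult[OF I ksgn_pol]) blast
  then obtain \<eta> where "\<eta> \<in> form n 0" "\<And>T. ?w T - kdiff n \<eta> T \<in> I"
    using koszul_vanishD[OF V _ w] by blast
  moreover have "\<eta> = (\<lambda>T. 0)" using form_nonzeroD[OF \<open>\<eta> \<in> form n 0\<close>] by blast
  ultimately have "?w {} \<in> I" by (metis diff_zero kdiff_zero)
  then show ?thesis by simp
qed

section \<open>Zero divisors and prime avoidance\<close>

lemma prod_notin_prime:
  assumes "finite A" "\<And>a b. a \<in> pol n \<Longrightarrow> b \<in> pol n \<Longrightarrow> a * b \<in> P \<Longrightarrow> a \<in> P \<or> b \<in> P"
    "1 \<notin> P" "\<And>i. i \<in> A \<Longrightarrow> f i \<in> pol n - P"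
  shows "prod f A \<notin> (P :: 'k::field mpoly set)"
  using assms(1,4)
proof (induction A)
  case (insert i A)
  then have "f i \<in> pol n" "prod f A \<in> pol n" "f i \<notin> P" "prod f A \<notin> P" by auto
  then show ?case using insert(1,2) assms(2)[of "f i" "prod f A"] by auto
qed (use assms(3) in simp)

lemma ideal_prod_mem:
  assumes P: "ideal P (poly_ring n)" and "finite A" "i \<in> A" "f i \<in> P" "\<And>i. i \<in> A \<Longrightarrow> f i \<in> pol n"
  shows "prod f A \<in> (P :: 'k::field mpoly set)"
proof -
  have "prod f A = prod f (A - {i}) * f i"
    using assms by (simp add: prod.remove[of A i] mult.commute)
  moreover have "prod f (A - {i}) \<in> pol n" using assms(5) by (intro pol_prod) auto
  ultimately show ?thesis using ideal_mult[OF P _ assms(4)] by simp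
qed

text \<open>The maximal elements among the annihilators of nonzero elements of S/I are prime and
  finite in number, and their union contains all zero divisors. None of them contains the graded
  maximal ideal, since H^0 = 0 excludes socle elements; prime avoidance then yields f.\<close>

lemma ex_nonzerodivisor:
  fixes I :: "'k::field mpoly set"
  assumes I: "ideal I (poly_ring n)" and V: "koszul_vanish n (Suc r) I"
  shows "\<exists>f \<in> graded_max_ideal n. nonzerodivisor_mod n I f"
proof -
  let ?c = "colon n I"
  let ?m = "graded_max_ideal n :: 'k mpoly set"
  define \<A> where "\<A> = ?c ` (pol n - I)"
  define \<M> where "\<M> = {P \<in> \<A>. \<forall>Q \<in> \<A>. P \<subseteq> Q \<longrightarrow> Q = P}"
  have idA: "ideal P (poly_ring n)" if "P \<in> \<A>" for P
    using that ideal_colon[OF I] by (auto simp: \<A>_def)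
  have idM: "ideal P (poly_ring n)" if "P \<in> \<M>" for P
    using that idA by (auto simp: \<M>_def)
  have below: "\<exists>Q \<in> \<M>. P \<subseteq> Q" if "P \<in> \<A>" for P
  proof -
    have "\<exists>Q \<in> {Q \<in> \<A>. P \<subseteq> Q}. \<forall>J \<in> {Q \<in> \<A>. P \<subseteq> Q}. Q \<subseteq> J \<longrightarrow> J = Q"
      by (rule ideals_ex_maximal[of _ n]) (use idA that in auto)
    then obtain Q where Q: "Q \<in> \<A>" "P \<subseteq> Q" "\<forall>J \<in> {Q \<in> \<A>. P \<subseteq> Q}. Q \<subseteq> J \<longrightarrow> J = Q" by auto
    have "J = Q" if "J \<in> \<A>" "Q \<subseteq> J" for J
      using Q(3) that subset_trans[OF Q(2) that(2)] by simp
    then have "Q \<in> \<M>" using Q(1) by (simp add: \<M>_def)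
    then show ?thesis using Q(2) by auto
  qed
  have prime: "a \<in> P \<or> b \<in> P" if P: "P \<in> \<M>" and ab: "a \<in> pol n" "b \<in> pol n" "a * b \<in> P" for P a b
  proof (rule ccontr)
    assume n: "\<not> (a \<in> P \<or> b \<in> P)"
    obtain v where v: "v \<in> pol n" "v \<notin> I" "P = ?c v" using P by (auto simp: \<M>_def \<A>_def)
    have "b * v \<notin> I" using n ab v by (auto simp: colon_ideal_iff)
    then have "?c (b * v) \<in> \<A>" using ab v by (auto simp: \<A>_def)
    moreover have "P \<subseteq> ?c (b * v)"
      unfolding v(3) using ideal_mult[OF I ab(2)] by (auto simp: colon_ideal_iff mult.left_commute[of _ b])
    ultimately have "?c (b * v) = P" using P by (auto simp: \<M>_def)
    moreover have "a \<in> ?c (b * v)" using ab v by (auto simp: colon_ideal_iff mult.assoc)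
    ultimately show False using n by blast
  qed
  have one: "1 \<notin> P" if "P \<in> \<M>" for P
    using that by (auto simp: \<M>_def \<A>_def colon_ideal_iff)
  have incomp: "Q = P" if "P \<in> \<M>" "Q \<in> \<M>" "Q \<subseteq> P" for P Q
    using that by (auto simp: \<M>_def)
  \<comment> \<open>Given infinitely many annihilators P i of v i, the ideals generated by I and v
    0, ..., v (k - 1) become stationary. A product of elements of P i outside P k, over all i < k,
    then also kills v k, so it lies in the prime P k: a contradiction.\<close>
  have fin: "finite \<M>"
  proof (rule ccontr)
    assume "infinite \<M>"
    then obtain P :: "nat \<Rightarrow> 'k mpoly set" where P: "inj P" "range P \<subseteq> \<M>"
      using infinite_countable_subset by blast
    have "\<exists>v. v \<in> pol n \<and> P k = ?c v" for k
    proof -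
      have "P k \<in> \<A>" using P(2) by (auto simp: \<M>_def)
      then show ?thesis by (auto simp: \<A>_def)
    qed
    then obtain v where v: "\<And>k. v k \<in> pol n" "\<And>k. P k = ?c (v k)" by metis
    interpret R: cring "poly_ring n :: 'k mpoly ring" by (rule cring_poly_ring)
    define J where "J k = Idl\<^bsub>poly_ring n\<^esub> (I \<union> v ` {..<k})" for k
    have sub: "I \<union> v ` {..<k} \<subseteq> pol n" for k using v(1) ideal_pol[OF I] by auto
    have idJ: "ideal (J k) (poly_ring n)" for k
      unfolding J_def by (rule R.genideal_ideal[OF sub])
    have genJ: "I \<union> v ` {..<k} \<subseteq> J k" for k
      unfolding J_def by (rule R.genideal_self[OF sub])
    have "J k \<subseteq> J (Suc k)" for k
      unfolding J_def by (rule R.genideal_minimal[OF idJ[unfolded J_def]]) (use genJ[of "Suc k", unfolded J_def] in auto)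
    then obtain k where "J (Suc k) = J k" using ideal_chain_stabilizes[of J n] idJ by blast
    then have vk: "v k \<in> J k" using genJ[of "Suc k"] by auto
    have "\<exists>a. a \<in> P i \<and> a \<notin> P k" if "i < k" for i
      using incomp[of "P k" "P i"] P that by (metis inj_eq less_irrefl range_subsetD subsetI)
    then obtain a where a: "\<And>i. i < k \<Longrightarrow> a i \<in> P i" "\<And>i. i < k \<Longrightarrow> a i \<notin> P k" by metis
    have PkM: "P k \<in> \<M>" for k using P(2) by blast
    have ap: "a i \<in> pol n" if "i < k" for i
      using ideal_pol[OF idM[OF PkM] a(1)[OF that]] .
    let ?a = "prod a {..<k}"
    have apr: "?a \<in> pol n" using ap by auto
    have "?a \<in> P i" if "i < k" for i
      by (rule ideal_prod_mem[OF idM[OF PkM], of _ i]) (use that a ap in auto)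
    then have av: "?a * v i \<in> I" if "i < k" for i
      using that v(2) by (auto simp: colon_ideal_iff)
    have "J k \<subseteq> ?c ?a"
      unfolding J_def
      by (rule R.genideal_minimal[OF ideal_colon[OF I apr]])
        (use av v(1) ideal_pol[OF I] ideal_mult[OF I apr] in \<open>auto simp: colon_ideal_iff mult.commute[of _ ?a]\<close>)
    then have "?a * v k \<in> I" using vk by (auto simp: colon_ideal_iff mult.commute[of _ ?a])
    then have "?a \<in> P k" unfolding v(2) using apr by (simp add: colon_ideal_iff)
    moreover have "?a \<notin> P k"
      by (rule prod_notin_prime[where n = n]) (use prime[OF PkM] one[OF PkM] ap a in auto)
    ultimately show False by blast
  qed
  \<comment> \<open>Modulo P only the summand \<open>g P\<close> of the sum of these elements
    survives, so the sum avoids every P. The argument covers finite fields.\<close>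
  have "\<exists>g \<in> ?m. g \<notin> P \<and> (\<forall>Q \<in> \<M> - {P}. g \<in> Q)" if P: "P \<in> \<M>" for P
  proof -
    obtain v where v: "v \<in> pol n" "v \<notin> I" "P = ?c v" using P by (auto simp: \<M>_def \<A>_def)
    have "\<not> ?m \<subseteq> P"
    proof
      assume "?m \<subseteq> P"
      then have "var i * v \<in> I" if "i \<in> {1..n}" for i
        using var_graded_max_ideal[OF that] v(3) by (auto simp: colon_ideal_iff)
      then show False using koszul_vanish_socle[OF I V v(1)] v(2) by blast
    qed
    then obtain b where b: "b \<in> ?m" "b \<notin> P" by blast
    have "\<exists>a. a \<in> Q \<and> a \<notin> P" if "Q \<in> \<M> - {P}" for Q
      using incomp[OF P, of Q] that by blast
    then obtain a where a: "\<And>Q. Q \<in> \<M> - {P} \<Longrightarrow> a Q \<in> Q" "\<And>Q. Q \<in> \<M> - {P} \<Longrightarrow> a Q \<notin> P" by metis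
    have ap: "a Q \<in> pol n" if "Q \<in> \<M> - {P}" for Q
      using ideal_pol[OF idM a(1)[OF that]] that by blast
    let ?a = "prod a (\<M> - {P})"
    have apr: "?a \<in> pol n" using ap by auto
    have bp: "b \<in> pol n" using ideal_pol[OF ideal_graded_max_ideal b(1)] .
    have "?a \<notin> P"
      by (rule prod_notin_prime[where n = n]) (use fin prime[OF P] one[OF P] ap a in auto)
    then have "?a * b \<notin> P" using prime[OF P apr bp] b(2) by blast
    moreover have "?a * b \<in> Q" if "Q \<in> \<M> - {P}" for Q
    proof -
      have Q: "ideal Q (poly_ring n)" using idM that by blast
      have "?a \<in> Q" by (rule ideal_prod_mem[OF Q, of _ Q]) (use that a ap fin in auto)
      then show ?thesis by (rule ideal_mult'[OF Q bp])
    qed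
    moreover have "?a * b \<in> ?m" using ideal_mult[OF ideal_graded_max_ideal apr b(1)] .
    ultimately show ?thesis by blast
  qed
  then obtain g where g: "\<And>P. P \<in> \<M> \<Longrightarrow> g P \<in> ?m" "\<And>P. P \<in> \<M> \<Longrightarrow> g P \<notin> P"
    "\<And>P Q. P \<in> \<M> \<Longrightarrow> Q \<in> \<M> - {P} \<Longrightarrow> g P \<in> Q" by metis
  let ?f = "sum g \<M>"
  have fm: "?f \<in> ?m" by (rule ideal_sum[OF ideal_graded_max_ideal]) (rule g)
  have fP: "?f \<notin> P" if P: "P \<in> \<M>" for P
  proof
    assume "?f \<in> P"
    moreover have "?f = g P + sum g (\<M> - {P})" using P fin by (simp add: sum.remove)
    moreover have "sum g (\<M> - {P}) \<in> P"
      by (rule ideal_sum[OF idM[OF P]]) (use g(3) P in auto)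
    ultimately have "g P \<in> P" using ideal_diff[OF idM[OF P], of ?f "sum g (\<M> - {P})"] by simp
    then show False using g(2)[OF P] by simp
  qed
  have "nonzerodivisor_mod n I ?f"
    unfolding nonzerodivisor_mod_def
  proof (intro conjI ballI impI)
    show fp: "?f \<in> pol n" using ideal_pol[OF ideal_graded_max_ideal fm] .
    fix v assume v: "v \<in> pol n" "?f * v \<in> I"
    show "v \<in> I"
    proof (rule ccontr)
      assume "v \<notin> I"
      then have "?c v \<in> \<A>" using v by (auto simp: \<A>_def)
      then obtain P where "P \<in> \<M>" "?c v \<subseteq> P" using below by blast
      moreover have "?f \<in> ?c v" using v fp by (simp add: colon_ideal_iff)
      ultimately show False using fP by blast
    qed
  qed
  then show ?thesis using fm by blast
qed

section \<open>Depth of cyclic modules by Koszul cohomology\<close>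

text \<open>The preimage in S of the submodule A (S/I), as \<open>set_smult_quot_module\<close>
  shows; it turns regular sequences on S/I into statements on ideals of S.\<close>

definition gen :: "nat \<Rightarrow> 'k::field mpoly set \<Rightarrow> 'k mpoly set \<Rightarrow> 'k mpoly set" where
  "gen n I A = Idl\<^bsub>poly_ring n\<^esub> (I \<union> A)"

context
  fixes n :: nat and I A :: "'k::field mpoly set"
  assumes sub: "I \<subseteq> pol n" "A \<subseteq> pol n"
begin

interpretation R: cring "poly_ring n :: 'k mpoly ring" by (rule cring_poly_ring)

lemma ideal_gen: "ideal (gen n I A) (poly_ring n)"
  unfolding gen_def by (rule R.genideal_ideal) (use sub in auto)

lemma gen_supset: "I \<union> A \<subseteq> gen n I A"
  unfolding gen_def by (rule R.genideal_self) (use sub in auto)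

lemma gen_least: "ideal J (poly_ring n) \<Longrightarrow> I \<union> A \<subseteq> J \<Longrightarrow> gen n I A \<subseteq> J"
  unfolding gen_def by (rule R.genideal_minimal)

end

lemma gen_empty:
  assumes "ideal I (poly_ring n)"
  shows "gen n I {} = (I :: 'k::field mpoly set)"
proof -
  have "I \<subseteq> pol n" using ideal_pol[OF assms] by blast
  then show ?thesis
    using gen_supset[of I n "{}"] gen_least[of I n "{}" I] assms by auto
qed

lemma gen_insert:
  assumes I: "ideal I (poly_ring n)" and f: "f \<in> pol n" and A: "A \<subseteq> pol n"
  shows "gen n I (insert f A) = gen n (ideal_plus I (princ n f)) A"
proof
  let ?J = "ideal_plus I (princ n f)"
  have Ip: "I \<subseteq> pol n" using ideal_pol[OF I] by blast
  note J = ideal_ideal_plus[OF I ideal_princ[OF f]]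
  have Jp: "?J \<subseteq> pol n" using ideal_pol[OF J] by blast
  have fA: "insert f A \<subseteq> pol n" using f A by auto
  note G = gen_supset[OF Ip fA] and G' = gen_supset[OF Jp A]
  note idG = ideal_gen[OF Ip fA] and idG' = ideal_gen[OF Jp A]
  show "gen n I (insert f A) \<subseteq> gen n ?J A"
  proof (rule gen_least[OF Ip fA idG'])
    have "f \<in> ?J" using ideal_plus_right[OF I princ_self[of f n]] .
    then show "I \<union> insert f A \<subseteq> gen n ?J A"
      using G' ideal_plus_left[OF ideal_princ[OF f]] by blast
  qed
  show "gen n ?J A \<subseteq> gen n I (insert f A)"
  proof (rule gen_least[OF Jp A idG])
    have "a + f * s \<in> gen n I (insert f A)" if "a \<in> I" "s \<in> pol n" for a s
      using ideal_add[OF idG, of a "f * s"] ideal_mult'[OF idG that(2), of f] G that(1) by blast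
    then show "?J \<union> A \<subseteq> gen n I (insert f A)"
      using G by (auto simp: ideal_plus_def princ_def)
  qed
qed

section \<open>Submodules of S/I and regular sequences in terms of ideals\<close>

context
  fixes n :: nat and I :: "'k::field mpoly set"
  assumes I: "ideal I (poly_ring n)"
begin

abbreviation (input) "M \<equiv> quot_module (poly_ring n) I"
abbreviation (input) "coset v \<equiv> I +>\<^bsub>poly_ring n\<^esub> v"

interpretation R: cring "poly_ring n :: 'k mpoly ring" by (rule cring_poly_ring)
interpretation h: ring_hom_ring "poly_ring n" "poly_ring n Quot I" "(+>\<^bsub>poly_ring n\<^esub>) I"
  by (rule ideal.rcos_ring_hom_ring[OF I])
interpretation M: Module.module "poly_ring n" M
  by (rule module_quot_module[OF cring_poly_ring I])

lemma carrier_quot_module: "carrier M = coset ` pol n"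
  by (auto simp: quot_module_def FactRing_def A_RCOSETS_def')

lemma smult_quot_module:
  assumes "a \<in> pol n" "v \<in> pol n"
  shows "a \<odot>\<^bsub>M\<^esub> coset v = coset (a * v)"
  using h.hom_mult[of a v] assms by (simp add: quot_module_def)

lemma add_quot_module:
  assumes "a \<in> pol n" "v \<in> pol n"
  shows "coset a \<oplus>\<^bsub>M\<^esub> coset v = coset (a + v)"
  using h.hom_add[of a v] assms by (simp add: quot_module_def)

lemma coset_zero: "coset 0 = \<zero>\<^bsub>M\<^esub>"
  using h.hom_zero by (simp add: quot_module_def)

lemma coset_eq_iff:
  assumes "v \<in> pol n" "w \<in> pol n"
  shows "coset v = coset w \<longleftrightarrow> v - w \<in> I"
proof -
  have "v \<ominus>\<^bsub>poly_ring n\<^esub> w = v - w"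
    using poly_ring_a_inv[OF assms(2)] by (simp add: a_minus_def)
  then show ?thesis
    using R.quotient_eq_iff_same_a_r_cos[OF I assms] by simp
qed

lemma submodule_coset_image:
  assumes J: "ideal J (poly_ring n)"
  shows "submodule (coset ` J) (poly_ring n) M"
proof (rule M.submoduleI)
  have Jp: "v \<in> pol n" if "v \<in> J" for v using ideal_pol[OF J that] .
  show "coset ` J \<subseteq> carrier M" using Jp by (auto simp: carrier_quot_module)
  show "\<zero>\<^bsub>M\<^esub> \<in> coset ` J" using ideal_zero[OF J] coset_zero by (metis imageI)
  show "\<ominus>\<^bsub>M\<^esub> x \<in> coset ` J" if "x \<in> coset ` J" for x
  proof -
    obtain v where v: "v \<in> J" "x = coset v" using \<open>x \<in> coset ` J\<close> by blast
    have "coset (- v) \<oplus>\<^bsub>M\<^esub> x = \<zero>\<^bsub>M\<^esub>"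
      unfolding v(2) using Jp[OF v(1)] by (simp add: add_quot_module coset_zero)
    moreover have "x \<in> carrier M" "coset (- v) \<in> carrier M"
      using v Jp by (auto simp: carrier_quot_module)
    ultimately have "\<ominus>\<^bsub>M\<^esub> x = coset (- v)"
      by (metis M.minus_equality)
    then show ?thesis using ideal_uminus[OF J v(1)] by blast
  qed
  show "x \<oplus>\<^bsub>M\<^esub> y \<in> coset ` J" if "x \<in> coset ` J" "y \<in> coset ` J" for x y
  proof -
    obtain v w where "v \<in> J" "x = coset v" "w \<in> J" "y = coset w" using \<open>x \<in> coset ` J\<close> \<open>y \<in> coset ` J\<close> by blast
    then show ?thesis using Jp ideal_add[OF J] by (auto simp: add_quot_module)
  qed
  show "a \<odot>\<^bsub>M\<^esub> x \<in> coset ` J" if "a \<in> pol n" "x \<in> coset ` J" for a x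
  proof -
    obtain v where "v \<in> J" "x = coset v" using \<open>x \<in> coset ` J\<close> by blast
    then show ?thesis using Jp ideal_mult[OF J that(1)] that(1) by (auto simp: smult_quot_module)
  qed
qed

lemma ideal_coset_vimage:
  assumes H: "submodule H (poly_ring n) M"
  shows "ideal {v \<in> pol n. coset v \<in> H} (poly_ring n)"
proof (rule ideal_polyI)
  have sg: "subgroup H (add_monoid M)" using H by (rule submodule.axioms)
  show "0 \<in> {v \<in> pol n. coset v \<in> H}"
    using subgroup.one_closed[OF sg] by (simp add: coset_zero)
  show "p + q \<in> {v \<in> pol n. coset v \<in> H}"
    if "p \<in> {v \<in> pol n. coset v \<in> H}" "q \<in> {v \<in> pol n. coset v \<in> H}" for p q
    using subgroup.m_closed[OF sg, of "coset p" "coset q"] that by (simp add: add_quot_module)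
  show "s * p \<in> {v \<in> pol n. coset v \<in> H}"
    if "s \<in> pol n" "p \<in> {v \<in> pol n. coset v \<in> H}" for s p
    using submodule.smult_closed[OF H, of s "coset p"] that by (simp add: smult_quot_module)
qed auto

lemma set_smult_quot_module:
  assumes A: "A \<subseteq> pol n"
  shows "set_smult (poly_ring n) M A = coset ` gen n I A"
proof
  have Ip: "I \<subseteq> pol n" using ideal_pol[OF I] by blast
  note idG = ideal_gen[OF Ip A] and G = gen_supset[OF Ip A]
  let ?g = "{a \<odot>\<^bsub>M\<^esub> v |a v. a \<in> A \<and> v \<in> carrier M}"
  have "?g \<subseteq> coset ` gen n I A"
  proof clarify
    fix a v assume a: "a \<in> A" and "v \<in> carrier M"
    then obtain w where w: "w \<in> pol n" "v = coset w" by (auto simp: carrier_quot_module)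
    have "a * w \<in> gen n I A" using ideal_mult'[OF idG w(1), of a] G a by blast
    moreover have "a \<odot>\<^bsub>M\<^esub> v = coset (a * w)" using smult_quot_module[of a w] a A w by auto
    ultimately show "a \<odot>\<^bsub>M\<^esub> v \<in> coset ` gen n I A" by simp
  qed
  then show "set_smult (poly_ring n) M A \<subseteq> coset ` gen n I A"
    unfolding set_smult_def using submodule_coset_image[OF idG] by blast
  have "coset ` gen n I A \<subseteq> H" if H: "submodule H (poly_ring n) M" "?g \<subseteq> H" for H
  proof -
    have "gen n I A \<subseteq> {v \<in> pol n. coset v \<in> H}"
    proof (rule gen_least[OF Ip A ideal_coset_vimage[OF H(1)]])
      have "coset v \<in> H" if "v \<in> I" for v
      proof -
        have "coset v = coset 0" using coset_eq_iff[of v 0] ideal_pol[OF I that] that by simp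
        moreover have "\<zero>\<^bsub>M\<^esub> \<in> H"
          using subgroup.one_closed[OF submodule.axioms(1)[OF H(1)]] by simp
        ultimately show ?thesis by (simp add: coset_zero)
      qed
      moreover have "coset a \<in> H" if "a \<in> A" for a
      proof -
        have "coset 1 \<in> carrier M" using pol_one by (simp add: carrier_quot_module)
        then have "a \<odot>\<^bsub>M\<^esub> coset 1 \<in> H" using H(2) that by blast
        then show ?thesis using smult_quot_module[of a 1] that A by auto
      qed
      ultimately show "I \<union> A \<subseteq> {v \<in> pol n. coset v \<in> H}" using Ip A by blast
    qed
    then show ?thesis by blast
  qed
  then show "coset ` gen n I A \<subseteq> set_smult (poly_ring n) M A"
    unfolding set_smult_def by blast
qed

lemma coset_mem_image_iff:
  assumes "ideal J (poly_ring n)" "I \<subseteq> J" "v \<in> pol n"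
  shows "coset v \<in> coset ` J \<longleftrightarrow> v \<in> J"
proof
  assume "coset v \<in> coset ` J"
  then obtain w where "w \<in> J" "coset v = coset w" by blast
  then have "v - w \<in> I" using coset_eq_iff[OF assms(3)] ideal_pol[OF assms(1)] by blast
  then show "v \<in> J" using ideal_cancel[OF assms(1)] assms(2) \<open>w \<in> J\<close> by blast
qed blast

lemma regular_sequence_quot_module_iff:
  "regular_sequence (poly_ring n) M fs \<longleftrightarrow> set fs \<subseteq> pol n \<and>
     (\<forall>i < length fs. \<forall>v \<in> pol n. fs ! i * v \<in> gen n I (set (take i fs)) \<longrightarrow> v \<in> gen n I (set (take i fs))) \<and>
     gen n I (set fs) \<noteq> pol n"
proof (cases "set fs \<subseteq> pol n")
  case fs: True
  have Ip: "I \<subseteq> pol n" using ideal_pol[OF I] by blast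
  have mem: "coset v \<in> set_smult (poly_ring n) M A \<longleftrightarrow> v \<in> gen n I A" if "v \<in> pol n" "A \<subseteq> pol n" for v A
    unfolding set_smult_quot_module[OF that(2)]
    using coset_mem_image_iff[OF ideal_gen[OF Ip that(2)] _ that(1)] gen_supset[OF Ip that(2)] by blast
  have "set_smult (poly_ring n) M (set fs) = carrier M \<longleftrightarrow> gen n I (set fs) = pol n"
  proof
    assume eq: "set_smult (poly_ring n) M (set fs) = carrier M"
    have "v \<in> gen n I (set fs)" if "v \<in> pol n" for v
    proof -
      have "coset v \<in> carrier M" using that by (simp add: carrier_quot_module)
      then show ?thesis using mem[OF that fs] eq by simp
    qed
    then show "gen n I (set fs) = pol n" using ideal_pol[OF ideal_gen[OF Ip fs]] by blast
  next
    assume "gen n I (set fs) = pol n"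
    then show "set_smult (poly_ring n) M (set fs) = carrier M"
      by (simp add: set_smult_quot_module[OF fs] carrier_quot_module)
  qed
  moreover have "(fs ! i \<odot>\<^bsub>M\<^esub> coset v \<in> set_smult (poly_ring n) M (set (take i fs)) \<longrightarrow>
        coset v \<in> set_smult (poly_ring n) M (set (take i fs))) \<longleftrightarrow>
      (fs ! i * v \<in> gen n I (set (take i fs)) \<longrightarrow> v \<in> gen n I (set (take i fs)))"
    if "i < length fs" "v \<in> pol n" for i v
  proof -
    have "fs ! i \<in> pol n" using fs that(1) nth_mem by blast
    moreover have "set (take i fs) \<subseteq> pol n" using fs set_take_subset[of i fs] by blast
    ultimately show ?thesis using that(2) by (simp add: smult_quot_module mem)
  qed
  ultimately show ?thesis
    unfolding regular_sequence_def using fs by (simp add: carrier_quot_module)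
qed (simp add: regular_sequence_def)

end

text \<open>The first element is split off and the rest is read over the larger ideal, the shape of
  an induction by \<open>koszul_vanish_nonzerodivisor\<close>.\<close>

fun regular_seq :: "nat \<Rightarrow> 'k::field mpoly set \<Rightarrow> 'k mpoly list \<Rightarrow> bool" where
  "regular_seq n I [] \<longleftrightarrow> I \<noteq> pol n"
| "regular_seq n I (f # fs) \<longleftrightarrow> nonzerodivisor_mod n I f \<and> regular_seq n (ideal_plus I (princ n f)) fs"

lemma regular_sequence_iff:
  assumes "ideal I (poly_ring n)" "set fs \<subseteq> pol n"
  shows "regular_sequence (poly_ring n) (quot_module (poly_ring n) I) fs \<longleftrightarrow> regular_seq n I fs"
  using assms
proof (induction fs arbitrary: I)
  case Nil
  then show ?case by (simp add: regular_sequence_quot_module_iff gen_empty)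
next
  case (Cons f fs)
  have f: "f \<in> pol n" and fs: "set fs \<subseteq> pol n" using Cons.prems by auto
  let ?J = "ideal_plus I (princ n f)"
  note J = ideal_ideal_plus[OF Cons.prems(1) ideal_princ[OF f]]
  have g: "gen n I (insert f A) = gen n ?J A" if "A \<subseteq> set fs" for A
    using gen_insert[OF Cons.prems(1) f, of A] that fs by blast
  have t: "gen n I (insert f (set (take i fs))) = gen n ?J (set (take i fs))" for i
    by (rule g) (rule set_take_subset)
  show ?case
    unfolding regular_sequence_quot_module_iff[OF Cons.prems(1)] regular_seq.simps
      Cons.IH[OF J fs, symmetric] regular_sequence_quot_module_iff[OF J] nonzerodivisor_mod_def
    using f fs by (simp add: All_less_Suc2 gen_empty[OF Cons.prems(1)] t g)
qed

section \<open>Depth as the range of Koszul vanishing\<close>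

lemma one_notin_graded_max_ideal: "(1 :: 'k::field mpoly) \<notin> graded_max_ideal n"
proof -
  have "upset n (exps n - {0})"
    unfolding upset_def using add_eq_0_iff_both_eq_0 by (auto simp: poly_mapping_eq_iff fun_eq_iff lookup_add)
  then have "graded_max_ideal n \<subseteq> (mono_ideal (exps n - {0}) :: 'k mpoly set)"
    by (intro graded_max_ideal_least ideal_mono_ideal)
      (auto simp: mono_ideal_def var_def poly_mapping_eq_iff fun_eq_iff lookup_single when_def)
  then show ?thesis by (auto simp: mono_ideal_def)
qed

lemma depth_quot_eq_Sup:
  fixes I :: "'k::field mpoly set"
  assumes I: "ideal I (poly_ring n)" and sub: "I \<subseteq> graded_max_ideal n"
  shows "depth_quot n I = Sup {enat (length fs) |fs. set fs \<subseteq> graded_max_ideal n \<and> regular_seq n I fs}"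
proof -
  let ?m = "graded_max_ideal n :: 'k mpoly set"
  let ?M = "quot_module (poly_ring n) I"
  have mp: "?m \<subseteq> pol n" and Ip: "I \<subseteq> pol n"
    using ideal_pol[OF ideal_graded_max_ideal] ideal_pol[OF I] by blast+
  have "gen n I ?m \<subseteq> ?m"
    by (rule gen_least[OF Ip mp ideal_graded_max_ideal]) (use sub in auto)
  then have "1 \<notin> gen n I ?m" using one_notin_graded_max_ideal by blast
  then have "I +>\<^bsub>poly_ring n\<^esub> 1 \<notin> set_smult (poly_ring n) ?M ?m"
    unfolding set_smult_quot_module[OF I mp]
    using coset_mem_image_iff[OF I ideal_gen[OF Ip mp], of 1] gen_supset[OF Ip mp] by auto
  then have "set_smult (poly_ring n) ?M ?m \<noteq> carrier ?M"
    unfolding carrier_quot_module[OF I] by (metis imageI pol_one)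
  moreover have "set fs \<subseteq> ?m \<and> regular_sequence (poly_ring n) ?M fs \<longleftrightarrow> set fs \<subseteq> ?m \<and> regular_seq n I fs" for fs
    using regular_sequence_iff[OF I, of fs] mp by blast
  ultimately show ?thesis unfolding depth_quot_def depth_def by simp
qed

lemma regular_seq_imp_koszul_vanish:
  assumes "ideal I (poly_ring n)" "set fs \<subseteq> graded_max_ideal n" "regular_seq n I fs"
  shows "koszul_vanish n (length fs) I"
  using assms
proof (induction fs arbitrary: I)
  case (Cons f fs)
  then have f: "f \<in> pol n" by (simp add: nonzerodivisor_mod_def)
  have "koszul_vanish n (length fs) (ideal_plus I (princ n f))"
    using Cons by (intro Cons.IH ideal_ideal_plus[OF Cons.prems(1) ideal_princ[OF f]]) auto
  then show ?case
    using Cons.prems by (simp add: koszul_vanish_nonzerodivisor[of I n f])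
qed simp

lemma koszul_vanish_imp_regular_seq:
  assumes "ideal I (poly_ring n)" "I \<subseteq> graded_max_ideal n" "koszul_vanish n r I"
  shows "\<exists>fs. length fs = r \<and> set fs \<subseteq> graded_max_ideal n \<and> regular_seq n I fs"
  using assms
proof (induction r arbitrary: I)
  case 0
  then have "I \<noteq> pol n" using one_notin_graded_max_ideal by blast
  then show ?case by simp
next
  case (Suc r)
  obtain f where f: "f \<in> graded_max_ideal n" "nonzerodivisor_mod n I f"
    using ex_nonzerodivisor[OF Suc.prems(1,3)] by blast
  have fp: "f \<in> pol n" using f(2) by (simp add: nonzerodivisor_mod_def)
  let ?J = "ideal_plus I (princ n f)"
  have "?J \<subseteq> graded_max_ideal n"
    using Suc.prems(2) f(1) ideal_add[OF ideal_graded_max_ideal] ideal_mult'[OF ideal_graded_max_ideal]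
    by (fastforce simp: ideal_plus_def princ_def)
  moreover have "koszul_vanish n r ?J"
    using koszul_vanish_nonzerodivisor[OF Suc.prems(1) f(2,1)] Suc.prems(3) by simp
  ultimately obtain fs where "length fs = r" "set fs \<subseteq> graded_max_ideal n" "regular_seq n ?J fs"
    using Suc.IH[OF ideal_ideal_plus[OF Suc.prems(1) ideal_princ[OF fp]]] by blast
  then show ?case using f by (intro exI[of _ "f # fs"]) simp
qed

text \<open>Containment in the graded maximal ideal excludes the infinite branch of
  \<open>depth\<close> and persists when elements of a regular sequence are added to I.\<close>

lemma le_depth_quot_iff:
  assumes I: "ideal I (poly_ring n)" and sub: "I \<subseteq> graded_max_ideal n"
  shows "enat r \<le> depth_quot n I \<longleftrightarrow> koszul_vanish n r I"
proof
  let ?X = "{enat (length fs) |fs. set fs \<subseteq> graded_max_ideal n \<and> regular_seq n I fs}"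
  show "enat r \<le> depth_quot n I" if V: "koszul_vanish n r I"
    unfolding depth_quot_eq_Sup[OF assms]
    using koszul_vanish_imp_regular_seq[OF assms V] by (intro Sup_upper) force
  assume le: "enat r \<le> depth_quot n I"
  show "koszul_vanish n r I"
  proof (cases r)
    case (Suc s)
    \<comment> \<open>Passing to r - 1 gives a strict inequality, hence a sequence longer than s,
      whether or not the supremum is attained.\<close>
    then have "enat s < enat r" by simp
    then have "enat s < Sup ?X" using le depth_quot_eq_Sup[OF assms] by (metis less_le_trans)
    then obtain fs where "set fs \<subseteq> graded_max_ideal n" "regular_seq n I fs" "s < length fs"
      by (auto simp: less_Sup_iff)
    then show ?thesis
      using koszul_vanish_mono[OF regular_seq_imp_koszul_vanish[OF I]] Suc by auto
  qed simp
qed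

section \<open>Vanishing for monomial ideals\<close>

lemma koszul_vanish_mono_extension:
  assumes U: "upset n U" and u: "u \<in> exps n"
    and "mono_vanish TYPE('k::field) n r {a \<in> exps n. a + u \<in> U}"
    and "mono_vanish TYPE('k) n r (U \<union> up n u)"
  shows "mono_vanish TYPE('k) n r U"
  using koszul_vanish_extension[OF ideal_mono_ideal[OF U], of "monom u :: 'k mpoly" r] assms
  by (simp add: colon_mono_ideal princ_monom ideal_plus_mono_ideal)

lemma koszul_vanish_mono_quotient:
  assumes U: "upset n U" and u: "u \<in> exps n"
    and "mono_vanish TYPE('k::field) n (Suc r) {a \<in> exps n. a + u \<in> U}"
    and "mono_vanish TYPE('k) n r U"
  shows "mono_vanish TYPE('k) n r (U \<union> up n u)"
  using koszul_vanish_quotient[OF ideal_mono_ideal[OF U], of "monom u :: 'k mpoly" r] assms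
  by (simp add: colon_mono_ideal princ_monom ideal_plus_mono_ideal)

lemma koszul_vanish_mono_var:
  assumes U: "upset n U" and v: "v \<in> {1..n}"
    and nzd: "\<And>a. a \<in> exps n \<Longrightarrow> a + single v 1 \<in> U \<Longrightarrow> a \<in> U"
  shows "mono_vanish TYPE('k::field) n (Suc r) U
    \<longleftrightarrow> mono_vanish TYPE('k) n r (U \<union> up n (single v 1))"
proof -
  let ?u = "single v (1 :: nat)"
  have u: "?u \<in> exps n" using v by simp
  have "colon n (mono_ideal U) (monom ?u) \<subseteq> (mono_ideal U :: 'k mpoly set)"
    unfolding colon_mono_ideal[OF u] using nzd by (auto simp: mono_ideal_def)
  then have "nonzerodivisor_mod n (mono_ideal U) (var v :: 'k mpoly)"
    using v unfolding nonzerodivisor_mod_def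
    by (auto simp: colon_ideal_def var_def mult.commute)
  then show ?thesis
    using koszul_vanish_nonzerodivisor[OF ideal_mono_ideal[OF U], of "var v :: 'k mpoly" r]
      var_graded_max_ideal[OF v] princ_monom[OF u, where 'a = 'k]
    by (simp add: ideal_plus_mono_ideal var_def)
qed

definition var_exps :: "nat \<Rightarrow> nat set \<Rightarrow> (nat \<Rightarrow>\<^sub>0 nat) set" where
  "var_exps n C = {a \<in> exps n. \<exists>v \<in> C. lookup a v \<noteq> 0}"

lemma upset_var_exps: "upset n (var_exps n C)"
  by (auto simp: upset_def var_exps_def lookup_add)

lemma up_single:
  assumes "v \<in> {1..n}"
  shows "up n (single v 1) = var_exps n {v}"
proof
  show "up n (single v 1) \<subseteq> var_exps n {v}"
    using assms by (auto simp: up_def var_exps_def lookup_add)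
  show "var_exps n {v} \<subseteq> up n (single v 1)"
  proof
    fix a assume a: "a \<in> var_exps n {v}"
    then have "a = single v 1 + (a - single v 1)"
      by (intro poly_mapping_eqI) (auto simp: var_exps_def lookup_add lookup_minus lookup_single when_def)
    then show "a \<in> up n (single v 1)"
      unfolding up_def using exps_minus a by (force simp: var_exps_def)
  qed
qed

lemma var_exps_Un: "var_exps n C \<union> var_exps n D = var_exps n (C \<union> D)"
  by (auto simp: var_exps_def)

text \<open>The variables outside C form a regular sequence. Once C contains all variables, the
  class of 1 is a socle element and even H^0 is nonzero.\<close>

lemma koszul_vanish_var_exps:
  assumes "C \<subseteq> {1..n}"
  shows "mono_vanish TYPE('k::field) n r (var_exps n C) \<longleftrightarrow> r + card C \<le> n"
  using assms
proof (induction "n - card C" arbitrary: C r)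
  case 0
  have "card C \<le> n" using card_mono[OF _ 0(2)] by simp
  then have "card C = n" using 0(1) by simp
  then have C: "C = {1..n}" using 0(2) by (simp add: card_subset_eq)
  let ?I = "mono_ideal (var_exps n C) :: 'k mpoly set"
  have "var i * 1 \<in> ?I" if "i \<in> {1..n}" for i
    using that C by (auto simp: var_def mono_ideal_def var_exps_def exps_def intro!: bexI[of _ i])
  moreover have "1 \<notin> ?I" by (auto simp: mono_ideal_def var_exps_def)
  ultimately have "\<not> koszul_vanish n (Suc 0) ?I"
    using koszul_vanish_socle[OF ideal_mono_ideal[OF upset_var_exps[of n C]], of 0 1] by auto
  then have "koszul_vanish n r ?I \<Longrightarrow> r = 0"
    using koszul_vanish_mono[of n r ?I "Suc 0"] by (cases r) auto
  then show ?case using \<open>card C = n\<close> by auto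
next
  case (Suc s)
  have "finite C" using Suc.prems finite_subset by blast
  have "C \<noteq> {1..n}" using Suc.hyps(2) by auto
  then obtain v where v: "v \<in> {1..n}" "v \<notin> C" using Suc.prems by blast
  have c: "card (insert v C) = Suc (card C)" using v \<open>finite C\<close> by simp
  have IH: "mono_vanish TYPE('k) n r (var_exps n (insert v C)) \<longleftrightarrow> r + card (insert v C) \<le> n" for r
    by (rule Suc.hyps(1)) (use Suc.hyps(2) Suc.prems v c in auto)
  have "mono_vanish TYPE('k) n (Suc r) (var_exps n C) \<longleftrightarrow> Suc r + card C \<le> n" for r
  proof -
    have "mono_vanish TYPE('k) n (Suc r) (var_exps n C)
        \<longleftrightarrow> mono_vanish TYPE('k) n r (var_exps n C \<union> up n (single v 1))"
    proof (rule koszul_vanish_mono_var[OF upset_var_exps v(1)])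
      fix a assume "a \<in> exps n" "a + single v 1 \<in> var_exps n C"
      then show "a \<in> var_exps n C"
        using v(2) by (auto simp: var_exps_def lookup_add lookup_single when_def split: if_splits)
    qed
    also have "\<dots> \<longleftrightarrow> Suc r + card C \<le> n"
      unfolding up_single[OF v(1)] var_exps_Un using IH[of r] c by simp
    finally show ?thesis .
  qed
  moreover have "card C \<le> n" using card_mono[OF _ Suc.prems] by simp
  ultimately show ?case by (cases r) auto
qed

lemma koszul_vanish_mono_empty:
  "mono_vanish TYPE('k::field) n r {} \<longleftrightarrow> r \<le> n"
proof -
  have "var_exps n {} = {}" by (simp add: var_exps_def)
  then show ?thesis using koszul_vanish_var_exps[of "{}" n r, where 'k = 'k] by simp
qed

lemma koszul_vanish_mono_exps: "mono_vanish TYPE('k::field) n r (exps n)"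
proof (rule koszul_vanishI)
  fix k and w :: "nat set \<Rightarrow> 'k mpoly" assume "w \<in> form n (Suc k)"
  then show "\<exists>\<eta> \<in> form n k. \<forall>T. w T - kdiff n \<eta> T \<in> mono_ideal (exps n)"
    using form_pol[of w] form_zero[of n k] unfolding pol_eq_mono_ideal by (intro bexI[of _ "\<lambda>T. 0"]) auto
qed

section \<open>Powers of path ideals\<close>

text \<open>Indices are read on the cycle; for 1 \<le> i and i + m \<le> n + 1 nothing wraps around,
  so paths and the cycle share the definition.\<close>

definition wnd :: "nat \<Rightarrow> nat \<Rightarrow> nat \<Rightarrow> (nat \<Rightarrow>\<^sub>0 nat)" where
  "wnd n m i = (\<Sum>j \<in> {i..<i + m}. single (cyc n j) 1)"

text \<open>
  The exponents of the monomials in the \<open>t\<close>-th power of the ideal generated by the monomials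
  with exponents \<open>wnd n m i\<close>, \<open>i \<in> A\<close>.
\<close>

definition packs :: "nat \<Rightarrow> nat \<Rightarrow> nat set \<Rightarrow> nat \<Rightarrow> (nat \<Rightarrow>\<^sub>0 nat) set" where
  "packs n m A t = {(\<Sum>i \<in># W. wnd n m i) + c |W c. set_mset W \<subseteq> A \<and> size W = t \<and> c \<in> exps n}"

text \<open>The path has the vertices 1, ..., N, but the ring keeps all n variables. Truncated
  subtraction leaves no window for N < m.\<close>

abbreviation path_packs :: "nat \<Rightarrow> nat \<Rightarrow> nat \<Rightarrow> nat \<Rightarrow> (nat \<Rightarrow>\<^sub>0 nat) set" where
  "path_packs n m N t \<equiv> packs n m {1..N + 1 - m} t"

lemma cyc_range: "n > 0 \<Longrightarrow> cyc n j \<in> {1..n}"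
  by (auto simp: cyc_def) (metis Suc_leI mod_less_divisor)

lemma wnd_exps: "n > 0 \<Longrightarrow> wnd n m i \<in> exps n"
  unfolding wnd_def by (intro exps_sum exps_single cyc_range)

lemma lookup_wnd:
  assumes "1 \<le> i" "i + m \<le> n + 1"
  shows "lookup (wnd n m i) v = (if i \<le> v \<and> v < i + m then 1 else 0)"
proof -
  have "wnd n m i = (\<Sum>j \<in> {i..<i + m}. single j 1)"
    unfolding wnd_def
  proof (rule sum.cong)
    fix j assume "j \<in> {i..<i + m}"
    then have "j - 1 < n" "1 \<le> j" using assms by auto
    then have "cyc n j = j" by (simp add: cyc_def)
    then show "single (cyc n j) 1 = single j (1 :: nat)" by simp
  qed simp
  then show ?thesis
    by (simp add: lookup_sum lookup_single when_def)
qed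

lemma packsI: "set_mset W \<subseteq> A \<Longrightarrow> size W = t \<Longrightarrow> c \<in> exps n \<Longrightarrow> (\<Sum>i \<in># W. wnd n m i) + c \<in> packs n m A t"
  unfolding packs_def by blast

lemma packsE:
  assumes "a \<in> packs n m A t"
  obtains W c where "set_mset W \<subseteq> A" "size W = t" "c \<in> exps n" "a = (\<Sum>i \<in># W. wnd n m i) + c"
  using assms unfolding packs_def by blast

lemma packs_mono: "A \<subseteq> B \<Longrightarrow> packs n m A t \<subseteq> packs n m B t"
  unfolding packs_def by blast

lemma sum_mset_wnd_exps: "n > 0 \<Longrightarrow> (\<Sum>i \<in># W. wnd n m i) \<in> exps n"
  by (induction W) (auto intro: wnd_exps)

lemma upset_packs:
  assumes "n > 0"
  shows "upset n (packs n m A t)"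
  unfolding upset_def
proof (intro conjI ballI subsetI)
  fix a assume "a \<in> packs n m A t"
  then show "a \<in> exps n" using sum_mset_wnd_exps[OF assms] by (auto elim!: packsE)
next
  fix a c assume "a \<in> packs n m A t" "c \<in> exps n"
  then show "a + c \<in> packs n m A t"
    by (auto elim!: packsE simp: add.assoc intro!: packsI)
qed

lemma packs_up: "n > 0 \<Longrightarrow> a \<in> packs n m A t \<Longrightarrow> c \<in> exps n \<Longrightarrow> a + c \<in> packs n m A t"
  using upset_packs[of n m A t] by (auto simp: upset_def)

lemma packs_exps: "n > 0 \<Longrightarrow> a \<in> packs n m A t \<Longrightarrow> a \<in> exps n"
  using upset_packs[of n m A t] by (auto simp: upset_def)

lemma packs_0: "packs n m A 0 = exps n"
  by (auto simp: packs_def)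

lemma packs_empty: "t > 0 \<Longrightarrow> packs n m {} t = {}"
  by (auto simp: packs_def)

lemma packs_Suc: "packs n m A (Suc t) = {wnd n m i + a |i a. i \<in> A \<and> a \<in> packs n m A t}"
proof (intro Set.set_eqI iffI)
  fix b assume "b \<in> packs n m A (Suc t)"
  then obtain W c where W: "set_mset W \<subseteq> A" "size W = Suc t" "c \<in> exps n" "b = (\<Sum>i \<in># W. wnd n m i) + c"
    by (rule packsE)
  then obtain i W' where W': "W = add_mset i W'" by (metis size_eq_Suc_imp_eq_union)
  show "b \<in> {wnd n m i + a |i a. i \<in> A \<and> a \<in> packs n m A t}"
    using W unfolding W' by (auto simp: add.assoc intro!: packsI exI[of _ i])
next
  fix b assume "b \<in> {wnd n m i + a |i a. i \<in> A \<and> a \<in> packs n m A t}"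
  then obtain i a where i: "b = wnd n m i + a" "i \<in> A" "a \<in> packs n m A t" by blast
  then obtain W c where W: "set_mset W \<subseteq> A" "size W = t" "c \<in> exps n" "a = (\<Sum>i \<in># W. wnd n m i) + c"
    using packsE by blast
  have "b = (\<Sum>i \<in># add_mset i W. wnd n m i) + c" using i W by (simp add: add.assoc)
  then show "b \<in> packs n m A (Suc t)" using packsI[of "add_mset i W"] i W by auto
qed

lemma packs_add_wnd: "i \<in> A \<Longrightarrow> a \<in> packs n m A t \<Longrightarrow> a + wnd n m i \<in> packs n m A (Suc t)"
  unfolding packs_Suc using add.commute by blast

lemma lookup_sum_mset_wnd_eq_0:
  assumes "\<And>i. i \<in># W \<Longrightarrow> 1 \<le> i \<and> i + m \<le> n + 1 \<and> \<not> (i \<le> v \<and> v < i + m)"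
  shows "lookup (\<Sum>i \<in># W. wnd n m i) v = 0"
  using assms by (induction W) (auto simp: lookup_add lookup_wnd)

lemma lookup_sum_mset_wnd_ge:
  assumes "i \<in># W"
  shows "lookup (wnd n m i) v \<le> lookup (\<Sum>i \<in># W. wnd n m i) v"
proof -
  obtain W' where "W = add_mset i W'" using assms by (metis multi_member_split)
  then show ?thesis by (simp add: lookup_add)
qed

text \<open>Where u is supported, s vanishes, so c alone absorbs u.\<close>

lemma add_cancel_disjoint:
  fixes a u s c :: "nat \<Rightarrow>\<^sub>0 nat"
  assumes "a + u = s + c" "\<And>v. lookup u v \<noteq> 0 \<Longrightarrow> lookup s v = 0"
  shows "a = s + (c - u)"
proof (rule poly_mapping_eqI)
  fix v
  have "lookup a v + lookup u v = lookup s v + lookup c v"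
    using assms(1) by (metis lookup_add)
  then show "lookup a v = lookup (s + (c - u)) v"
    using assms(2)[of v] by (cases "lookup u v = 0") (simp_all add: lookup_add lookup_minus)
qed

text \<open>
  Among the windows of a packing of \<open>a + wnd n m q\<close> drop the last one: what it leaves uncovered of
  the window \<open>q\<close> meets no other window of the packing.
\<close>

lemma packs_remove_last:
  assumes n: "n > 0" and q: "1 \<le> q" "q + m \<le> n + 1"
    and a: "a + wnd n m q \<in> packs n m {1..q} (Suc t)"
  shows "a \<in> packs n m {1..q} t"
proof -
  obtain W c where W: "set_mset W \<subseteq> {1..q}" "size W = Suc t" "c \<in> exps n"
    "a + wnd n m q = (\<Sum>i \<in># W. wnd n m i) + c" using a by (rule packsE)
  define k where "k = Max (set_mset W)"
  have "set_mset W \<noteq> {}" using W(2) by auto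
  then have k: "k \<in># W" and le: "\<And>i. i \<in># W \<Longrightarrow> i \<le> k"
    unfolding k_def by (auto intro: Max_in)
  obtain W' where W': "W = add_mset k W'" using k by (metis multi_member_split)
  let ?S = "\<Sum>i \<in># W'. wnd n m i"
  have kq: "1 \<le> k" "k \<le> q" using W(1) k by auto
  have "a = ?S + (wnd n m k + c - wnd n m q)"
  proof (rule poly_mapping_eqI)
    fix v
    have eq: "lookup a v + lookup (wnd n m q) v
        = lookup ?S v + lookup (wnd n m k) v + lookup c v"
      using arg_cong[OF W(4), of "\<lambda>p. lookup p v"] by (simp add: W' lookup_add)
    moreover have "lookup (wnd n m q) v \<le> lookup (wnd n m k) v + lookup c v"
    proof (cases "q \<le> v \<and> v < q + m \<and> k + m \<le> v")
      case True
      have "lookup ?S v = 0"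
      proof (rule lookup_sum_mset_wnd_eq_0)
        fix i assume "i \<in># W'"
        then have "i \<in># W" by (simp add: W')
        then show "1 \<le> i \<and> i + m \<le> n + 1 \<and> \<not> (i \<le> v \<and> v < i + m)"
          using W(1) le[of i] q True by (auto simp: subset_iff)
      qed
      then show ?thesis using eq by simp
    next
      case False
      then show ?thesis using kq q by (auto simp: lookup_wnd)
    qed
    ultimately show "lookup a v = lookup (?S + (wnd n m k + c - wnd n m q)) v"
      by (simp add: lookup_add lookup_minus)
  qed
  moreover have "wnd n m k + c - wnd n m q \<in> exps n"
    by (intro exps_minus) (simp add: W(3) wnd_exps[OF n])
  moreover have "set_mset W' \<subseteq> {1..q}" "size W' = t" using W(1,2) by (auto simp: W')
  ultimately show ?thesis using packsI by metis
qed

lemma packs_remove_last_iff: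
  assumes "1 \<le> q" "q + m \<le> n + 1" "n > 0"
  shows "{a \<in> exps n. a + wnd n m q \<in> packs n m {1..q} (Suc t)} = packs n m {1..q} t"
proof (intro Set.set_eqI iffI CollectI conjI)
  fix a assume "a \<in> packs n m {1..q} t"
  then show "a \<in> exps n" "a + wnd n m q \<in> packs n m {1..q} (Suc t)"
    using packs_exps[OF assms(3)] packs_add_wnd[of q "{1..q}"] assms(1) by simp_all
qed (use packs_remove_last[OF assms(3,1,2)] in blast)

text \<open>No window of the path reaches v, so the factor x_v belongs to the cofactor.\<close>

lemma path_packs_remove_var:
  assumes "N \<le> n" "N < v" "a + single v 1 \<in> path_packs n m N t"
  shows "a \<in> path_packs n m N t"
proof -
  obtain W c where W: "set_mset W \<subseteq> {1..N + 1 - m}" "size W = t" "c \<in> exps n"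
    "a + single v 1 = (\<Sum>i \<in># W. wnd n m i) + c" using assms(3) by (rule packsE)
  have "a = (\<Sum>i \<in># W. wnd n m i) + (c - single v 1)"
  proof (rule add_cancel_disjoint[OF W(4)])
    fix w assume "lookup (single v 1) w \<noteq> (0 :: nat)"
    then have "w = v" by (auto simp: lookup_single when_def split: if_splits)
    then show "lookup (\<Sum>i \<in># W. wnd n m i) w = 0"
      using W(1) assms(1,2) by (intro lookup_sum_mset_wnd_eq_0) (auto simp: subset_iff)
  qed
  then show ?thesis using packsI[OF W(1,2) exps_minus[OF W(3)]] by metis
qed

lemma packs_Un_up_last:
  assumes "n > 0"
  shows "packs n m {1..Suc q} t \<union> up n (wnd n m (Suc q)) = packs n m {1..q} t \<union> up n (wnd n m (Suc q))"
proof -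
  have "a \<in> packs n m {1..q} t \<union> up n (wnd n m (Suc q))" if a: "a \<in> packs n m {1..Suc q} t" for a
  proof -
    obtain W c where W: "set_mset W \<subseteq> {1..Suc q}" "size W = t" "c \<in> exps n" "a = (\<Sum>i \<in># W. wnd n m i) + c"
      using a by (rule packsE)
    show ?thesis
    proof (cases "Suc q \<in># W")
      case True
      then obtain W' where "W = add_mset (Suc q) W'" by (metis multi_member_split)
      then have "a = wnd n m (Suc q) + ((\<Sum>i \<in># W'. wnd n m i) + c)" using W by (simp add: add.assoc)
      then show ?thesis using W(3) sum_mset_wnd_exps[OF assms] unfolding up_def by auto
    next
      case False
      then have "set_mset W \<subseteq> {1..q}" using W(1) by (metis atLeastAtMostSuc_conv le_numeral_extra(4) subset_insert add_leD1 le_SucI plus_1_eq_Suc le_add1)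
      then show ?thesis using W packsI by blast
    qed
  qed
  moreover have "packs n m {1..q} t \<subseteq> packs n m {1..Suc q} t" by (rule packs_mono) auto
  ultimately show ?thesis by blast
qed

text \<open>The product is free of x_b, so no window of the packing contains b. The windows start at
  b at the latest, hence all end before b and are disjoint from the window \<open>Suc b\<close>,
  which the cofactor must therefore absorb.\<close>

lemma path_packs_remove_block:
  assumes "m \<ge> 1" "N < n" "m \<le> N" and b: "b = N + 1 - m"
    and a: "a + wnd n m (Suc b) \<in> path_packs n m N t" "lookup a b = 0"
  shows "a \<in> path_packs n m (N - m) t"
proof -
  obtain W c where W: "set_mset W \<subseteq> {1..N + 1 - m}" "size W = t" "c \<in> exps n"
    "a + wnd n m (Suc b) = (\<Sum>i \<in># W. wnd n m i) + c" using a(1) by (rule packsE)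
  have "lookup (a + wnd n m (Suc b)) b = 0"
    using a(2) assms by (simp add: lookup_add lookup_wnd)
  then have b0: "lookup (\<Sum>i \<in># W. wnd n m i) b = 0" by (simp add: W(4) lookup_add)
  have i: "1 \<le> i \<and> i + m \<le> b" if "i \<in># W" for i
  proof -
    have "1 \<le> i" "i \<le> b" using W(1) that b by auto
    moreover have "lookup (wnd n m i) b = 0"
      using lookup_sum_mset_wnd_ge[OF that, of n m b] b0 by simp
    ultimately show ?thesis
      using assms by (cases "b < i + m") (auto simp: lookup_wnd)
  qed
  have "a = (\<Sum>i \<in># W. wnd n m i) + (c - wnd n m (Suc b))"
  proof (rule add_cancel_disjoint[OF W(4)])
    fix v assume "lookup (wnd n m (Suc b)) v \<noteq> 0"
    then have "b < v" using assms by (auto simp: lookup_wnd split: if_splits)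
    show "lookup (\<Sum>i \<in># W. wnd n m i) v = 0"
    proof (rule lookup_sum_mset_wnd_eq_0)
      fix i assume "i \<in># W"
      then show "1 \<le> i \<and> i + m \<le> n + 1 \<and> \<not> (i \<le> v \<and> v < i + m)"
        using i[of i] \<open>b < v\<close> assms by auto
    qed
  qed
  moreover have "set_mset W \<subseteq> {1..N - m + 1 - m}" using i b assms by fastforce
  ultimately show ?thesis using packsI[OF _ W(2) exps_minus[OF W(3)]] by metis
qed

text \<open>
  The value \<open>phi N m t\<close>, as a function of \<open>p = N + 1 - m - t\<close>. Truncated subtraction is intended:
  in \<open>p\<close> it covers the case \<open>t > N + 1 - m\<close>, in the last summand the difference of ceiling and floor.
\<close>

definition phi_nat :: "nat \<Rightarrow> nat \<Rightarrow> nat" where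
  "phi_nat m p = (p div (m + 1) + 1) * (m - 1) + (p mod (m + 1) - 1)"

section \<open>Arithmetic of the depth function\<close>

lemma phi_nat_add: "phi_nat m (p + (m + 1)) = phi_nat m p + (m - 1)"
proof -
  have "(p + (m + 1)) div (m + 1) = p div (m + 1) + 1" "(p + (m + 1)) mod (m + 1) = p mod (m + 1)"
    by (simp_all del: add_Suc_right add_Suc)
  then show ?thesis by (simp only: phi_nat_def) (simp add: algebra_simps)
qed

lemma phi_nat_small: "p \<le> m \<Longrightarrow> phi_nat m p = m - 1 + (p - 1)"
  by (simp add: phi_nat_def)

text \<open>The induction uses the period m + 1. The lower bound serves the steps of the recursion
  that lower t, the upper bound those that drop one vertex.\<close>

lemma phi_nat_Suc: "phi_nat m p \<le> phi_nat m (Suc p) \<and> phi_nat m (Suc p) \<le> Suc (phi_nat m p)"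
proof (induction p rule: less_induct)
  case (less p)
  show ?case
  proof (cases "p \<le> m")
    case True
    have "phi_nat m (Suc m) = m - 1 + (m - 1)" using phi_nat_add[of m 0] phi_nat_small[of 0 m] by simp
    then show ?thesis using True phi_nat_small[of p m] phi_nat_small[of "Suc p" m]
      by (cases "p = m") auto
  next
    case False
    then obtain p' where p: "p = p' + (m + 1)" by (metis Suc_eq_plus1 add.commute less_eqE not_less_eq_eq)
    have "Suc p = Suc p' + (m + 1)" using p by simp
    then show ?thesis using less.IH[of p'] phi_nat_add[of m p'] phi_nat_add[of m "Suc p'"] p by simp
  qed
qed

lemma phi_nat_mono: "p \<le> q \<Longrightarrow> phi_nat m p \<le> phi_nat m q"
  using lift_Suc_mono_le[of "phi_nat m"] phi_nat_Suc by blast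

text \<open>For the step in which the path loses m + 1 vertices. It is an equality for p > m; for p
  \<le> m the truncated difference is 0.\<close>

lemma phi_nat_diff: "phi_nat m p \<le> phi_nat m (p - (m + 1)) + (m - 1)"
proof (cases "p \<le> m")
  case True
  then show ?thesis using phi_nat_small[of p m] phi_nat_small[of 0 m] by simp
next
  case False
  then have "p = p - (m + 1) + (m + 1)" by simp
  then show ?thesis using phi_nat_add[of m "p - (m + 1)"] by simp
qed

section \<open>Lower bound for powers of path ideals\<close>

lemma koszul_vanish_colon_window:
  assumes m: "1 \<le> m" and q: "1 \<le> q" "q + m \<le> n"
    and V1: "mono_vanish TYPE('k::field) n (Suc r) (packs n m {1..q} t)"
    and V2: "mono_vanish TYPE('k) n (Suc (Suc r)) (path_packs n m (q - 1) (Suc t))"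
  shows "mono_vanish TYPE('k) n (Suc r) {a \<in> exps n. a + wnd n m (Suc q) \<in> packs n m {1..q} (Suc t)}"
proof -
  let ?A = "{a \<in> exps n. a + wnd n m (Suc q) \<in> packs n m {1..q} (Suc t)}"
  let ?B = "path_packs n m (q - 1) (Suc t)" and ?x = "single q (1 :: nat)"
  let ?y = "single (q + m) (1 :: nat)"
  have n0: "n > 0" and qn: "q \<in> {1..n}" using q by auto
  have y: "?y \<in> exps n" using q by simp
  have A2: "{1..q} = {1..q + m - 1 + 1 - m}" using m by simp
  show ?thesis
  proof (rule koszul_vanish_mono_extension[OF upset_colon[OF upset_packs[OF n0]]])
    show "?x \<in> exps n" using qn by simp
    \<comment> \<open>Multiplication by x_q trades the window \<open>Suc q\<close> for the window q
      and the variable x_(q + m), which lies beyond the path on q + m - 1 vertices. So the window q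
      can be cancelled by \<open>packs_remove_last\<close> and the variable dropped.\<close>
    have shift: "?x + wnd n m (Suc q) = wnd n m q + ?y"
      using q by (intro poly_mapping_eqI) (auto simp: lookup_add lookup_wnd lookup_single when_def)
    have "a + ?x \<in> ?A \<longleftrightarrow> a \<in> packs n m {1..q} t" if a: "a \<in> exps n" for a
    proof -
      have "a + ?x + wnd n m (Suc q) = a + ?y + wnd n m q"
        using shift by (simp only: add.assoc add.commute[of ?y])
      then have "a + ?x \<in> ?A \<longleftrightarrow> a + ?y + wnd n m q \<in> packs n m {1..q} (Suc t)"
        using a qn by simp
      also have "\<dots> \<longleftrightarrow> a + ?y \<in> packs n m {1..q} t"
        using packs_remove_last[OF n0, of q m "a + ?y" t] packs_add_wnd[of q "{1..q}" "a + ?y" n m t] q by auto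
      also have "\<dots> \<longleftrightarrow> a \<in> packs n m {1..q} t"
        using path_packs_remove_var[of "q + m - 1" n "q + m" a m t] packs_up[OF n0 _ y, of a m "{1..q}" t] q m
        unfolding A2 by auto
      finally show ?thesis .
    qed
    then have "{a \<in> exps n. a + ?x \<in> ?A} = packs n m {1..q} t" using packs_exps[OF n0] by blast
    then show "mono_vanish TYPE('k) n (Suc r) {a \<in> exps n. a + ?x \<in> ?A}"
      using V1 by simp
  next
    have "a \<in> ?B" if "a \<in> ?A" "a \<notin> up n ?x" for a
    proof -
      have "a \<in> path_packs n m (q + m - 1 - m) (Suc t)"
        by (rule path_packs_remove_block[of m _ n q])
          (use that m q A2 in \<open>auto simp: up_single[OF qn, unfolded One_nat_def] var_exps_def\<close>)
      then show ?thesis using m by (simp add: add.commute)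
    qed
    moreover have "a \<in> ?A" if "a \<in> ?B" for a
    proof -
      have "a \<in> packs n m {1..q} (Suc t)" by (rule subsetD[OF packs_mono that]) (use m in auto)
      then show ?thesis using packs_up[OF n0 _ wnd_exps[OF n0]] packs_exps[OF n0] by blast
    qed
    ultimately have e: "?A \<union> up n ?x = ?B \<union> up n ?x" by blast
    \<comment> \<open>The path behind \<open>?B\<close> ends before q, so x_q is regular modulo
      \<open>?B\<close> and costs one degree; hence \<open>Suc (Suc r)\<close> in the last
      premise.\<close>
    show "mono_vanish TYPE('k) n (Suc r) (?A \<union> up n ?x)"
      unfolding e
    proof (subst koszul_vanish_mono_var[symmetric, OF upset_packs[OF n0] qn])
      fix a assume "a \<in> exps n" and *: "a + ?x \<in> ?B"
      show "a \<in> ?B" by (rule path_packs_remove_var[OF _ _ *]) (use q in auto)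
    qed (fact V2)
  qed
qed

text \<open>Intended for t \<ge> 1: each of the n - N variables beyond the path adds one to the
  depth, and for N < m the ideal is zero.\<close>

definition path_depth :: "nat \<Rightarrow> nat \<Rightarrow> nat \<Rightarrow> nat \<Rightarrow> nat" where
  "path_depth n m N t = (if N < m then n else phi_nat m (N + 1 - m - t) + (n - N))"

text \<open>Induction on N + t. The recursion calls (N, t - 1), (N - 1, t), (N - 1, t - 1) and (N -
  1 - m, t) with the bounds r, r, r + 1 and r + 2. They are met because p does not drop, drops by at
  most one, stays, and drops by at most m + 1, while 0, 1, 1 and m + 1 variables become free. For t
  = 0 the ideal is the unit ideal, and all cohomology vanishes.\<close>

lemma koszul_vanish_path_packs:
  assumes m: "m \<ge> 2"
  shows "N \<le> n \<Longrightarrow> n > 0 \<Longrightarrow> t = 0 \<or> r \<le> path_depth n m N t \<Longrightarrow>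
    mono_vanish TYPE('k::field) n r (path_packs n m N t)"
proof (induction "N + t" arbitrary: N t r rule: less_induct)
  case less
  note n0 = \<open>n > 0\<close>
  show ?case
  proof (cases "t = 0")
    case True
    then show ?thesis by (simp add: packs_0 koszul_vanish_mono_exps)
  next
    case t: False
    then have r: "r \<le> path_depth n m N t" using less.prems by simp
    obtain t' where t': "t = Suc t'" using t not0_implies_Suc by blast
    show ?thesis
    proof (cases "N < m")
      case True
      then show ?thesis using r t by (simp add: packs_empty koszul_vanish_mono_empty path_depth_def)
    next
      case False
      define q where "q = N - m"
      have N: "N = q + m" using False by (simp add: q_def)
      have A: "{1..N + 1 - m} = {1..Suc q}" by (simp add: N)
      define p where "p = N + 1 - m - t"
      have rp: "r \<le> phi_nat m p + (n - N)" using r False by (simp add: path_depth_def p_def)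
      have wq: "wnd n m (Suc q) \<in> exps n" using wnd_exps[OF n0] .
      show ?thesis
        unfolding A
      proof (rule koszul_vanish_mono_extension[OF upset_packs[OF n0] wq])
        have e: "{a \<in> exps n. a + wnd n m (Suc q) \<in> packs n m {1..Suc q} t} = path_packs n m N t'"
          unfolding t' A by (rule packs_remove_last_iff) (use N less.prems n0 in auto)
        have "t' = 0 \<or> r \<le> path_depth n m N t'"
        proof -
          have "p \<le> N + 1 - m - t'" by (simp add: p_def t')
          then show ?thesis using rp phi_nat_mono[of p "N + 1 - m - t'" m] False by (simp add: path_depth_def)
        qed
        then show "mono_vanish TYPE('k) n r {a \<in> exps n. a + wnd n m (Suc q) \<in> packs n m {1..Suc q} t}"
          unfolding e by (intro less.hyps) (use less.prems t' in auto)
      next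
        have A1: "{1..q} = {1..N - 1 + 1 - m}" using N m by simp
        show "mono_vanish TYPE('k) n r (packs n m {1..Suc q} t \<union> up n (wnd n m (Suc q)))"
          unfolding packs_Un_up_last[OF n0]
        proof (rule koszul_vanish_mono_quotient[OF upset_packs[OF n0] wq])
          have "r \<le> path_depth n m (N - 1) t"
          proof (cases "N - 1 < m")
            case True
            then have "N = m" using False by simp
            then have "p = 0" using t by (simp add: p_def)
            then show ?thesis using rp True phi_nat_small[of 0 m] \<open>N = m\<close> less.prems(1) by (auto simp: path_depth_def)
          next
            case False
            have "phi_nat m p \<le> Suc (phi_nat m (p - 1))" using phi_nat_Suc[of m "p - 1"] phi_nat_small[of 0 m] by (cases p) auto
            moreover have "N - 1 + 1 - m - t = p - 1" using N m by (simp add: p_def)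
            ultimately show ?thesis using rp False less.prems(1) m N unfolding path_depth_def by auto
          qed
          then show "mono_vanish TYPE('k) n r (packs n m {1..q} t)"
            unfolding A1 by (intro less.hyps) (use less.prems N m in auto)
        next
          let ?A = "{a \<in> exps n. a + wnd n m (Suc q) \<in> packs n m {1..q} t}"
          show "mono_vanish TYPE('k) n (Suc r) ?A"
          \<comment> \<open>For q = 0 the path on N - 1 = m - 1 vertices has no window, so the colon
            ideal is zero.\<close>
          proof (cases "q = 0")
            case True
            then have A0: "?A = {}" using t by (simp add: packs_empty)
            have "p = 0" "N = m" using t N True by (simp_all add: p_def)
            then have "Suc r \<le> n" using rp phi_nat_small[of 0 m] less.prems(1) m by simp
            then show ?thesis unfolding A0 by (simp only: koszul_vanish_mono_empty)
          next
            case q0: False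
            have A2: "{1..q} = {1..N - 1 + 1 - m}" and N1: "N - 1 - m = q - 1" using N m by simp_all
            show ?thesis
              unfolding t'
            proof (rule koszul_vanish_colon_window)
              have "N - 1 + 1 - m - t' = p" using N m q0 by (simp add: p_def t')
              then have "Suc r \<le> path_depth n m (N - 1) t'"
                using rp q0 N m less.prems(1) by (auto simp: path_depth_def)
              then show "mono_vanish TYPE('k) n (Suc r) (packs n m {1..q} t')"
                unfolding A2 by (intro less.hyps) (use less.prems N m t' in auto)
            next
              have "Suc (Suc r) \<le> path_depth n m (N - 1 - m) t"
              proof (cases "N - 1 - m < m")
                case True
                then have "p \<le> m" "p \<le> q" using N t by (auto simp: p_def)
                then show ?thesis using True rp phi_nat_small[of p m] N m q0 less.prems(1) by (auto simp: path_depth_def)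
              next
                case False
                have "N - 1 - m + 1 - m - t = p - (m + 1)" unfolding p_def using N q0 m by linarith
                then show ?thesis using False rp phi_nat_diff[of m p] N m less.prems(1) by (auto simp: path_depth_def)
              qed
              then show "mono_vanish TYPE('k) n (Suc (Suc r)) (path_packs n m (q - 1) (Suc t'))"
                unfolding N1[symmetric] t'[symmetric] by (intro less.hyps) (use less.prems N m in auto)
            qed (use N m q0 less.prems(1) in auto)
          qed
        qed
      qed
    qed
  qed
qed

section \<open>Intersections of monomial primes\<close>

text \<open>The private elements p \<sigma> are distinct and lie outside C \<rho>.\<close>

lemma card_Un_private:
  fixes C :: "nat \<Rightarrow> nat set"
  assumes "finite R" "\<rho> \<notin> R" "\<And>\<sigma>. \<sigma> \<in> insert \<rho> R \<Longrightarrow> finite (C \<sigma>)"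
    and p: "\<And>\<sigma>. \<sigma> \<in> R \<Longrightarrow> p \<sigma> \<in> C \<sigma>" "\<And>\<sigma> \<tau>. \<sigma> \<in> R \<Longrightarrow> \<tau> \<in> insert \<rho> R \<Longrightarrow> \<tau> \<noteq> \<sigma> \<Longrightarrow> p \<sigma> \<notin> C \<tau>"
  shows "card (C \<rho>) + card R \<le> card (\<Union>\<sigma> \<in> insert \<rho> R. C \<sigma>)"
proof -
  have inj: "inj_on p R"
  proof (rule inj_onI)
    fix \<sigma> \<tau> assume "\<sigma> \<in> R" "\<tau> \<in> R" "p \<sigma> = p \<tau>"
    then show "\<sigma> = \<tau>" using p(1)[of \<tau>] p(2)[of \<sigma> \<tau>] by auto
  qed
  have "p ` R \<inter> C \<rho> = {}" using p(2)[of _ \<rho>] assms(2) by auto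
  then have "card (C \<rho>) + card R = card (C \<rho> \<union> p ` R)"
    using assms(1,3) card_image[OF inj] by (subst card_Un_disjoint) auto
  also have "\<dots> \<le> card (\<Union>\<sigma> \<in> insert \<rho> R. C \<sigma>)"
    by (rule card_mono) (use assms p(1) in auto)
  finally show ?thesis .
qed

text \<open>
  The facets of the associated simplicial complex are the complements of the \<open>C \<rho>\<close>. Because of the
  private elements \<open>p \<rho>\<close>, the link of their common face has the boundary of a simplex as its nerve.
\<close>

lemma koszul_vanish_Int_primes:
  fixes C :: "nat \<Rightarrow> nat set"
  assumes "finite R" "R \<noteq> {}" "\<And>\<rho>. \<rho> \<in> R \<Longrightarrow> C \<rho> \<subseteq> {1..n}"
    and "\<And>\<rho>. \<rho> \<in> R \<Longrightarrow> p \<rho> \<in> C \<rho>" "\<And>\<rho> \<sigma>. \<rho> \<in> R \<Longrightarrow> \<sigma> \<in> R \<Longrightarrow> \<sigma> \<noteq> \<rho> \<Longrightarrow> p \<rho> \<notin> C \<sigma>"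
  shows "mono_vanish TYPE('k::field) n r (\<Inter>\<rho> \<in> R. var_exps n (C \<rho>))
    \<longleftrightarrow> r + card (\<Union>\<rho> \<in> R. C \<rho>) + 1 \<le> n + card R"
  using assms
proof (induction R arbitrary: C r rule: finite_ne_induct)
  case (singleton \<rho>)
  then show ?case using koszul_vanish_var_exps[of "C \<rho>" n r, where 'k = 'k] by simp
next
  case (insert \<rho> R)
  let ?P = "var_exps n (C \<rho>)" and ?Q = "\<Inter>\<sigma> \<in> R. var_exps n (C \<sigma>)"
  let ?u = "card (\<Union>\<sigma> \<in> insert \<rho> R. C \<sigma>)"
  have upP: "upset n ?P" by (rule upset_var_exps)
  have upQ: "upset n ?Q"
    using insert.hyps(2) upset_var_exps[of n] by (fastforce simp: upset_def)
  have fin: "finite (C \<sigma>)" if "\<sigma> \<in> insert \<rho> R" for \<sigma>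
    using insert.prems(1)[OF that] finite_subset by blast
  have u: "?u \<le> n"
  proof -
    have "(\<Union>\<sigma> \<in> insert \<rho> R. C \<sigma>) \<subseteq> {1..n}" using insert.prems(1) by blast
    then show ?thesis using card_mono[of "{1..n}"] by fastforce
  qed
  have VP: "mono_vanish TYPE('k) n r ?P" if "r + ?u \<le> n + card R" for r
  proof -
    have "card (C \<rho>) + card R \<le> ?u"
      by (rule card_Un_private[where p = p]) (use insert fin in auto)
    then show ?thesis
      using that koszul_vanish_var_exps[of "C \<rho>" n r] insert.prems(1) by simp
  qed
  have VQ: "mono_vanish TYPE('k) n r ?Q" if "r + ?u \<le> n + card R" for r
  proof -
    have "(\<Union>\<sigma> \<in> R. C \<sigma>) \<subset> (\<Union>\<sigma> \<in> insert \<rho> R. C \<sigma>)"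
      using insert.prems(2)[of \<rho>] insert.prems(3)[of \<rho>] insert.hyps(3) by blast
    then have "card (\<Union>\<sigma> \<in> R. C \<sigma>) < ?u"
      using fin insert.hyps(1) by (intro psubset_card_mono) auto
    moreover have "mono_vanish TYPE('k) n r ?Q \<longleftrightarrow> r + card (\<Union>\<sigma> \<in> R. C \<sigma>) + 1 \<le> n + card R"
      by (rule insert.IH) (use insert.prems in auto)
    ultimately show ?thesis using that by simp
  qed
  \<comment> \<open>Adding P to every prime of Q gives an intersection of the same kind over R: the
    sets C \<sigma> \<union> C \<rho> keep the private elements and have the full union, so the
    induction hypothesis covers P + Q as well as Q.\<close>
  have VPQ: "mono_vanish TYPE('k) n r (?P \<union> ?Q) \<longleftrightarrow> r + ?u + 1 \<le> n + card R" for r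
  proof -
    have "?P \<union> ?Q = (\<Inter>\<sigma> \<in> R. var_exps n (C \<sigma> \<union> C \<rho>))"
      by (auto simp: var_exps_Un[symmetric])
    moreover have "(\<Union>\<sigma> \<in> R. C \<sigma> \<union> C \<rho>) = (\<Union>\<sigma> \<in> insert \<rho> R. C \<sigma>)"
      using insert.hyps(2) by auto
    moreover have "mono_vanish TYPE('k) n r (\<Inter>\<sigma> \<in> R. var_exps n (C \<sigma> \<union> C \<rho>))
        \<longleftrightarrow> r + card (\<Union>\<sigma> \<in> R. C \<sigma> \<union> C \<rho>) + 1 \<le> n + card R"
    proof (rule insert.IH)
      fix \<sigma> \<tau> assume "\<sigma> \<in> R" "\<tau> \<in> R" "\<tau> \<noteq> \<sigma>"
      then show "p \<sigma> \<notin> C \<tau> \<union> C \<rho>"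
        using insert.prems(3)[of \<sigma> \<tau>] insert.prems(3)[of \<sigma> \<rho>] insert.hyps(3) by auto
    qed (use insert.prems in auto)
    ultimately show ?thesis by simp
  qed
  note iP = ideal_mono_ideal[OF upP, where 'k = 'k] and iQ = ideal_mono_ideal[OF upQ, where 'k = 'k]
  have inter: "(\<Inter>\<sigma> \<in> insert \<rho> R. var_exps n (C \<sigma>)) = ?P \<inter> ?Q" by simp
  \<comment> \<open>Both S/P and S/Q have greater depth than S/(P + Q), so by Mayer-Vietoris the
    depth of S/(P \<inter> Q) is exactly one more than that of S/(P + Q); \<open>up\<close> and
    \<open>low\<close> are the two halves.\<close>
  have up: "mono_vanish TYPE('k) n r (?P \<inter> ?Q)" if "r + ?u \<le> n + card R" for r
  proof (cases r)
    case (Suc s)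
    show ?thesis
      unfolding mono_ideal_inter[symmetric]
      by (rule koszul_vanish_inter[OF iP iQ])
        (use VP[OF that] VQ[OF that] VPQ[of s] that Suc in \<open>simp_all add: ideal_plus_mono_ideal\<close>)
  qed simp
  have low: "\<not> mono_vanish TYPE('k) n (Suc r) (?P \<inter> ?Q)" if "r + ?u = n + card R" for r
  proof
    assume "mono_vanish TYPE('k) n (Suc r) (?P \<inter> ?Q)"
    then have "mono_vanish TYPE('k) n r (?P \<union> ?Q)"
      using koszul_vanish_plus[OF iP iQ, of r] VP[of r] VQ[of r] that
      by (simp add: mono_ideal_inter ideal_plus_mono_ideal)
    then show False using VPQ[of r] that by simp
  qed
  show ?case
    unfolding inter
  proof
    assume V: "mono_vanish TYPE('k) n r (?P \<inter> ?Q)"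
    show "r + ?u + 1 \<le> n + card (insert \<rho> R)"
    proof (rule ccontr)
      assume "\<not> ?thesis"
      then have "Suc (n + card R - ?u) \<le> r" using insert.hyps(1,3) u by simp
      then show False
        using low[of "n + card R - ?u"] koszul_vanish_mono[OF V] u by simp
    qed
  next
    assume "r + ?u + 1 \<le> n + card (insert \<rho> R)"
    then show "mono_vanish TYPE('k) n r (?P \<inter> ?Q)"
      using up insert.hyps(1,3) by simp
  qed
qed

section \<open>A colon ideal that is an intersection of monomial primes\<close>

lemma ex_mod_in_interval:
  fixes m :: nat
  assumes "m > 0"
  obtains \<rho> where "t \<le> \<rho>" "\<rho> < t + m" "\<rho> mod m = v mod m"
proof
  \<comment> \<open>Modulo m the term (m - 1) t stands for - t.\<close>
  let ?\<rho> = "t + (v + (m - 1) * t) mod m"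
  show "t \<le> ?\<rho>" "?\<rho> < t + m" using assms by simp_all
  have "?\<rho> mod m = (v + (t + (m - 1) * t)) mod m" by (simp add: mod_add_right_eq add.left_commute)
  also have "t + (m - 1) * t = m * t" using assms by (cases m) auto
  finally show "?\<rho> mod m = v mod m" by simp
qed

lemma mod_eq_less_imp_add_le:
  fixes m :: nat
  assumes "a mod m = b mod m" "a < b"
  shows "a + m \<le> b"
proof -
  have "m dvd b - a" using mod_eq_dvd_iff_nat[of a b m] assms by simp
  then have "m \<le> b - a" using assms(2) by (intro dvd_imp_le) auto
  then show ?thesis using assms(2) by simp
qed

lemma mod_eq_interval_unique:
  fixes m :: nat
  assumes "a mod m = b mod m" "t \<le> a" "a < t + m" "t \<le> b" "b < t + m"
  shows "a = b"
  using mod_eq_less_imp_add_le[of a m b] mod_eq_less_imp_add_le[of b m a] assms by (cases a b rule: linorder_cases) auto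

text \<open>
  A variable can be moved to the next element of its residue class at the expense of shifting a
  window.
\<close>

lemma wnd_exchange:
  assumes "1 \<le> i" "i + m \<le> n"
  shows "wnd n m (Suc i) + single i 1 = wnd n m i + single (i + m) 1"
  using assms by (intro poly_mapping_eqI) (auto simp: lookup_add lookup_wnd lookup_single when_def)

lemma sum_fun_upd:
  fixes g :: "'a \<Rightarrow> 'b::comm_monoid_add"
  assumes "finite A" "i \<in> A"
  shows "(\<Sum>x \<in> A. g ((f(i := y)) x)) + g (f i) = (\<Sum>x \<in> A. g (f x)) + g y"
proof -
  have "(\<Sum>x \<in> A - {i}. g ((f(i := y)) x)) = (\<Sum>x \<in> A - {i}. g (f x))" by (rule sum.cong) auto
  then show ?thesis using assms by (simp add: sum.remove ac_simps)
qed

text \<open>Induction on the total distance of the c \<rho> from their targets \<rho>. One step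
  trades the window \<open>Suc i\<close> for the window i, where i = c \<rho>, and moves c \<rho> to
  i + m. The last hypothesis is the invariant that the windows from c \<rho> on in its residue class
  are still untraded; it persists because distinct elements of R have distinct residues.\<close>

lemma wnd_shift_aux:
  fixes R :: "nat set"
  assumes "m > 0" "t + m \<le> n + 1" "finite R" "R \<subseteq> {t..<t + m}"
    and "\<And>\<rho>. \<rho> \<in> R \<Longrightarrow> 1 \<le> c \<rho> \<and> c \<rho> \<le> \<rho> \<and> c \<rho> mod m = \<rho> mod m"
    and "\<And>i. i \<in> {1..<t} \<Longrightarrow> f i = i \<or> f i = Suc i"
    and "\<And>i \<rho>. i \<in> {1..<t} \<Longrightarrow> \<rho> \<in> R \<Longrightarrow> i mod m = \<rho> mod m \<Longrightarrow> c \<rho> \<le> i \<Longrightarrow> f i = Suc i"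
  shows "\<exists>f'. (\<forall>i \<in> {1..<t}. f' i = i \<or> f' i = Suc i) \<and>
    (\<Sum>i \<in> {1..<t}. wnd n m (f i)) + (\<Sum>\<rho> \<in> R. single (c \<rho>) 1)
      = (\<Sum>i \<in> {1..<t}. wnd n m (f' i)) + (\<Sum>\<rho> \<in> R. single \<rho> 1)"
  using assms(5-)
proof (induction "\<Sum>\<rho> \<in> R. \<rho> - c \<rho>" arbitrary: c f rule: less_induct)
  case less
  show ?case
  proof (cases "\<forall>\<rho> \<in> R. c \<rho> = \<rho>")
    case True
    then have "(\<Sum>\<rho> \<in> R. single (c \<rho>) (1 :: nat)) = (\<Sum>\<rho> \<in> R. single \<rho> 1)"
      by (intro sum.cong) auto
    then show ?thesis using less.prems(2) by (intro exI[of _ f]) auto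
  next
    case False
    then obtain \<rho> where \<rho>: "\<rho> \<in> R" "c \<rho> < \<rho>" using less.prems(1) le_neq_implies_less by blast
    define i where "i = c \<rho>"
    have im: "i + m \<le> \<rho>" "1 \<le> i" "i mod m = \<rho> mod m"
      using mod_eq_less_imp_add_le[of i m \<rho>] less.prems(1)[OF \<rho>(1)] \<rho> by (auto simp: i_def)
    have "\<rho> < t + m" using \<rho>(1) assms(4) by auto
    then have it: "i \<in> {1..<t}" using im by auto
    have fi: "f i = Suc i" using less.prems(3)[OF it \<rho>(1) im(3)] by (simp add: i_def)
    define f1 where "f1 = f(i := i)"
    define c1 where "c1 = c(\<rho> := i + m)"
    have "\<exists>f'. (\<forall>i \<in> {1..<t}. f' i = i \<or> f' i = Suc i) \<and>
      (\<Sum>i \<in> {1..<t}. wnd n m (f1 i)) + (\<Sum>\<rho> \<in> R. single (c1 \<rho>) 1)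
        = (\<Sum>i \<in> {1..<t}. wnd n m (f' i)) + (\<Sum>\<rho> \<in> R. single \<rho> 1)"
    proof (rule less.hyps)
      show "(\<Sum>\<rho> \<in> R. \<rho> - c1 \<rho>) < (\<Sum>\<rho> \<in> R. \<rho> - c \<rho>)"
      proof (rule sum_strict_mono_ex1[OF assms(3)])
        show "\<forall>\<sigma> \<in> R. \<sigma> - c1 \<sigma> \<le> \<sigma> - c \<sigma>" by (auto simp: c1_def i_def)
        show "\<exists>\<sigma> \<in> R. \<sigma> - c1 \<sigma> < \<sigma> - c \<sigma>"
          by (rule bexI[OF _ \<rho>(1)]) (use im assms(1) \<rho>(2) in \<open>auto simp: c1_def i_def\<close>)
      qed
      show "1 \<le> c1 \<sigma> \<and> c1 \<sigma> \<le> \<sigma> \<and> c1 \<sigma> mod m = \<sigma> mod m" if "\<sigma> \<in> R" for \<sigma>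
        using less.prems(1)[OF that] im by (auto simp: c1_def)
      show "f1 i' = i' \<or> f1 i' = Suc i'" if "i' \<in> {1..<t}" for i'
        using less.prems(2)[OF that] by (auto simp: f1_def)
      show "f1 i' = Suc i'" if i': "i' \<in> {1..<t}" and \<sigma>: "\<sigma> \<in> R" "i' mod m = \<sigma> mod m" "c1 \<sigma> \<le> i'" for i' \<sigma>
      proof (cases "\<sigma> = \<rho>")
        case True
        then have "i < i'" "c \<sigma> \<le> i'" using \<sigma>(3) assms(1) by (auto simp: c1_def i_def)
        then show ?thesis using less.prems(3)[OF i' \<sigma>(1,2)] by (simp add: f1_def)
      next
        case False
        have "i' \<noteq> i"
        proof
          assume "i' = i"
          then have "\<sigma> mod m = \<rho> mod m" using \<sigma>(2) im(3) by simp
          then show False using mod_eq_interval_unique[of \<sigma> m \<rho> t] subsetD[OF assms(4) \<sigma>(1)] subsetD[OF assms(4) \<rho>(1)] False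
            by simp
        qed
        then show ?thesis using less.prems(3)[OF i' \<sigma>(1,2)] \<sigma>(3) False by (simp add: f1_def c1_def)
      qed
    qed
    moreover have "(\<Sum>i \<in> {1..<t}. wnd n m (f1 i)) + (\<Sum>\<rho> \<in> R. single (c1 \<rho>) 1)
        = (\<Sum>i \<in> {1..<t}. wnd n m (f i)) + (\<Sum>\<rho> \<in> R. single (c \<rho>) 1)"
    proof -
      let ?x = "single i (1 :: nat)" and ?y = "single (i + m) (1 :: nat)"
      have 1: "(\<Sum>i \<in> {1..<t}. wnd n m (f1 i)) + wnd n m (Suc i) = (\<Sum>i \<in> {1..<t}. wnd n m (f i)) + wnd n m i"
        using sum_fun_upd[OF _ it, of "wnd n m" f i] fi by (simp add: f1_def)
      have 2: "(\<Sum>\<rho> \<in> R. single (c1 \<rho>) 1) + ?x = (\<Sum>\<rho> \<in> R. single (c \<rho>) 1) + ?y"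
        using sum_fun_upd[OF assms(3) \<rho>(1), of "\<lambda>v. single v (1 :: nat)" c "i + m"] by (simp add: c1_def i_def)
      have 3: "wnd n m (Suc i) + ?x = wnd n m i + ?y"
        by (rule wnd_exchange) (use im it assms(2) in auto)
      have "(p + r) + (b + d) = (q + s) + (b + d)"
        if "p + b = q + a" "r + d = s + e" "b + d = a + e" for p q r s a b d e :: "nat \<Rightarrow>\<^sub>0 nat"
      proof -
        have "(p + r) + (b + d) = (p + b) + (r + d)" by (simp only: ac_simps)
        also have "\<dots> = (q + s) + (a + e)" unfolding that(1,2) by (simp only: ac_simps)
        finally show ?thesis unfolding that(3) .
      qed
      from this[OF 1 2 3] show ?thesis by (rule add_right_imp_eq)
    qed
    ultimately show ?thesis by simp
  qed
qed

text \<open>Variables from distinct residue classes are gathered at the consecutive positions from t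
  on, where they can contribute to one more window.\<close>

lemma wnd_shift:
  fixes R :: "nat set"
  assumes "m > 0" "t + m \<le> n + 1" "R \<subseteq> {t..<t + m}"
    and "\<And>\<rho>. \<rho> \<in> R \<Longrightarrow> 1 \<le> c \<rho> \<and> c \<rho> < t + m \<and> c \<rho> mod m = \<rho> mod m"
  obtains f where "\<And>i. i \<in> {1..<t} \<Longrightarrow> f i = i \<or> f i = Suc i"
    "(\<Sum>i \<in> {1..<t}. wnd n m (Suc i)) + (\<Sum>\<rho> \<in> R. single (c \<rho>) 1)
      = (\<Sum>i \<in> {1..<t}. wnd n m (f i)) + (\<Sum>\<rho> \<in> R. single \<rho> 1)"
proof -
  have "finite R" using assms(3) finite_subset by blast
  \<comment> \<open>Otherwise c \<rho> \<ge> \<rho> + m \<ge> t + m.\<close>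
  have "c \<rho> \<le> \<rho>" if "\<rho> \<in> R" for \<rho>
    using assms(4)[OF that] mod_eq_less_imp_add_le[of \<rho> m "c \<rho>"] that assms(3) by fastforce
  then have "\<exists>f. (\<forall>i \<in> {1..<t}. f i = i \<or> f i = Suc i) \<and>
    (\<Sum>i \<in> {1..<t}. wnd n m (Suc i)) + (\<Sum>\<rho> \<in> R. single (c \<rho>) 1)
      = (\<Sum>i \<in> {1..<t}. wnd n m (f i)) + (\<Sum>\<rho> \<in> R. single \<rho> 1)"
    using assms(4) by (intro wnd_shift_aux[OF assms(1,2) \<open>finite R\<close> assms(3)]) auto
  then show thesis using that by blast
qed

text \<open>The index range \<open>{1..<t}\<close> provides t - 1 windows; the missing one is cut
  out of z.\<close>

lemma packs_witness:
  assumes "\<And>i. i \<in> {1..<t} \<Longrightarrow> f i \<in> A" "i0 \<in> A" "t \<ge> 1" "z \<in> exps n"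
    and le: "\<And>v. lookup (wnd n m i0) v \<le> lookup z v"
  shows "(\<Sum>i \<in> {1..<t}. wnd n m (f i)) + z \<in> packs n m A t"
proof -
  let ?W = "add_mset i0 (image_mset f (mset_set {1..<t}))"
  have "z = wnd n m i0 + (z - wnd n m i0)"
    using le by (intro poly_mapping_eqI) (simp add: lookup_add lookup_minus)
  moreover have "(\<Sum>i \<in># ?W. wnd n m i) = wnd n m i0 + (\<Sum>i \<in> {1..<t}. wnd n m (f i))"
    by (simp add: image_mset.compositionality comp_def sum_unfold_sum_mset)
  ultimately have "(\<Sum>i \<in> {1..<t}. wnd n m (f i)) + z = (\<Sum>i \<in># ?W. wnd n m i) + (z - wnd n m i0)"
    by (metis (no_types, lifting) add.assoc add.commute)
  moreover have "set_mset ?W \<subseteq> A" "size ?W = t" using assms(1-3) by auto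
  ultimately show ?thesis using packsI[OF _ _ exps_minus[OF assms(4)]] by metis
qed

text \<open>
  A monomial \<open>x\<^sup>u\<close> such that the ideal quotient of the \<open>t\<close>-th power of the path ideal on \<open>NN\<close>
  vertices by \<open>x\<^sup>u\<close> is an intersection of \<open>m\<close> monomial primes. The vertices \<open>Inv\<close> are made
  invertible, the first \<open>m + t - 1\<close> vertices are grouped by their residues modulo \<open>m\<close>, and the
  vertices \<open>Blk\<close> become variables of the colon ideal.
\<close>

locale path_colon =
  fixes n m t j k :: nat
  assumes m2: "m \<ge> 2" and t1: "t \<ge> 1" and km: "k \<le> m" and Nn: "j * (m + 1) + (m + t + k - 1) \<le> n"
begin

text \<open>Here \<open>NN + 1 - m - t\<close> equals j (m + 1) + k, and the j blocks of length m +
  1 begin after \<open>N0\<close>.\<close>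

definition N0 :: nat where "N0 = m + t + k - 1"
definition NN :: nat where "NN = j * (m + 1) + N0"
text \<open>The first and the last vertex of each block. The m - 1 vertices between them belong to
  \<open>Inv\<close>, so either end alone completes a window.\<close>

definition Blk :: "nat set" where
  "Blk = (\<lambda>l. N0 + l * (m + 1) + 1) ` {..<j} \<union> (\<lambda>l. N0 + (l + 1) * (m + 1)) ` {..<j}"
definition Inv :: "nat set" where "Inv = {m + t + 1..NN} - Blk"
text \<open>The variables of the prime with index \<rho>, a set that meets every window. For \<rho>
  < t + k it includes m + t; for larger \<rho> a window starting after \<rho> already ends beyond
  \<open>N0\<close> and meets \<open>Blk\<close>.\<close>

definition cov :: "nat \<Rightarrow> nat set" where
  "cov \<rho> = {v \<in> {1..<m + t}. v mod m = \<rho> mod m} \<union> (if \<rho> < t + k then {m + t} else {}) \<union> Blk"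
text \<open>The windows starting at 2, ..., t lie below m + t, so each contains exactly one element
  of \<open>cov \<rho>\<close>. Their total weight is t - 1, one short of a packing by t
  windows.\<close>

definition u :: "nat \<Rightarrow>\<^sub>0 nat" where
  "u = (\<Sum>i \<in> {1..<t}. wnd n m (Suc i)) + (\<Sum>v \<in> Inv. single v t)"

lemma N0_ge: "m + t \<le> N0 + 1" "N0 \<le> NN" "NN \<le> n" "N0 + 1 = m + t + k"
  using Nn t1 m2 by (auto simp: N0_def NN_def)

lemma n_pos: "n > 0"
  using N0_ge m2 t1 by linarith

lemma BlkE:
  assumes "v \<in> Blk"
  obtains l where "l < j" "v = N0 + l * (m + 1) + 1" | l where "l < j" "v = N0 + (l + 1) * (m + 1)"
  using assms by (auto simp: Blk_def)

lemma block_le: "l < j \<Longrightarrow> (l + 1) * (m + 1) \<le> j * (m + 1)"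
  by (rule mult_le_mono1) simp

lemma Blk_bounds:
  assumes "v \<in> Blk"
  shows "N0 < v" "v \<le> NN" "(v - N0) mod (m + 1) \<le> 1"
proof -
  have "N0 < v \<and> v \<le> NN \<and> (v - N0) mod (m + 1) \<le> 1"
    using assms
  proof (cases rule: BlkE)
    case (1 l)
    have "(l * (m + 1) + 1) mod (m + 1) = 1" using m2 by (metis mod_mult_self3 mod_less less_add_same_cancel2 add.commute less_le_trans zero_less_numeral)
    then show ?thesis using 1 block_le[of l] by (simp add: NN_def)
  next
    case (2 l)
    then show ?thesis using block_le[of l] by (simp add: NN_def del: mult_Suc mult_Suc_right)
  qed
  then show "N0 < v" "v \<le> NN" "(v - N0) mod (m + 1) \<le> 1" by auto
qed

lemma finite_Blk: "finite Blk"
  by (simp add: Blk_def)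

lemma card_Blk: "card Blk = 2 * j"
proof -
  have inj: "inj_on (\<lambda>l. N0 + l * (m + 1) + 1) {..<j}" "inj_on (\<lambda>l. N0 + (l + 1) * (m + 1)) {..<j}"
    by (auto simp: inj_on_def simp del: mult_Suc_right)
  have "N0 + l * (m + 1) + 1 \<noteq> N0 + (l' + 1) * (m + 1)" for l l'
  proof
    assume "N0 + l * (m + 1) + 1 = N0 + (l' + 1) * (m + 1)"
    then have "l * (m + 1) + 1 = (l' + 1) * (m + 1)" by simp
    then have "(l * (m + 1) + 1) mod (m + 1) = ((l' + 1) * (m + 1)) mod (m + 1)" by (rule arg_cong)
    then show False using m2 by (simp only: mod_mult_self2_is_0 mod_mult_self3) simp
  qed
  then have "(\<lambda>l. N0 + l * (m + 1) + 1) ` {..<j} \<inter> (\<lambda>l. N0 + (l + 1) * (m + 1)) ` {..<j} = {}" by blast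
  then show ?thesis
    unfolding Blk_def using inj by (subst card_Un_disjoint) (auto simp: card_image)
qed

lemma finite_cov: "finite (cov \<rho>)"
  by (simp add: cov_def finite_Blk)

lemma cov_subset: "\<rho> \<in> {t..<t + m} \<Longrightarrow> cov \<rho> \<subseteq> {1..NN}"
  using N0_ge Blk_bounds by (fastforce simp: cov_def split: if_splits)

lemma Inv_subset: "Inv \<subseteq> {1..NN}"
  by (auto simp: Inv_def)

lemma finite_Inv: "finite Inv"
  by (simp add: Inv_def)

text \<open>From \<open>N0 + 1\<close> to \<open>NN\<close> consecutive elements of
  \<open>Blk\<close> are at most m apart, so no window reaching this range fits between
  them.\<close>

lemma window_meets_Blk:
  assumes "N0 + 2 \<le> i + m" "i + m \<le> NN + 1"
  shows "\<exists>v \<in> Blk. i \<le> v \<and> v < i + m"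
proof (cases "i \<le> N0 + 1")
  case True
  have "j * (m + 1) \<noteq> 0" using assms unfolding NN_def by linarith
  then have "0 < j" by (cases j) auto
  then have "N0 + 1 \<in> Blk" by (force simp: Blk_def)
  then show ?thesis using True assms by (intro bexI[of _ "N0 + 1"]) auto
next
  case False
  define l r where "l = (i - N0 - 1) div (m + 1)" and "r = (i - N0 - 1) mod (m + 1)"
  have "i - N0 - 1 = l * (m + 1) + r" unfolding l_def r_def by (rule div_mult_mod_eq[symmetric])
  then have i: "i = N0 + l * (m + 1) + 1 + r" using False by simp
  have r: "r \<le> m" using mod_less_divisor[of "m + 1" "i - N0 - 1"] by (simp add: r_def)
  have "l * (m + 1) < j * (m + 1)" using i assms m2 by (simp add: NN_def)
  then have l: "l < j" by (simp only: mult_less_cancel2)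
  show ?thesis
  proof (cases "r = 0")
    case True
    then have "i \<in> Blk" using i l by (auto simp: Blk_def)
    then show ?thesis using m2 by auto
  next
    case False
    have "N0 + (l + 1) * (m + 1) \<in> Blk" using l by (auto simp: Blk_def)
    then show ?thesis using i r False by (intro bexI[of _ "N0 + (l + 1) * (m + 1)"]) auto
  qed
qed

text \<open>A window with i \<le> t lies below m + t and meets the residue class; for t < i \<le>
  \<rho> it contains \<rho> itself; after that it contains m + t or ends beyond \<open>N0\<close>,
  where \<open>Blk\<close> takes over.\<close>

lemma window_meets_cov:
  assumes \<rho>: "t \<le> \<rho>" "\<rho> < t + m" and i: "1 \<le> i" "i + m \<le> NN + 1"
  shows "\<exists>v \<in> cov \<rho>. i \<le> v \<and> v < i + m"
proof -
  consider "i \<le> t" | "t < i" "i \<le> \<rho>" | "\<rho> < i" "\<rho> < t + k" "i \<le> m + t" | "\<rho> < i" "t + k \<le> \<rho>" | "m + t < i"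
    using \<rho> by linarith
  then show ?thesis
  proof cases
    case 1
    obtain v where "i \<le> v" "v < i + m" "v mod m = \<rho> mod m"
      using ex_mod_in_interval[of m i \<rho>] m2 by auto
    then show ?thesis using 1 i by (intro bexI[of _ v]) (auto simp: cov_def)
  next
    case 2
    then show ?thesis using \<rho> t1 by (intro bexI[of _ \<rho>]) (auto simp: cov_def)
  next
    case 3
    then show ?thesis using \<rho> by (intro bexI[of _ "m + t"]) (auto simp: cov_def)
  next
    case 4
    then have "N0 + 2 \<le> i + m" using N0_ge(4) by simp
    then show ?thesis using window_meets_Blk[OF _ i(2)] by (auto simp: cov_def)
  next
    case 5
    then have "N0 + 2 \<le> i + m" using N0_ge(4) km by simp
    then show ?thesis using window_meets_Blk[OF _ i(2)] by (auto simp: cov_def)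
  qed
qed

text \<open>The order of a monomial along the prime of \<open>cov \<rho>\<close>. Windows of the
  path weigh at least 1 and u less than t, so a factor that brings u into the t-th power has
  positive weight.\<close>

definition weight :: "nat \<Rightarrow> (nat \<Rightarrow>\<^sub>0 nat) \<Rightarrow> nat" where
  "weight \<rho> b = (\<Sum>v \<in> cov \<rho>. lookup b v)"

lemma weight_add: "weight \<rho> (a + b) = weight \<rho> a + weight \<rho> b"
  by (simp add: weight_def lookup_add sum.distrib)

lemma weight_zero: "weight \<rho> 0 = 0"
  by (simp add: weight_def)

lemma weight_sum: "weight \<rho> (sum f A) = (\<Sum>i \<in> A. weight \<rho> (f i))"
  by (induction A rule: infinite_finite_induct) (simp_all add: weight_add weight_zero)

lemma weight_wnd_ge:
  assumes "\<rho> \<in> {t..<t + m}" "i \<in> {1..NN + 1 - m}"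
  shows "1 \<le> weight \<rho> (wnd n m i)"
proof -
  have i: "1 \<le> i" "i + m \<le> NN + 1" "i + m \<le> n + 1" using assms(2) N0_ge by auto
  obtain v where v: "v \<in> cov \<rho>" "i \<le> v" "v < i + m"
    using window_meets_cov[of \<rho> i] assms(1) i by auto
  then have "lookup (wnd n m i) v = 1" using i by (simp add: lookup_wnd)
  then show ?thesis
    unfolding weight_def using member_le_sum[OF v(1), of "lookup (wnd n m i)"] finite_cov by simp
qed

lemma weight_sum_mset_ge:
  assumes "\<rho> \<in> {t..<t + m}" "set_mset W \<subseteq> {1..NN + 1 - m}"
  shows "size W \<le> weight \<rho> (\<Sum>i \<in># W. wnd n m i)"
  using assms(2)
proof (induction W)
  case (add i W)
  then show ?case using weight_wnd_ge[OF assms(1), of i] by (simp add: weight_add)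
qed simp

lemma weight_wnd_le:
  assumes "\<rho> \<in> {t..<t + m}" "i \<in> {1..<t}"
  shows "weight \<rho> (wnd n m (Suc i)) \<le> 1"
proof -
  have i: "Suc i + m \<le> m + t" "Suc i + m \<le> n + 1" using assms(2) N0_ge by auto
  let ?D = "{v \<in> cov \<rho>. Suc i \<le> v \<and> v < Suc i + m}"
  have "weight \<rho> (wnd n m (Suc i)) = card ?D"
    unfolding weight_def using i finite_cov[of \<rho>]
    by (simp add: lookup_wnd sum.inter_filter[symmetric])
  moreover have "v mod m = \<rho> mod m" if "v \<in> ?D" for v
    using that i Blk_bounds(1)[of v] N0_ge(1) by (auto simp: cov_def split: if_splits)
  then have "v = w" if "v \<in> ?D" "w \<in> ?D" for v w
    using mod_eq_interval_unique[of v m w "Suc i"] that by auto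
  then have "card ?D \<le> Suc 0" using finite_cov[of \<rho>] by (subst card_le_Suc0_iff_eq) auto
  ultimately show ?thesis by simp
qed

lemma weight_u:
  assumes "\<rho> \<in> {t..<t + m}"
  shows "weight \<rho> u < t"
proof -
  have "weight \<rho> (single v t) = 0" if "v \<in> Inv" for v
  proof -
    have "v \<notin> cov \<rho>" using that by (auto simp: Inv_def cov_def split: if_splits)
    then show ?thesis unfolding weight_def by (intro sum.neutral) (auto simp: lookup_single when_def)
  qed
  then have "weight \<rho> u = (\<Sum>i \<in> {1..<t}. weight \<rho> (wnd n m (Suc i)))"
    by (simp add: u_def weight_add weight_sum)
  also have "\<dots> \<le> (\<Sum>i \<in> {1..<t}. 1)" by (rule sum_mono) (rule weight_wnd_le[OF assms])
  finally show ?thesis using t1 by simp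
qed

lemma u_exps: "u \<in> exps n"
  unfolding u_def using wnd_exps[OF n_pos] Inv_subset N0_ge(3)
  by (intro exps_add_iff[THEN iffD2] conjI exps_sum exps_single) auto

lemma colon_subset:
  assumes "a \<in> exps n" "a + u \<in> path_packs n m NN t" "\<rho> \<in> {t..<t + m}"
  shows "a \<in> var_exps n (cov \<rho>)"
proof -
  obtain W c where W: "set_mset W \<subseteq> {1..NN + 1 - m}" "size W = t" "c \<in> exps n"
    "a + u = (\<Sum>i \<in># W. wnd n m i) + c" using assms(2) by (rule packsE)
  have "t \<le> weight \<rho> (a + u)"
    unfolding W(4) weight_add using weight_sum_mset_ge[OF assms(3) W(1)] W(2) by simp
  then have "weight \<rho> a \<noteq> 0" using weight_u[OF assms(3)] by (simp add: weight_add)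
  then show ?thesis
    using assms(1) unfolding weight_def var_exps_def by (auto simp: finite_cov)
qed

lemma lookup_Inv: "lookup (\<Sum>v \<in> Inv. single v t) v = (if v \<in> Inv then t else 0)"
  by (simp add: lookup_sum lookup_single when_def finite_Inv)

text \<open>If a contains a vertex of \<open>Blk\<close>, this vertex and inverted ones form the
  missing window. Otherwise a supplies a variable from each residue class still required, and
  \<open>wnd_shift\<close> gathers these into a window starting at t, or at t + k if x_(m + t)
  divides a.\<close>

lemma colon_supset:
  assumes a: "a \<in> exps n" and meet: "\<And>\<rho>. \<rho> \<in> {t..<t + m} \<Longrightarrow> a \<in> var_exps n (cov \<rho>)"
  shows "a + u \<in> path_packs n m NN t"
proof -
  let ?inv = "\<Sum>v \<in> Inv. single v t"
  let ?G = "\<lambda>\<rho>. {v \<in> {1..<m + t}. v mod m = \<rho> mod m}"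
  have inv_exps: "?inv \<in> exps n"
    using Inv_subset N0_ge(3) by (intro exps_sum exps_single) auto
  show ?thesis
  proof (cases "\<exists>v \<in> Blk. lookup a v \<noteq> 0")
    case True
    then obtain v where v: "v \<in> Blk" "lookup a v \<noteq> 0" by blast
    \<comment> \<open>The first vertex of a block starts the window, the last vertex ends
      it.\<close>
    obtain i where i: "1 \<le> i" "i + m \<le> NN + 1" and rest: "\<And>w. i \<le> w \<Longrightarrow> w < i + m \<Longrightarrow> w = v \<or> w \<in> Inv"
    proof -
      have inv: "w \<in> Inv" if "N0 + l * (m + 1) + 2 \<le> w" "w \<le> N0 + l * (m + 1) + m" "l < j" for w l
      proof -
        define s where "s = w - (N0 + l * (m + 1))"
        have s: "w - N0 = l * (m + 1) + s" "2 \<le> s" "s \<le> m" using that(1,2) by (auto simp: s_def)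
        have "(w - N0) mod (m + 1) = s" unfolding s(1) mod_mult_self3 using s(3) by simp
        then have "w \<notin> Blk" using Blk_bounds(3)[of w] s(2) by auto
        moreover have "w \<le> NN" using that(2) block_le[OF that(3)] by (simp add: NN_def)
        ultimately show ?thesis using that(1) N0_ge by (simp add: Inv_def)
      qed
      from v(1) show thesis
      proof (cases rule: BlkE)
        case (1 l)
        show thesis
        proof (rule that[of v])
          show "v + m \<le> NN + 1" using 1 block_le[of l] by (simp add: NN_def)
          show "w = v \<or> w \<in> Inv" if "v \<le> w" "w < v + m" for w
            using inv[of l w] 1 that by fastforce
        qed (use 1 in simp)
      next
        case (2 l)
        show thesis
        proof (rule that[of "N0 + l * (m + 1) + 2"])
          show "N0 + l * (m + 1) + 2 + m \<le> NN + 1" using 2 block_le[of l] by (simp add: NN_def)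
          show "w = v \<or> w \<in> Inv" if "N0 + l * (m + 1) + 2 \<le> w" "w < N0 + l * (m + 1) + 2 + m" for w
            using inv[of l w] 2 that by fastforce
        qed simp
      qed
    qed
    have "(\<Sum>i \<in> {1..<t}. wnd n m (Suc i)) + (a + ?inv) \<in> path_packs n m NN t"
    proof (rule packs_witness[of t _ _ i])
      show "Suc i \<in> {1..NN + 1 - m}" if "i \<in> {1..<t}" for i using that N0_ge by auto
      show "i \<in> {1..NN + 1 - m}" using i by auto
      show "lookup (wnd n m i) w \<le> lookup (a + ?inv) w" for w
        using rest[of w] v(2) i N0_ge(3) t1 by (auto simp: lookup_wnd lookup_add lookup_Inv)
    qed (use t1 a inv_exps in auto)
    then show ?thesis by (simp add: u_def ac_simps)
  next
    case noBlk: False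
    \<comment> \<open>If x_(m + t) is available, it accounts for all \<rho> < t + k. The window from
      t + k then consists of the gathered positions, of m + t, and of inverted vertices up to
      \<open>N0\<close>.\<close>
    define y where "y \<longleftrightarrow> k \<ge> 1 \<and> lookup a (m + t) \<noteq> 0"
    define R where "R = (if y then {t + k..<t + m} else {t..<t + m})"
    define i0 where "i0 = (if y then t + k else t)"
    have R: "R \<subseteq> {t..<t + m}" by (auto simp: R_def)
    have "\<exists>v. v \<in> ?G \<rho> \<and> lookup a v \<noteq> 0" if \<rho>: "\<rho> \<in> R" for \<rho>
    proof -
      obtain v where v: "v \<in> cov \<rho>" "lookup a v \<noteq> 0"
        using meet[OF subsetD[OF R \<rho>]] by (auto simp: var_exps_def)
      have "\<not> (\<rho> < t + k \<and> v = m + t)"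
        using v(2) \<rho> by (auto simp: R_def y_def split: if_splits)
      then show ?thesis using v noBlk by (auto simp: cov_def split: if_splits)
    qed
    then have "\<forall>\<rho> \<in> R. \<exists>v. v \<in> ?G \<rho> \<and> lookup a v \<noteq> 0" by blast
    then obtain c where c: "\<And>\<rho>. \<rho> \<in> R \<Longrightarrow> c \<rho> \<in> ?G \<rho> \<and> lookup a (c \<rho>) \<noteq> 0"
      using bchoice[of R "\<lambda>\<rho> v. v \<in> ?G \<rho> \<and> lookup a v \<noteq> 0"] by blast
    have finR: "finite R" by (simp add: R_def)
    have cR: "1 \<le> c \<rho> \<and> c \<rho> < t + m \<and> c \<rho> mod m = \<rho> mod m" if "\<rho> \<in> R" for \<rho>
      using c[OF that] by auto
    have "0 < m" "t + m \<le> n + 1" using m2 N0_ge by auto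
    then obtain f where f: "\<And>i. i \<in> {1..<t} \<Longrightarrow> f i = i \<or> f i = Suc i"
      "(\<Sum>i \<in> {1..<t}. wnd n m (Suc i)) + (\<Sum>\<rho> \<in> R. single (c \<rho>) 1)
        = (\<Sum>i \<in> {1..<t}. wnd n m (f i)) + (\<Sum>\<rho> \<in> R. single \<rho> 1)"
      by (rule wnd_shift[OF _ _ R cR]) blast+
    let ?x = "\<Sum>\<rho> \<in> R. single (c \<rho>) (1 :: nat)" and ?r = "\<Sum>\<rho> \<in> R. single \<rho> (1 :: nat)"
    have inj: "\<rho> = \<sigma>" if "\<rho> \<in> R" "\<sigma> \<in> R" "c \<rho> = c \<sigma>" for \<rho> \<sigma>
    proof (rule mod_eq_interval_unique[of _ m _ t])
      show "\<rho> mod m = \<sigma> mod m" using c[OF that(1)] c[OF that(2)] that(3) by auto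
    qed (use R that in auto)
    have lx: "lookup ?x v = (if v \<in> c ` R then 1 else 0)" for v
    proof -
      have "lookup ?x v = card {\<rho> \<in> R. c \<rho> = v}"
        using finR by (simp add: lookup_sum lookup_single when_def sum.inter_filter[symmetric])
      moreover have "{\<rho> \<in> R. c \<rho> = v} = {\<rho>}" if "\<rho> \<in> R" "c \<rho> = v" for \<rho>
        using that inj by blast
      moreover have "{\<rho> \<in> R. c \<rho> = v} = {}" if "v \<notin> c ` R" using that by blast
      ultimately show ?thesis by (cases "v \<in> c ` R") auto
    qed
    have ax: "a = ?x + (a - ?x)"
      by (rule poly_mapping_eqI) (use c lx in \<open>auto simp: lookup_add lookup_minus\<close>)
    let ?z = "?r + (a - ?x) + ?inv"
    have r_exps: "?r \<in> exps n"
    proof (intro exps_sum exps_single)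
      fix \<rho> assume "\<rho> \<in> R"
      then show "\<rho> \<in> {1..n}" using subsetD[OF R, of \<rho>] N0_ge t1 by simp
    qed
    have "(\<Sum>i \<in> {1..<t}. wnd n m (f i)) + ?z \<in> path_packs n m NN t"
    proof (rule packs_witness[of t _ _ i0])
      show "f i \<in> {1..NN + 1 - m}" if "i \<in> {1..<t}" for i using f(1)[OF that] that N0_ge by auto
      have i0: "1 \<le> i0" "i0 + m \<le> N0 + 1" using N0_ge t1 by (auto simp: i0_def)
      then show "i0 \<in> {1..NN + 1 - m}" using N0_ge by auto
      show "?z \<in> exps n"
        using exps_minus[OF a] inv_exps r_exps by (simp only: exps_add_iff simp_thms)
      show "lookup (wnd n m i0) v \<le> lookup ?z v" for v
      proof (cases "i0 \<le> v \<and> v < i0 + m")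
        case True
        have "v \<in> R \<or> (y \<and> v = m + t) \<or> v \<in> Inv"
        proof (cases "v < t + m")
          case False
          then have y: "y" using True by (auto simp: i0_def split: if_splits)
          have "v \<le> N0" using True i0 by simp
          then have "v \<notin> Blk" using Blk_bounds(1)[of v] by auto
          then show ?thesis using False y \<open>v \<le> N0\<close> N0_ge(2) by (auto simp: Inv_def)
        qed (use True in \<open>auto simp: R_def i0_def split: if_splits\<close>)
        moreover have "lookup ?r v \<ge> 1" if "v \<in> R"
          using that finR by (simp add: lookup_sum lookup_single when_def)
        moreover have "lookup (a - ?x) v \<ge> 1" if "y" "v = m + t"
        proof -
          have "v \<notin> c ` R" using c that(2) by fastforce
          then show ?thesis using that lx by (auto simp: lookup_minus y_def)
        qed
        moreover have "lookup ?inv v \<ge> 1" if "v \<in> Inv" using that t1 by (simp add: lookup_Inv)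
        ultimately have "1 \<le> lookup ?z v" unfolding lookup_add by fastforce
        then show ?thesis using i0 N0_ge by (simp add: lookup_wnd)
      next
        case False
        then show ?thesis using i0 N0_ge by (auto simp: lookup_wnd)
      qed
    qed (use t1 in auto)
    also have "(\<Sum>i \<in> {1..<t}. wnd n m (f i)) + ?z = ((\<Sum>i \<in> {1..<t}. wnd n m (f i)) + ?r) + (a - ?x) + ?inv"
      by (simp only: ac_simps)
    also have "\<dots> = (\<Sum>i \<in> {1..<t}. wnd n m (Suc i)) + (?x + (a - ?x)) + ?inv"
      unfolding f(2)[symmetric] by (simp only: ac_simps)
    also have "\<dots> = a + u" unfolding ax[symmetric] u_def by (simp only: ac_simps)
    finally show ?thesis .
  qed
qed

lemma Union_cov: "(\<Union>\<rho> \<in> {t..<t + m}. cov \<rho>) = {1..<m + t} \<union> (if k \<ge> 1 then {m + t} else {}) \<union> Blk"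
proof (rule subset_antisym)
  have "v \<in> (\<Union>\<rho> \<in> {t..<t + m}. cov \<rho>)" if "v \<in> {1..<m + t}" for v
  proof -
    obtain \<rho> where "t \<le> \<rho>" "\<rho> < t + m" "\<rho> mod m = v mod m" using ex_mod_in_interval[of m t v] m2 by auto
    then show ?thesis using that by (intro UN_I[of \<rho>]) (auto simp: cov_def)
  qed
  moreover have "t \<in> {t..<t + m}" using m2 by simp
  moreover have "(if k \<ge> 1 then {m + t} else {}) \<union> Blk \<subseteq> cov t" by (auto simp: cov_def)
  ultimately show "{1..<m + t} \<union> (if k \<ge> 1 then {m + t} else {}) \<union> Blk \<subseteq> (\<Union>\<rho> \<in> {t..<t + m}. cov \<rho>)"
    by blast
qed (auto simp: cov_def split: if_splits)

lemma card_Union_cov: "card (\<Union>\<rho> \<in> {t..<t + m}. cov \<rho>) = m + t - 1 + min k 1 + 2 * j"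
proof -
  let ?G = "{1..<m + t} \<union> (if k \<ge> 1 then {m + t} else {})"
  have "?G \<inter> Blk = {}"
    using Blk_bounds(1) N0_ge(4) by (fastforce split: if_splits)
  then have "card (?G \<union> Blk) = card ?G + 2 * j"
    using finite_Blk card_Blk by (subst card_Un_disjoint) auto
  moreover have "card ?G = m + t - 1 + min k 1" by (cases "k \<ge> 1") auto
  ultimately show ?thesis unfolding Union_cov by simp
qed

text \<open>Colons by monomials preserve vanishing, so it suffices that vanishing fails for the
  intersection of the m primes. Its depth is n + m - 1 minus the cardinality in
  \<open>card_Union_cov\<close>, that is n - t - \<open>min k 1\<close> - 2 j.\<close>

lemma not_koszul_vanish:
  assumes "n < r + t + min k 1 + 2 * j"
  shows "\<not> mono_vanish TYPE('k::field) n r (path_packs n m NN t)"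
proof
  assume V: "mono_vanish TYPE('k) n r (path_packs n m NN t)"
  have "{a \<in> exps n. a + u \<in> path_packs n m NN t} = (\<Inter>\<rho> \<in> {t..<t + m}. var_exps n (cov \<rho>))"
  proof (intro Set.set_eqI iffI CollectI conjI INT_I)
    fix a assume a: "a \<in> (\<Inter>\<rho> \<in> {t..<t + m}. var_exps n (cov \<rho>))"
    have "t \<in> {t..<t + m}" using m2 by simp
    then have "a \<in> var_exps n (cov t)" using a by blast
    then show "a \<in> exps n" by (simp add: var_exps_def)
    then show "a + u \<in> path_packs n m NN t" using colon_supset a by blast
  qed (use colon_subset in auto)
  then have "mono_vanish TYPE('k) n r (\<Inter>\<rho> \<in> {t..<t + m}. var_exps n (cov \<rho>))"
    using koszul_vanish_colon_monom[OF u_exps upset_packs[OF n_pos] V] by simp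
  moreover have "mono_vanish TYPE('k) n r (\<Inter>\<rho> \<in> {t..<t + m}. var_exps n (cov \<rho>))
    \<longleftrightarrow> r + card (\<Union>\<rho> \<in> {t..<t + m}. cov \<rho>) + 1 \<le> n + card {t..<t + m}"
  \<comment> \<open>The elements of \<open>{t..<t + m}\<close> have distinct residues and lie below
    m + t, so \<rho> is private to \<open>cov \<rho>\<close>.\<close>
  proof (rule koszul_vanish_Int_primes[where p = id])
    show "cov \<rho> \<subseteq> {1..n}" if "\<rho> \<in> {t..<t + m}" for \<rho>
      using cov_subset[OF that] N0_ge(3) by auto
    show "id \<rho> \<in> cov \<rho>" if "\<rho> \<in> {t..<t + m}" for \<rho>
      using that t1 by (auto simp: cov_def)
    show "id \<rho> \<notin> cov \<sigma>" if "\<rho> \<in> {t..<t + m}" "\<sigma> \<in> {t..<t + m}" "\<sigma> \<noteq> \<rho>" for \<rho> \<sigma>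
      using mod_eq_interval_unique[of \<rho> m \<sigma> t] that Blk_bounds(1)[of \<rho>] N0_ge(1)
      by (auto simp: cov_def split: if_splits)
  qed (use m2 in auto)
  ultimately show False using assms unfolding card_Union_cov using m2 by simp
qed

end

lemma not_koszul_vanish_path_packs:
  assumes m: "m \<ge> 2" and N: "m \<le> N" "N \<le> n" and t: "t \<ge> 1"
  shows "\<not> mono_vanish TYPE('k::field) n (Suc (path_depth n m N t)) (path_packs n m N t)"
  using t
proof (induction t rule: less_induct)
  case (less t)
  have n0: "n > 0" using m N by simp
  show ?case
  proof (cases "t \<le> N + 1 - m")
    case True
    \<comment> \<open>Division with remainder fits the path into the locale, with \<open>NN\<close>
      = N.\<close>
    define p j k where "p = N + 1 - m - t" and "j = p div (m + 1)" and "k = p mod (m + 1)"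
    have p: "p = j * (m + 1) + k" unfolding j_def k_def by (rule div_mult_mod_eq[symmetric])
    have k: "k \<le> m" using mod_less_divisor[of "m + 1" p] by (simp add: k_def)
    have Np: "N = p + (m + t - 1)" using True less.prems N by (simp add: p_def)
    then have Njk: "N = j * (m + 1) + (m + t + k - 1)" using p m by simp
    interpret path_colon n m t j k
      by unfold_locales (use m less.prems k Njk N in auto)
    have NN: "NN = N" using Njk by (simp add: NN_def N0_def)
    have "phi_nat m p = (j + 1) * (m - 1) + (k - 1)" by (simp only: phi_nat_def j_def k_def)
    moreover have "(j + 1) * (m - 1) + 2 * (j + 1) = (j + 1) * (m + 1)"
    proof -
      have "(j + 1) * (m - 1) + 2 * (j + 1) = (j + 1) * (m - 1 + 2)" by (simp only: distrib_left mult.commute)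
      also have "m - 1 + 2 = m + 1" using m by simp
      finally show ?thesis .
    qed
    ultimately have "phi_nat m p + min k 1 + 2 * j + 2 + t = N + 2"
      using Njk m by (cases k) auto
    then have "n < Suc (path_depth n m N t) + t + min k 1 + 2 * j"
      using N by (simp add: path_depth_def p_def)
    then show ?thesis by (rule not_koszul_vanish[unfolded NN])
  next
    case False
    \<comment> \<open>Here p is truncated to 0 for t and for t - 1, so the bound stays the same,
      while the colon by the last window lowers t by one.\<close>
    obtain t' where t': "t = Suc t'" using less.prems by (cases t) auto
    have "t' \<ge> 1" using False t' N by simp
    have "N + 1 - m - t = N + 1 - m - t'" using False t' by simp
    then have d: "path_depth n m N t = path_depth n m N t'" by (simp add: path_depth_def)
    show ?thesis
    proof
      assume V: "mono_vanish TYPE('k) n (Suc (path_depth n m N t)) (path_packs n m N t)"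
      have "{a \<in> exps n. a + wnd n m (N + 1 - m) \<in> path_packs n m N t} = path_packs n m N t'"
        unfolding t' by (rule packs_remove_last_iff) (use N m n0 in auto)
      then have "mono_vanish TYPE('k) n (Suc (path_depth n m N t')) (path_packs n m N t')"
        using koszul_vanish_colon_monom[OF wnd_exps[OF n0] upset_packs[OF n0] V, of m "N + 1 - m"] d by simp
      then show False using less.IH[of t'] \<open>t' \<ge> 1\<close> t' by simp
    qed
  qed
qed

section \<open>Powers of the path ideal of a cycle\<close>

lemma mono_ideal_least:
  fixes K :: "'k::field mpoly set"
  assumes K: "ideal K (poly_ring n)" and U: "\<And>e. e \<in> U \<Longrightarrow> monom e \<in> K"
  shows "mono_ideal U \<subseteq> K"
proof
  fix p :: "'k mpoly" assume p: "p \<in> mono_ideal U"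
  have "p = (\<Sum>e \<in> keys p. single e (lookup p e))"
    by (rule poly_mapping_eqI) (auto simp: lookup_sum lookup_single when_def in_keys_iff)
  also have "\<dots> \<in> K"
  proof (rule ideal_sum[OF K])
    fix e assume "e \<in> keys p"
    then have "monom e \<in> K" using p U by (auto simp: mono_ideal_def)
    moreover have "single 0 (lookup p e) \<in> (pol n :: 'k mpoly set)"
      by (auto simp: mem_pol_iff)
    ultimately have "single 0 (lookup p e) * monom e \<in> K"
      using ideal_mult[OF K] by blast
    then show "single e (lookup p e) \<in> K"
      by (simp add: mult_single)
  qed
  finally show "p \<in> K" .
qed

lemma monom_mem_mono_ideal [simp]: "(monom e :: 'k::field mpoly) \<in> mono_ideal U \<longleftrightarrow> e \<in> U"
  by (simp add: mono_ideal_def)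

lemma monom_add: "(monom (a + b) :: 'k::field mpoly) = monom a * monom b"
  by (simp add: mult_single)

lemma prod_var_eq_monom: "(\<Prod>j \<in> A. var (f j)) = (monom (\<Sum>j \<in> A. single (f j) 1) :: 'k::field mpoly)"
  by (induction A rule: infinite_finite_induct) (simp_all add: var_def mult_single)

lemma cycle_path_ideal_eq:
  assumes n: "n > 0"
  shows "cycle_path_ideal n m = (mono_ideal (packs n m {1..n} 1) :: 'k::field mpoly set)"
proof -
  interpret R: cring "poly_ring n :: 'k mpoly ring" by (rule cring_poly_ring)
  let ?g = "(\<lambda>i. monom (wnd n m i)) ` {1..n} :: 'k mpoly set"
  have gen: "cycle_path_ideal n m = Idl\<^bsub>poly_ring n\<^esub> ?g"
    by (simp add: cycle_path_ideal_def prod_var_eq_monom wnd_def)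
  have gp: "?g \<subseteq> pol n" using wnd_exps[OF n] by auto
  have mem: "wnd n m i \<in> packs n m {1..n} 1" if "i \<in> {1..n}" for i
    using packs_add_wnd[OF that, of 0 n m 0] by (simp add: packs_0)
  show ?thesis
    unfolding gen
  proof
    show "Idl\<^bsub>poly_ring n\<^esub> ?g \<subseteq> mono_ideal (packs n m {1..n} 1)"
      by (rule R.genideal_minimal[OF ideal_mono_ideal[OF upset_packs[OF n]]]) (use mem in auto)
    show "mono_ideal (packs n m {1..n} 1) \<subseteq> Idl\<^bsub>poly_ring n\<^esub> ?g"
    proof (rule mono_ideal_least[OF R.genideal_ideal[OF gp]])
      fix e assume "e \<in> packs n m {1..n} 1"
      then obtain i c where ic: "e = c + wnd n m i" "i \<in> {1..n}" "c \<in> exps n"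
        unfolding One_nat_def packs_Suc packs_0 using add.commute by blast
      then have "monom (wnd n m i) \<in> Idl\<^bsub>poly_ring n\<^esub> ?g"
        using R.genideal_self[OF gp] by blast
      then show "monom e \<in> Idl\<^bsub>poly_ring n\<^esub> ?g"
        unfolding ic(1) monom_add
        using ideal_mult[OF R.genideal_ideal[OF gp], of "monom c"] ic(3) by simp
    qed
  qed
qed

lemma ideal_prod_mono_packs:
  assumes n: "n > 0"
  shows "mono_ideal (packs n m A t) \<cdot>\<^bsub>poly_ring n\<^esub> mono_ideal (packs n m A 1)
    = (mono_ideal (packs n m A (Suc t)) :: 'k::field mpoly set)"
proof
  interpret R: cring "poly_ring n :: 'k mpoly ring" by (rule cring_poly_ring)
  let ?I = "mono_ideal (packs n m A t) :: 'k mpoly set" and ?J = "mono_ideal (packs n m A 1) :: 'k mpoly set"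
  let ?P = "?I \<cdot>\<^bsub>poly_ring n\<^esub> ?J"
  have id: "ideal (mono_ideal (packs n m A s) :: 'k mpoly set) (poly_ring n)" for s
    by (rule ideal_mono_ideal[OF upset_packs[OF n]])
  have idP: "ideal ?P (poly_ring n)" by (rule R.ideal_prod_is_ideal[OF id id])
  show "?P \<subseteq> mono_ideal (packs n m A (Suc t))"
  proof
    fix s assume "s \<in> ?P"
    then show "s \<in> mono_ideal (packs n m A (Suc t))"
    proof induction
      case (prod p q)
      have "a + b \<in> packs n m A (Suc t)" if "a \<in> packs n m A t" and b: "b \<in> packs n m A 1" for a b
      proof -
        obtain i c where ic: "b = wnd n m i + c" "i \<in> A" "c \<in> exps n"
          using b unfolding One_nat_def packs_Suc packs_0 by blast
        have "a + wnd n m i + c \<in> packs n m A (Suc t)"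
          by (rule packs_up[OF n packs_add_wnd[OF ic(2) that(1)] ic(3)])
        then show ?thesis by (simp add: ic(1) add.assoc)
      qed
      then show ?case
        using prod keys_mult[of p q] by (fastforce simp: mono_ideal_def)
    next
      case (sum p q)
      then show ?case using ideal_add[OF id] by simp
    qed
  qed
  show "mono_ideal (packs n m A (Suc t)) \<subseteq> ?P"
  proof (rule mono_ideal_least[OF idP])
    fix e assume "e \<in> packs n m A (Suc t)"
    then obtain i a where ia: "e = a + wnd n m i" "i \<in> A" "a \<in> packs n m A t"
      unfolding packs_Suc using add.commute by blast
    have "wnd n m i \<in> packs n m A 1"
      using packs_add_wnd[OF ia(2), of 0 n m 0] by (simp add: packs_0)
    then show "monom e \<in> ?P"
      unfolding ia(1) monom_add using ideal_prod.prod[of "monom a" ?I "monom (wnd n m i)" ?J "poly_ring n"] ia(3)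
      by simp
  qed
qed

lemma ideal_power_cycle_path_ideal:
  assumes n: "n > 0"
  shows "ideal_power (poly_ring n) (cycle_path_ideal n m) t
    = (mono_ideal (packs n m {1..n} t) :: 'k::field mpoly set)"
proof (induction t)
  case 0
  show ?case
    by (simp add: ideal_power_def nat_pow_def ideals_set_def packs_0 pol_eq_mono_ideal)
next
  case (Suc t)
  have "ideal_power (poly_ring n) (cycle_path_ideal n m) (Suc t)
      = ideal_power (poly_ring n) (cycle_path_ideal n m) t \<cdot>\<^bsub>poly_ring n\<^esub> (cycle_path_ideal n m :: 'k mpoly set)"
    by (simp add: ideal_power_def nat_pow_def ideals_set_def)
  also have "\<dots> = mono_ideal (packs n m {1..n} t) \<cdot>\<^bsub>poly_ring n\<^esub> mono_ideal (packs n m {1..n} 1)"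
    unfolding Suc.IH unfolding cycle_path_ideal_eq[OF n] ..
  finally show ?case unfolding ideal_prod_mono_packs[OF n] .
qed

text \<open>A window of the cycle that avoids n starts at n - m at the latest, so it is a window of
  the path on n - 1 vertices.\<close>

lemma cycle_packs_Un_up:
  assumes n: "n > m" "m \<ge> 1"
  shows "packs n m {1..n} t \<union> up n (single n 1)
    = path_packs n m (n - 1) t \<union> up n (single n 1)"
proof -
  have n0: "n > 0" using n by simp
  have "a \<in> path_packs n m (n - 1) t" if a: "a \<in> packs n m {1..n} t" "lookup a n = 0" for a
  proof -
    obtain W c where W: "set_mset W \<subseteq> {1..n}" "size W = t" "c \<in> exps n" "a = (\<Sum>i \<in># W. wnd n m i) + c"
      using a(1) by (rule packsE)
    have "i \<in> {1..n - 1 + 1 - m}" if i: "i \<in># W" for i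
    proof (rule ccontr)
      assume "i \<notin> {1..n - 1 + 1 - m}"
      then have "n \<in> {i..<i + m}" using W(1) i n by auto
      moreover have "cyc n n = n" using n0 by (simp add: cyc_def)
      ultimately have "lookup (wnd n m i) n \<noteq> 0"
        by (auto simp: wnd_def lookup_sum lookup_single when_def)
      then have "lookup a n \<noteq> 0"
        using lookup_sum_mset_wnd_ge[OF i, of n m n] by (simp add: W(4) lookup_add)
      then show False using a(2) by simp
    qed
    then show ?thesis using packsI[of W _ t c] W by blast
  qed
  moreover have "a \<in> packs n m {1..n} t" if "a \<in> path_packs n m (n - 1) t" for a
    by (rule subsetD[OF packs_mono that]) (use n in auto)
  moreover have "a \<in> exps n" if "a \<in> packs n m {1..n} t" for a
    using packs_exps[OF n0 that] .
  moreover have "a \<in> up n (single n 1)" if "a \<in> exps n" "lookup a n \<noteq> 0" for a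
    using up_single[of n n] n0 that by (simp add: var_exps_def)
  ultimately show ?thesis by blast
qed

lemma mono_ideal_subset_graded_max_ideal:
  assumes "U \<subseteq> exps n" "0 \<notin> U"
  shows "mono_ideal U \<subseteq> (graded_max_ideal n :: 'k::field mpoly set)"
proof (rule mono_ideal_least[OF ideal_graded_max_ideal])
  fix e assume e: "e \<in> U"
  then obtain v where v: "lookup e v \<noteq> 0"
    using assms(2) by (metis lookup_zero poly_mapping_eqI)
  have "e \<in> exps n" using e assms(1) by (rule subsetD[rotated])
  then have vn: "v \<in> {1..n}" using exps_lookup[of e n v] v by metis
  have eq: "e = (e - single v 1) + single v 1"
    using v by (intro poly_mapping_eqI) (auto simp: lookup_add lookup_minus lookup_single when_def)
  have "monom (e - single v 1) * var v \<in> (graded_max_ideal n :: 'k mpoly set)"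
    by (rule ideal_mult[OF ideal_graded_max_ideal _ var_graded_max_ideal[OF vn]])
      (use e assms(1) exps_minus in auto)
  then show "monom e \<in> (graded_max_ideal n :: 'k mpoly set)"
    by (subst eq) (simp add: monom_add var_def)
qed

text \<open>For c = 0 and c = 1 this shows that J^t and (J^t : x_n) are proper. A window has m \<ge>
  2 vertices, one of which differs from n.\<close>

lemma single_notin_cycle_packs:
  assumes n: "n > m" "m \<ge> 2" and t: "t \<ge> 1"
  shows "single n c \<notin> packs n m {1..n} t"
proof
  assume "single n c \<in> packs n m {1..n} t"
  then obtain W b where W: "set_mset W \<subseteq> {1..n}" "size W = t" "single n c = (\<Sum>i \<in># W. wnd n m i) + b"
    by (rule packsE)
  obtain i where i: "i \<in># W" using W(2) t by (metis multiset_nonemptyE not_one_le_zero size_empty)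
  \<comment> \<open>The first vertex of the window, or the second if the first is n.\<close>
  define v where "v = cyc n (if i = n then n + 1 else i)"
  have "v \<noteq> n"
  proof (cases "i = n")
    case False
    then have "1 \<le> i" "i < n" using W(1) i by (auto simp: order.strict_iff_order)
    then show ?thesis by (simp add: v_def cyc_def)
  qed (use n in \<open>simp add: v_def cyc_def\<close>)
  moreover have "lookup (wnd n m i) v \<noteq> 0"
    using n by (auto simp: wnd_def lookup_sum lookup_single when_def v_def)
  moreover have "lookup (wnd n m i) v \<le> lookup (single n c) v"
    using lookup_sum_mset_wnd_ge[OF i, of n m v] by (simp add: W(3) lookup_add)
  ultimately show False by (simp add: lookup_single when_def)
qed

text \<open>For N = n - 1 and t \<le> n - m one has N - t + 2 = (j + 1) (m + 1) + k, so the floor is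
  j + 1 and the ceiling exceeds it by \<open>min k 1\<close>; this excess is what the truncated
  difference in \<open>phi_nat\<close> takes off k.\<close>

lemma phi_eq_phi_nat:
  assumes n: "n > m" and m: "m \<ge> 2"
  shows "phi (int n - 1) (int m) (int t) = int (phi_nat m (n - m - t))"
proof (cases "t \<le> n - m")
  case True
  define p j k where "p = n - m - t" and "j = p div (m + 1)" and "k = p mod (m + 1)"
  have p: "p = j * (m + 1) + k" unfolding j_def k_def by (rule div_mult_mod_eq[symmetric])
  have k: "k \<le> m" using mod_less_divisor[of "m + 1" p] by (simp add: k_def)
  have s: "int n - 1 - int t + 2 = (int j + 1) * (int m + 1) + int k"
    using True p n by (simp add: p_def algebra_simps of_nat_diff flip: of_nat_add of_nat_mult)
  let ?x = "real_of_int (int n - 1 - int t + 2) / real_of_int (int m + 1)"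
  have x: "?x = real j + 1 + real k / (real m + 1)"
    unfolding s by (simp add: field_simps)
  have k1: "0 \<le> real k / (real m + 1)" "real k / (real m + 1) < 1" using k by (simp_all add: field_simps)
  have fl: "\<lfloor>?x\<rfloor> = int j + 1" unfolding x using k1 by (intro floor_unique) auto
  have cl: "\<lceil>?x\<rceil> = int j + 1 + int (min k 1)"
  proof (cases "k = 0")
    case False
    then have "0 < real k / (real m + 1)" by simp
    then show ?thesis unfolding x using k1 False by (intro ceiling_unique) auto
  next
    case True
    then show ?thesis unfolding x by simp
  qed
  have "phi (int n - 1) (int m) (int t) = (int j + 1) * (int m + 1) + int k - (int j + 1) - (int j + 1 + int (min k 1))"
    unfolding phi_def fl cl using s True n by simp
  also have "\<dots> = int (phi_nat m p)"
  proof -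
    have m1: "int (m - 1) = int m - 1" using m by simp
    have "int (phi_nat m p) = (int j + 1) * (int m - 1) + int (k - 1)"
      unfolding phi_nat_def j_def[symmetric] k_def[symmetric] by (simp only: of_nat_add of_nat_mult of_nat_1 m1)
    then show ?thesis by (cases k) (simp_all add: algebra_simps)
  qed
  finally show ?thesis by (simp add: p_def)
next
  case False
  then have "\<not> int t \<le> int n - 1 + 1 - int m" "n - m - t = 0" using n by linarith+
  then show ?thesis using m phi_nat_small[of 0 m] by (simp add: phi_def of_nat_diff)
qed

theorem theorem2p10:
  fixes n m t :: nat and J :: "'k::field mpoly set"
  assumes "n > m" and "m \<ge> 2" and "t \<ge> 1"
    and "J = cycle_path_ideal n m"
  shows "ereal_of_enat (depth_quot n (ideal_power (poly_ring n) J t))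
           \<le> ereal (real_of_int (phi (int n - 1) (int m) (int t) + 1))
    \<and> (depth_quot n (colon_ideal (poly_ring n) (ideal_power (poly_ring n) J t) (var n))
           > depth_quot n (ideal_power (poly_ring n) J t)
         \<longrightarrow> ereal_of_enat (depth_quot n (ideal_power (poly_ring n) J t))
               = ereal (real_of_int (phi (int n - 1) (int m) (int t))))"
proof -
  have n0: "n > 0" using assms(1) by simp
  define U where "U = packs n m {1..n} t"
  define U' where "U' = {a \<in> exps n. a + single n 1 \<in> U}"
  let ?B = "mono_ideal U :: 'k mpoly set" and ?A = "mono_ideal U' :: 'k mpoly set"
  let ?C = "mono_ideal (U \<union> up n (single n 1)) :: 'k mpoly set"
  \<comment> \<open>By \<open>VC\<close> this is the depth of S/(J^t, x_n).\<close>
  define g where "g = phi_nat m (n - m - t)"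
  have B: "ideal_power (poly_ring n) J t = ?B"
    unfolding assms(4) U_def by (rule ideal_power_cycle_path_ideal[OF n0])
  have nn: "n \<in> {1..n}" using n0 by simp
  have sn: "single n 1 \<in> exps n" using nn by simp
  have A: "colon n (ideal_power (poly_ring n) J t) (var n) = ?A"
    unfolding B U'_def var_def by (rule colon_mono_ideal[OF sn])
  have upU: "upset n U" unfolding U_def by (rule upset_packs[OF n0])
  have upU': "upset n U'" unfolding U'_def by (rule upset_colon[OF upU])
  have not0: "0 \<notin> U" "0 \<notin> U'"
    using single_notin_cycle_packs[OF assms(1-3), of 0] single_notin_cycle_packs[OF assms(1-3), of 1]
    by (auto simp: U_def U'_def)
  have "U \<subseteq> exps n" "U' \<subseteq> exps n" using upU upU' by (simp_all add: upset_def)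
  then have sub: "?B \<subseteq> graded_max_ideal n" "?A \<subseteq> graded_max_ideal n"
    using mono_ideal_subset_graded_max_ideal not0 by metis+
  have dB: "enat r \<le> depth_quot n ?B \<longleftrightarrow> koszul_vanish n r ?B"
    and dA: "enat r \<le> depth_quot n ?A \<longleftrightarrow> koszul_vanish n r ?A" for r
    using le_depth_quot_iff[OF ideal_mono_ideal[OF upU] sub(1)]
      le_depth_quot_iff[OF ideal_mono_ideal[OF upU'] sub(2)] by simp_all
  \<comment> \<open>In n variables the path power has depth g + 1, and x_n, which no window
    contains, is regular modulo it.\<close>
  have VC: "koszul_vanish n r ?C \<longleftrightarrow> r \<le> g" for r
  proof -
    have "koszul_vanish n r ?C \<longleftrightarrow> mono_vanish TYPE('k) n (Suc r) (path_packs n m (n - 1) t)"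
    proof -
      have "U \<union> up n (single n 1) = path_packs n m (n - 1) t \<union> up n (single n 1)"
        unfolding U_def by (rule cycle_packs_Un_up) (use assms in auto)
      moreover have "a \<in> path_packs n m (n - 1) t"
        if "a + single n 1 \<in> path_packs n m (n - 1) t" for a
        by (rule path_packs_remove_var[OF _ _ that]) (use n0 in auto)
      ultimately show ?thesis
        using koszul_vanish_mono_var[OF upset_packs[OF n0] nn, of m "{1..n - 1 + 1 - m}" t r, where 'k = 'k] by simp
    qed
    also have "\<dots> \<longleftrightarrow> Suc r \<le> path_depth n m (n - 1) t"
    proof
      show "Suc r \<le> path_depth n m (n - 1) t"
        if V: "mono_vanish TYPE('k) n (Suc r) (path_packs n m (n - 1) t)"
      proof (rule ccontr)
        assume "\<not> ?thesis"
        then have "koszul_vanish n (Suc (path_depth n m (n - 1) t)) (mono_ideal (path_packs n m (n - 1) t) :: 'k mpoly set)"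
          by (intro koszul_vanish_mono[OF V]) simp
        moreover have "m \<le> n - 1" "n - 1 \<le> n" using assms(1) by simp_all
        ultimately show False using not_koszul_vanish_path_packs[OF assms(2) _ _ assms(3)] by blast
      qed
    qed (rule koszul_vanish_path_packs[OF assms(2) _ n0]; use assms in auto)
    also have "\<dots> \<longleftrightarrow> r \<le> g"
    proof -
      have "\<not> n - 1 < m" "n - 1 + 1 - m - t = n - m - t" "n - (n - 1) = 1" using assms(1) by simp_all
      then show ?thesis by (simp only: path_depth_def g_def if_False) simp
    qed
    finally show ?thesis .
  qed
  have VBA: "koszul_vanish n r ?A" if "koszul_vanish n r ?B" for r
    unfolding U'_def by (rule koszul_vanish_colon_monom[OF sn upU that])
  have quot: "koszul_vanish n r ?C" if "koszul_vanish n (Suc r) ?A" "koszul_vanish n r ?B" for r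
    using koszul_vanish_mono_quotient[OF upU sn] that unfolding U'_def by blast
  have ext: "koszul_vanish n r ?B" if "koszul_vanish n r ?A" "koszul_vanish n r ?C" for r
    using koszul_vanish_mono_extension[OF upU sn] that unfolding U'_def by blast
  have "\<not> koszul_vanish n (Suc (Suc g)) ?B"
    using quot[of "Suc g"] VBA VC[of "Suc g"] koszul_vanish_mono[of n "Suc (Suc g)" ?B "Suc g"] by auto
  then have "depth_quot n ?B < enat (Suc (Suc g))" using dB not_le by blast
  then obtain d where d: "depth_quot n ?B = enat d" "d \<le> Suc g"
    by (cases "depth_quot n ?B") auto
  have phi: "phi (int n - 1) (int m) (int t) = int g"
    unfolding g_def by (rule phi_eq_phi_nat) (use assms in auto)
  have "d = g" if "depth_quot n ?A > depth_quot n ?B"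
  proof -
    have "enat (Suc d) \<le> depth_quot n ?A" using that d(1) by (metis Suc_ile_eq)
    then have VA: "koszul_vanish n (Suc d) ?A" using dA by blast
    have VB: "koszul_vanish n d ?B" "\<not> koszul_vanish n (Suc d) ?B"
      using dB[of d] dB[of "Suc d"] d(1) by auto
    \<comment> \<open>The extra degree of the colon ideal controls the connecting homomorphism,
      which gives d \<le> g. If d < g, both outer terms would vanish below d + 1, and so would the
      middle one.\<close>
    have "d \<le> g" using quot[OF VA VB(1)] VC by blast
    moreover have "\<not> Suc d \<le> g" using ext[OF VA] VB(2) VC by blast
    ultimately show ?thesis by simp
  qed
  then show ?thesis
    unfolding A unfolding B phi d(1) using d(2) by auto
qed

end
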